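(* Let $\epsilon\in\{\pm1\}$. Suppose that a function $h(x)$ satisfies the following conditions: - $h(x)$ is a $\mathcal C^\infty_{\rm poly}(\mathbb R_+^\times)$-mean-periodic real-valued function or an $\mathbf S(\mathbb R_+^\times)^*$-mean-periodic real-valued function on $\mathbb R_+^\times$ satisfying $h(x^{-1})=-\epsilon x h(x)$; - there exists $t_0>0$ such that $h(e^{-t})$ is of constant sign on $(t_0,+\infty)$; - the Mellin--Carleman transform $\mathsf{MC}(h)(s)$ of $h(x)$ has no poles in $(1/2+\delta,+\infty)$ for some $0\le\delta<w$, where $w$ is the positive real number in the definition of the class $\mathcal F$ (recalled in the context). Then all the poles of $\mathsf{MC}(h)(s)$ belong to the strip $|\mathrm{Re}(s)-1/2|\le\delta$. In particular, if $\mathsf{MC}(h)(s)$ does not have any poles on $(1/2,+\infty)$, namely $\delta=0$, then all the poles of $\mathsf{MC}(h)(s)$ are on the line $\mathrm{Re}(s)=1/2$.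
   Context: The number $w$ and the setting. $\mathcal F$ is the set of complex-valued functions $Z(s)=\gamma(s)D(s)$ with $\gamma,D$ meromorphic on $\mathbb C$ such that: all the poles of $Z$ belong to the vertical strip $|\mathrm{Re}(s)-1/2|\le w$ for some $w>0$; $|\gamma(\sigma+it)|\ll_{a,b,t_0}|t|^{-A}$ for all $\sigma\in[a,b]$, $|t|\ge t_0$, for all real $a\le b$ and every $A>0$; if $\sigma>1/2+w$ then $D(\sigma+it)\ll|t|^{A_1}$ for some real $A_1$; and there are a real $A_2$ and a strictly increasing sequence of positive reals $(t_m)_{m\ge1}$ with $|D(\sigma\pm it_m)|=O(t_m^{A_2})$ uniformly for $\sigma\in[1/2-w-\delta',1/2+w+\delta']$ for some $\delta'>0$ and all $m\ge1$. The proposition is stated in the setting of functions $h$ attached to elements $Z$ of $\mathcal F$, i.e. $h(x)=f_{Z}(x)-\epsilon x^{-1}f_{Z}(x^{-1})$ with $f_Z(x)=\frac1{2\pi i}\int_{(c)}Z(s)x^{-s}ds$, $c>1/2+w$. Spaces and mean-periodicity. $\mathbb R_+^\times=(0,\infty)$. $\mathcal C^\infty_{\exp}(\mathbb R)$ is the space of smooth functions on $\mathbb R$ such that for every $n\in\mathbb Z_{\ge0}$ there is $m\in\mathbb Z_{\ge0}$ with $f^{(n)}(x)=O(e^{m|x|})$ as $x\to\pm\infty$; it is topologized as an inductive limit of Fréchet spaces $F_m$ ($m\ge1$), the topology of $F_m$ being given by the seminorms $\sup_x|f^{(n)}(x)e^{-m|x|}|$, $n\ge0$. $\mathcal C^\infty_{\rm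 poly}(\mathbb R_+^\times)$ is the space of smooth functions on $\mathbb R_+^\times$ such that for every $n\in\mathbb Z_{\ge0}$ there is $m\in\mathbb Z$ with $f^{(n)}(t)=O(t^m)$ as $t\to+\infty$ and $t\to0^+$ (at most polynomial growth at both ends), with the topology making the bijection $\mathcal C^\infty_{\exp}(\mathbb R)\to\mathcal C^\infty_{\rm poly}(\mathbb R_+^\times)$, $f(t)\mapsto f(-\log x)$, a homeomorphism. $\mathbf S(\mathbb R_+^\times)$ is the Fréchet space of smooth $f$ on $\mathbb R_+^\times$ with $\sup_{x>0}|x^mf^{(n)}(x)|<\infty$ for all $m\in\mathbb Z$, $n\ge0$. $X^*$ denotes the topological dual (weak-$*$ topology); the dual of $\mathbf S(\mathbb R_+^\times)^*$ is identified with $\mathbf S(\mathbb R_+^\times)$. A locally integrable function $h$ with $h(x)=O(x^a)$ as $x\to+\infty$ and $O(x^{-a})$ as $x\to0^+$ for some $a\ge0$ is viewed as an element of $\mathbf S(\mathbb R_+^\times)^*$ via $g\mapsto\int_0^\infty g(x)h(x)\frac{dx}x$. Convolution: $(f\ast_\times\varphi)(x)=\langle f(x/\cdot),\varphi\rangle$; for functions $(f\ast_\times h)(x)=\int_0^\infty f(x/y)h(y)\frac{dy}y$. For $X=\mathcal C^\infty_{\rm poly}(\mathbb R_+^\times)$ or $\mathbf S(\mathbb R_+^\times)^*$, $h\in X$ is $X$-mean-periodic if there is a nonzero $\varphi\in X^*$ with $h\ast_\times\varphi=0$. Mellin--Carleman transform: if $h\ast_\times\varphi=0$ with $\varphi\neq0$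 (for instance $\varphi\in\mathbf S(\mathbb R_+^\times)$), put $h^+=h\cdot1_{(0,1)}$, $h^-=h\cdot1_{[1,\infty)}$ and $\mathsf M(\psi)(s)=\int_0^\infty\psi(x)x^s\frac{dx}x$ (i.e. $\langle x^s,\psi\rangle$); then $\mathsf{MC}(h)(s)=\mathsf M(\varphi\ast_\times h^+)(s)/\mathsf M(\varphi)(s)=-\mathsf M(\varphi\ast_\times h^-)(s)/\mathsf M(\varphi)(s)$. It is a meromorphic function, independent of the choice of $\varphi$.
   Formalization: C^∞_exp (hence C^∞_poly) is taken as the union of the F_m, one exponent m serving all derivatives; the set "for every n there is m" contains e.g. sin(e^x), which lies in no F_m, so it is not the inductive limit whose topology is prescribed. *)

theory Defs
  imports "HOL-Complex_Analysis.Complex_Analysis" "HOL-Library.Landau_Symbols"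
begin

subsection \<open>The class \<open>\<F>\<close>\<close>

text \<open>
  \<open>in_class_F w Z\<close> says that \<open>Z\<close> belongs to the class, with \<open>w\<close> the number bounding the strip
  that contains the poles of \<open>Z\<close>. Values of meromorphic functions at their poles are irrelevant:
  poles are always expressed through \<^const>\<open>is_pole\<close>.
\<close>

definition in_class_F :: "real \<Rightarrow> (complex \<Rightarrow> complex) \<Rightarrow> bool" where
  "in_class_F w Z \<longleftrightarrow> w > 0 \<and>
     (\<forall>s. is_pole Z s \<longrightarrow> \<bar>Re s - 1/2\<bar> \<le> w) \<and>
     (\<exists>\<gamma> D. \<gamma> meromorphic_on UNIV \<and> D meromorphic_on UNIV \<and> Z = (\<lambda>s. \<gamma> s * D s) \<and>
        (\<exists>t0>0. \<forall>a b. a \<le> b \<longrightarrow> (\<forall>A>0. \<exists>C. \<forall>\<sigma>\<in>{a..b}. \<forall>t. \<bar>t\<bar> \<ge> t0 \<longrightarrow>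
            norm (\<gamma> (Complex \<sigma> t)) \<le> C * \<bar>t\<bar> powr (- A))) \<and>
        (\<forall>\<sigma>>1/2 + w. \<exists>A1.
            (\<lambda>t. norm (D (Complex \<sigma> t))) \<in> O[at_top](\<lambda>t. \<bar>t\<bar> powr A1) \<and>
            (\<lambda>t. norm (D (Complex \<sigma> t))) \<in> O[at_bot](\<lambda>t. \<bar>t\<bar> powr A1)) \<and>
        (\<exists>A2 \<delta>' C. \<exists>tm :: nat \<Rightarrow> real. \<delta>' > 0 \<and> strict_mono tm \<and> (\<forall>m. tm m > 0) \<and>
            (\<forall>m. \<forall>\<sigma>\<in>{1/2 - w - \<delta>' .. 1/2 + w + \<delta>'}.
               norm (D (Complex \<sigma> (tm m))) \<le> C * tm m powr A2 \<and>
               norm (D (Complex \<sigma> (- tm m))) \<le> C * tm m powr A2)))"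


subsection \<open>Function spaces\<close>

definition nth_deriv :: "nat \<Rightarrow> (real \<Rightarrow> complex) \<Rightarrow> real \<Rightarrow> complex" where
  "nth_deriv n f = ((\<lambda>g x. vector_derivative g (at x)) ^^ n) f"

text \<open>Only used for open sets \<open>A\<close>.\<close>
definition smooth_on :: "real set \<Rightarrow> (real \<Rightarrow> complex) \<Rightarrow> bool" where
  "smooth_on A f \<longleftrightarrow> (\<forall>n. \<forall>x\<in>A. nth_deriv n f differentiable (at x))"

text \<open>
  The Frechet spaces \<open>F\<^sub>m\<close>, topologized by their seminorms.
\<close>

definition F_space :: "nat \<Rightarrow> (real \<Rightarrow> complex) set" where
  "F_space m = {f. smooth_on UNIV f \<and>
     (\<forall>n. bdd_above (range (\<lambda>x. norm (nth_deriv n f x) * exp (- (real m * \<bar>x\<bar>)))))}"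

definition F_seminorm :: "nat \<Rightarrow> nat \<Rightarrow> (real \<Rightarrow> complex) \<Rightarrow> real" where
  "F_seminorm m n f = (SUP x. norm (nth_deriv n f x) * exp (- (real m * \<bar>x\<bar>)))"

definition F_top :: "nat \<Rightarrow> (real \<Rightarrow> complex) topology" where
  "F_top m = topology_generated_by
     {{g \<in> F_space m. F_seminorm m n (\<lambda>x. g x - f x) < r} | f n r. f \<in> F_space m \<and> r > 0}"

text \<open>
  The space \<open>C\<^sup>\<infinity>\<^sub>e\<^sub>x\<^sub>p(\<real>)\<close> is the inductive limit of the \<open>F\<^sub>m\<close>, so its underlying set is their union:
  a single exponent \<open>m\<close> serves all derivatives. (A function such as \<open>sin (exp x)\<close>, whose derivatives
  need larger and larger exponents, lies in no \<open>F\<^sub>m\<close>; the inductive limit topology says nothing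
  about it.) The topology is the finest locally convex one for which all the inclusions of the
  \<open>F\<^sub>m\<close> are continuous; its convex open sets are exactly the convex sets that meet every \<open>F\<^sub>m\<close> in
  an open set.
\<close>

definition C_exp :: "(real \<Rightarrow> complex) set" where
  "C_exp = (\<Union>m\<in>{1..}. F_space m)"

definition fun_convex :: "(real \<Rightarrow> complex) set \<Rightarrow> bool" where
  "fun_convex U \<longleftrightarrow> (\<forall>f\<in>U. \<forall>g\<in>U. \<forall>c::real. 0 \<le> c \<and> c \<le> 1 \<longrightarrow>
      (\<lambda>x. of_real c * f x + of_real (1 - c) * g x) \<in> U)"

definition C_exp_top :: "(real \<Rightarrow> complex) topology" where
  "C_exp_top = topology_generated_by
     {U. U \<subseteq> C_exp \<and> fun_convex U \<and> (\<forall>m\<ge>1. openin (F_top m) (U \<inter> F_space m))}"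

text \<open>
  Functions on \<open>\<real>\<^sup>\<times>\<^sub>+ = (0,\<infinity>)\<close> are represented by functions on \<^typ>\<open>real\<close> that vanish outside
  \<open>(0,\<infinity>)\<close>; \<open>on_pos\<close> passes to that representative.
\<close>

definition on_pos :: "(real \<Rightarrow> complex) \<Rightarrow> real \<Rightarrow> complex" where
  "on_pos f = (\<lambda>x. if 0 < x then f x else 0)"

text \<open>
  \<open>C\<^sup>\<infinity>\<^sub>p\<^sub>o\<^sub>l\<^sub>y(\<real>\<^sup>\<times>\<^sub>+)\<close> and its topology are transported from \<open>C\<^sup>\<infinity>\<^sub>e\<^sub>x\<^sub>p(\<real>)\<close> by the change of variable
  \<open>x = exp (- t)\<close>.
\<close>

definition C_poly :: "(real \<Rightarrow> complex) set" where
  "C_poly = {f. on_pos f = f \<and> (\<lambda>t. f (exp (- t))) \<in> C_exp}"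

definition C_poly_top :: "(real \<Rightarrow> complex) topology" where
  "C_poly_top = pullback_topology C_poly (\<lambda>f t. f (exp (- t))) C_exp_top"

definition topological_dual :: "(real \<Rightarrow> complex) topology \<Rightarrow> ((real \<Rightarrow> complex) \<Rightarrow> complex) set" where
  "topological_dual T = {\<phi>. continuous_map T euclidean \<phi> \<and>
     (\<forall>f\<in>topspace T. \<forall>g\<in>topspace T. \<forall>a b. \<phi> (\<lambda>x. a * f x + b * g x) = a * \<phi> f + b * \<phi> g)}"

text \<open>The space \<open>S(\<real>\<^sup>\<times>\<^sub>+)\<close>.\<close>

definition schwartz :: "(real \<Rightarrow> complex) set" where
  "schwartz = {f. on_pos f = f \<and> smooth_on {0<..} f \<and>
     (\<forall>(m::int) n. bdd_above ((\<lambda>x. x powi m * norm (nth_deriv n f x)) ` {0<..}))}"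

text \<open>
  The functions that are viewed as elements of \<open>S(\<real>\<^sup>\<times>\<^sub>+)\<^sup>*\<close> through
  \<open>g \<mapsto> \<integral>\<^sub>0\<^sup>\<infinity> g(x) h(x) dx/x\<close>.
\<close>

definition tempered :: "(real \<Rightarrow> complex) \<Rightarrow> bool" where
  "tempered h \<longleftrightarrow>
     (\<forall>a b. 0 < a \<and> a \<le> b \<longrightarrow> set_integrable lebesgue {a..b} h) \<and>
     (\<exists>a\<ge>0. (\<lambda>x. norm (h x)) \<in> O[at_top](\<lambda>x. x powr a) \<and>
            (\<lambda>x. norm (h x)) \<in> O[at_right 0](\<lambda>x. x powr (- a)))"


subsection \<open>Convolution and mean-periodicity\<close>

definition mconv :: "(real \<Rightarrow> complex) \<Rightarrow> (real \<Rightarrow> complex) \<Rightarrow> real \<Rightarrow> complex" where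
  "mconv f g x = (LINT y:{0<..}|lebesgue. f (x / y) * g y / of_real y)"

text \<open>
  The dual of \<open>S(\<real>\<^sup>\<times>\<^sub>+)\<^sup>*\<close> is \<open>S(\<real>\<^sup>\<times>\<^sub>+)\<close>, so for it the annihilating elements are functions, and
  \<open>\<langle>h(x/\<cdot>), \<phi>\<rangle>\<close> is an integral.
\<close>

definition schwartz_annihilators :: "(real \<Rightarrow> complex) \<Rightarrow> (real \<Rightarrow> complex) set" where
  "schwartz_annihilators h =
     {\<phi> \<in> schwartz. \<phi> \<noteq> (\<lambda>_. 0) \<and> (\<forall>x>0. mconv h \<phi> x = 0)}"

definition C_poly_annihilators :: "(real \<Rightarrow> complex) \<Rightarrow> ((real \<Rightarrow> complex) \<Rightarrow> complex) set" where
  "C_poly_annihilators h =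
     {\<phi> \<in> topological_dual C_poly_top. (\<exists>f\<in>C_poly. \<phi> f \<noteq> 0) \<and>
        (\<forall>x>0. \<phi> (on_pos (\<lambda>y. h (x / y))) = 0)}"

definition schwartz_dual_mean_periodic :: "(real \<Rightarrow> complex) \<Rightarrow> bool" where
  "schwartz_dual_mean_periodic h \<longleftrightarrow> tempered h \<and> schwartz_annihilators h \<noteq> {}"

definition C_poly_mean_periodic :: "(real \<Rightarrow> complex) \<Rightarrow> bool" where
  "C_poly_mean_periodic h \<longleftrightarrow> on_pos h \<in> C_poly \<and> C_poly_annihilators h \<noteq> {}"


subsection \<open>The Mellin--Carleman transform\<close>

definition mellin :: "(real \<Rightarrow> complex) \<Rightarrow> complex \<Rightarrow> complex" where
  "mellin f s = (LINT x:{0<..}|lebesgue. f x * of_real x powr s / of_real x)"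

definition mellin_dual :: "((real \<Rightarrow> complex) \<Rightarrow> complex) \<Rightarrow> complex \<Rightarrow> complex" where
  "mellin_dual \<psi> s = \<psi> (on_pos (\<lambda>x. of_real x powr s))"

definition plus_part :: "(real \<Rightarrow> complex) \<Rightarrow> real \<Rightarrow> complex" where
  "plus_part h = (\<lambda>x. if 0 < x \<and> x < 1 then h x else 0)"

text \<open>
  \<open>\<psi> = \<phi> * u\<close> for \<open>\<phi>\<close> in the dual of \<open>C\<^sup>\<infinity>\<^sub>p\<^sub>o\<^sub>l\<^sub>y(\<real>\<^sup>\<times>\<^sub>+)\<close> and a function \<open>u\<close>: the convolution of
  distributions, \<open>\<langle>g, \<phi> * u\<rangle> = \<langle>\<langle>g(x y), u\<^sub>x\<rangle>, \<phi>\<^sub>y\<rangle>\<close> for test functions \<open>g\<close>, extended to an element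
  of the dual of \<open>C\<^sup>\<infinity>\<^sub>p\<^sub>o\<^sub>l\<^sub>y(\<real>\<^sup>\<times>\<^sub>+)\<close>. The extension is unique because \<open>S(\<real>\<^sup>\<times>\<^sub>+)\<close> is dense. For
  \<open>u = h\<^sup>+\<close> with \<open>h * \<phi> = 0\<close> it exists because \<open>\<phi> * h\<^sup>+ = - \<phi> * h\<^sup>-\<close> decreases rapidly at both ends.
\<close>

definition is_dual_conv ::
  "((real \<Rightarrow> complex) \<Rightarrow> complex) \<Rightarrow> (real \<Rightarrow> complex) \<Rightarrow> ((real \<Rightarrow> complex) \<Rightarrow> complex) \<Rightarrow> bool" where
  "is_dual_conv \<phi> u \<psi> \<longleftrightarrow> \<psi> \<in> topological_dual C_poly_top \<and>
     (\<forall>g\<in>schwartz.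
        \<psi> g = \<phi> (on_pos (\<lambda>y. LINT x:{0<..}|lebesgue. g (x * y) * u x / of_real x)))"

text \<open>
  \<open>is_MC h F\<close>: \<open>F\<close> is the Mellin--Carleman transform of \<open>h\<close>, computed from some annihilating \<open>\<phi>\<close>.
  Different choices of \<open>\<phi>\<close> give quotients that agree except at the (isolated) zeros of the
  denominators, where division by zero makes the value meaningless; this does not affect
  \<^const>\<open>is_pole\<close>.
\<close>

definition is_MC :: "(real \<Rightarrow> complex) \<Rightarrow> (complex \<Rightarrow> complex) \<Rightarrow> bool" where
  "is_MC h F \<longleftrightarrow>
     (tempered h \<and> (\<exists>\<phi>\<in>schwartz_annihilators h.
        F = (\<lambda>s. mellin (mconv \<phi> (plus_part h)) s / mellin \<phi> s))) \<or>
     (on_pos h \<in> C_poly \<and> (\<exists>\<phi>\<in>C_poly_annihilators h. \<exists>\<psi>. is_dual_conv \<phi> (plus_part h) \<psi> \<and>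
        F = (\<lambda>s. mellin_dual \<psi> s / mellin_dual \<phi> s)))"

end

theory Submission
  imports Defs
begin

text \<open>
  Put \<open>H u = h (exp (- u))\<close> and \<open>L s = \<integral>\<^sub>0\<^sup>\<infinity> H u exp (- s u) du\<close>. If \<open>\<phi>\<close> annihilates \<open>h\<close>, then the
  numerator \<open>A\<close> and the denominator \<open>B\<close> of the Mellin--Carleman transform are entire; computing
  \<open>\<phi> * h\<^sup>+\<close> directly gives \<open>A s = B s * L s\<close> for large \<open>Re s\<close>, and computing it as
  \<open>- \<phi> * h\<^sup>-\<close> gives \<open>A s = \<epsilon> * B s * L (1 - s)\<close> for very negative \<open>Re s\<close>, by the functional equation
  of \<open>h\<close>. As \<open>H\<close> is eventually of constant sign, by Landau's theorem the abscissa of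
  convergence of \<open>L\<close> is a singularity of \<open>A / B\<close>; real singularities beyond \<open>1/2 + \<delta>\<close> being excluded, \<open>L\<close> converges for \<open>Re s > 1/2 + \<delta>\<close>, and both identities extend to the half
  planes \<open>Re s > 1/2 + \<delta>\<close> and \<open>Re s < 1/2 - \<delta>\<close>.

  When \<open>\<phi>\<close> is only a functional, \<open>exp (- s t)\<close> is approximated by \<open>exp (- s t - q t\<^sup>2)\<close> with \<open>q \<rightarrow> 0\<close>, for
  which the defining property of \<open>\<phi> * h\<^sup>+\<close> is available.
\<close>

subsection \<open>Two-sided Laplace transforms\<close>

text \<open>Two obstacles shape the development. A continuous functional on \<open>C_poly\<close>
  comes without an integral representation, so Fubini's theorem does not carry it under an integral:
  its vanishing on single translates of \<open>H\<close> has to be transferred to superpositions of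
  translates by differentiating along a moving cut-off, and the factorization into
  \<open>B s\<close> times a transform appears only in the limit of the regularization. Moreover
  \<open>A / B\<close> has meaningless values at the zeros of \<open>B\<close>; identities are
  therefore kept in the product form \<open>A s = B s * L s\<close>, and \<open>B\<close> is
  cancelled only where isolated zeros permit it. Landau's theorem wants a function of one sign
  everywhere, whereas \<open>H\<close> has one only beyond \<open>t0\<close>; the part of
  \<open>H\<close> on (0, \<open>t0\<close>] has an entire transform and is split off.
  Differentiation under integrals and functionals always goes through the quadratic remainder bound
  below, which yields derivatives from plain inequalities.\<close>

lemma has_derivative_from_quadratic_bound:
  fixes F :: "'a::real_normed_vector \<Rightarrow> 'b::real_normed_vector"
  assumes "bounded_linear D" and "d > 0"
    and bound: "\<And>h. norm h < d \<Longrightarrow> norm (F (x + h) - F x - D h) \<le> K * (norm h)\<^sup>2"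
  shows "(F has_derivative D) (at x)"
proof -
  have "(\<lambda>h. norm (F (x + h) - F x - D h) / norm h) \<midarrow>0\<rightarrow> 0"
  proof (rule Lim_null_comparison[where g = "\<lambda>h. K * norm h"])
    have "\<forall>\<^sub>F h in at (0::'a). h \<in> ball 0 d"
      using \<open>d > 0\<close> by (intro eventually_at_in_open') auto
    then show "\<forall>\<^sub>F h in at 0. norm (norm (F (x + h) - F x - D h) / norm h) \<le> K * norm h"
    proof (rule eventually_mono)
      fix h :: 'a assume "h \<in> ball 0 d"
      then show "norm (norm (F (x + h) - F x - D h) / norm h) \<le> K * norm h"
        using bound[of h] by (cases "h = 0") (auto simp: field_simps power2_eq_square)
    qed
    show "(\<lambda>h::'a. K * norm h) \<midarrow>0\<rightarrow> 0"
      by (auto intro!: tendsto_eq_intros)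
  qed
  then show ?thesis
    using assms(1) by (simp add: has_derivative_at)
qed

lemma exp_diff_linear_le:
  fixes w :: complex
  shows "norm (exp w - 1 - w) \<le> (norm w)\<^sup>2 * exp (norm w)"
  using Taylor_exp_field[of w 1] by (simp add: mult.commute power2_eq_square algebra_simps)

text \<open>According to the sign of \<open>u\<close> one endpoint already dominates. Keeping both
  terms lets absolute convergence at two abscissae pass to all abscissae between them.\<close>

lemma exp_convex_bound:
  fixes u :: real
  assumes "\<sigma>1 \<le> \<sigma>" "\<sigma> \<le> \<sigma>2"
  shows "exp (- \<sigma> * u) \<le> exp (- \<sigma>1 * u) + exp (- \<sigma>2 * u)"
proof (cases "u \<ge> 0")
  case True
  then have "exp (- \<sigma> * u) \<le> exp (- \<sigma>1 * u)"
    using assms by (auto intro: mult_right_mono)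
  then show ?thesis by (simp add: add_increasing2)
next
  case False
  then have "exp (- \<sigma> * u) \<le> exp (- \<sigma>2 * u)"
    using assms by (auto intro: mult_right_mono_neg)
  then show ?thesis by (simp add: add_increasing)
qed

text \<open>Over the whole line rather than a half line: the transforms of an annihilator, of a
  one-sided part of \<open>h\<close> and of their convolution all have this form, and under x = exp
  (- u) it is the Mellin transform.\<close>

definition laplace :: "(real \<Rightarrow> complex) \<Rightarrow> complex \<Rightarrow> complex" where
  "laplace f s = (LINT u|lebesgue. f u * exp (- s * of_real u))"

text \<open>Measurability of \<open>f\<close> is demanded separately, because integrability of the
  weighted norm alone does not imply it.\<close>

definition laplace_abs :: "(real \<Rightarrow> complex) \<Rightarrow> real \<Rightarrow> bool" where
  "laplace_abs f \<sigma> \<longleftrightarrow> f \<in> borel_measurable lebesgue \<and>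
     integrable lebesgue (\<lambda>u. norm (f u) * exp (- \<sigma> * u))"

lemma laplace_absD [measurable_dest]: "laplace_abs f \<sigma> \<Longrightarrow> f \<in> borel_measurable lebesgue"
  by (simp add: laplace_abs_def)

lemma continuous_imp_lebesgue_measurable:
  fixes f :: "real \<Rightarrow> 'a::real_normed_vector"
  assumes "continuous_on UNIV f"
  shows "f \<in> borel_measurable lebesgue"
  using measurable_completion[of f lborel borel] borel_measurable_continuous_onI[OF assms] by simp

lemma laplace_absI:
  assumes "f \<in> borel_measurable lebesgue" "integrable lebesgue G"
    and "\<And>u. norm (f u) * exp (- \<sigma> * u) \<le> G u"
  shows "laplace_abs f \<sigma>"
  unfolding laplace_abs_def
proof (intro conjI assms(1))
  have [measurable]: "(\<lambda>u::real. exp (- \<sigma> * u)) \<in> borel_measurable lebesgue"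
    by (intro continuous_imp_lebesgue_measurable continuous_intros)
  note assms(1)[measurable]
  have "(\<lambda>u. norm (f u) * exp (- \<sigma> * u)) \<in> borel_measurable lebesgue"
    by measurable
  then show "integrable lebesgue (\<lambda>u. norm (f u) * exp (- \<sigma> * u))"
  proof (rule Bochner_Integration.integrable_bound[OF assms(2)]; intro AE_I2)
    fix u
    show "norm (norm (f u) * exp (- \<sigma> * u)) \<le> norm (G u)"
      using assms(3)[of u] by simp
  qed
qed

lemma laplace_abs_mono:
  assumes "laplace_abs f \<sigma>" "g \<in> borel_measurable lebesgue" "\<And>u. norm (g u) \<le> norm (f u)"
  shows "laplace_abs g \<sigma>"
proof (rule laplace_absI[OF assms(2)])
  show "integrable lebesgue (\<lambda>u. norm (f u) * exp (- \<sigma> * u))"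
    using assms(1) by (simp add: laplace_abs_def)
  show "norm (g u) * exp (- \<sigma> * u) \<le> norm (f u) * exp (- \<sigma> * u)" for u
    by (intro mult_right_mono assms(3)) simp
qed

lemma laplace_abs_between:
  assumes "laplace_abs f \<sigma>1" "laplace_abs f \<sigma>2" "\<sigma>1 \<le> \<sigma>" "\<sigma> \<le> \<sigma>2"
  shows "laplace_abs f \<sigma>"
proof (rule laplace_absI)
  show "f \<in> borel_measurable lebesgue" using assms by (simp add: laplace_abs_def)
  show "integrable lebesgue (\<lambda>u. norm (f u) * exp (- \<sigma>1 * u) + norm (f u) * exp (- \<sigma>2 * u))"
    using assms by (intro Bochner_Integration.integrable_add) (auto simp: laplace_abs_def)
  show "norm (f u) * exp (- \<sigma> * u) \<le> norm (f u) * exp (- \<sigma>1 * u) + norm (f u) * exp (- \<sigma>2 * u)" for u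
    using mult_left_mono[OF exp_convex_bound[OF assms(3,4), of u], of "norm (f u)"]
    by (simp add: algebra_simps)
qed

lemma laplace_abs_imp_integrable:
  assumes "laplace_abs f (Re s)"
  shows "integrable lebesgue (\<lambda>u. f u * exp (- s * of_real u))"
proof -
  have [measurable]: "(\<lambda>u::real. exp (- s * of_real u)) \<in> borel_measurable lebesgue"
    by (intro continuous_imp_lebesgue_measurable continuous_intros)
  note assms[measurable]
  have "integrable lebesgue (\<lambda>u. norm (f u) * exp (- Re s * u))"
    using assms by (simp add: laplace_abs_def)
  moreover have "(\<lambda>u. f u * exp (- s * of_real u)) \<in> borel_measurable lebesgue"
    by measurable
  ultimately show ?thesis
    by (rule Bochner_Integration.integrable_bound) (simp add: norm_mult)
qed

text \<open>The weight never vanishes, so multiplying by its inverse recovers measurability of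
  \<open>f\<close>. In this form linearity is inherited from Bochner integrability.\<close>

lemma laplace_abs_iff_integrable:
  "laplace_abs f \<sigma> \<longleftrightarrow> integrable lebesgue (\<lambda>u. f u * exp (- of_real (\<sigma> * u)))"
proof
  assume "laplace_abs f \<sigma>"
  then have "laplace_abs f (Re (of_real \<sigma>))" by simp
  from laplace_abs_imp_integrable[OF this]
  show "integrable lebesgue (\<lambda>u. f u * exp (- of_real (\<sigma> * u)))"
    by (simp only: of_real_mult mult_minus_left)
next
  assume L: "integrable lebesgue (\<lambda>u. f u * exp (- of_real (\<sigma> * u)))"
  have [measurable]: "(\<lambda>u::real. exp (of_real (\<sigma> * u)) :: complex) \<in> borel_measurable lebesgue"
    by (intro continuous_imp_lebesgue_measurable continuous_intros)
  have "(\<lambda>u. (f u * exp (- of_real (\<sigma> * u))) * exp (of_real (\<sigma> * u))) \<in> borel_measurable lebesgue"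
    by (intro borel_measurable_times borel_measurable_integrable[OF L]) measurable
  also have "(\<lambda>u. (f u * exp (- of_real (\<sigma> * u))) * exp (of_real (\<sigma> * u))) = f"
    by (simp add: fun_eq_iff mult.assoc flip: exp_add)
  finally have "f \<in> borel_measurable lebesgue" .
  moreover have "norm (f u * exp (- of_real (\<sigma> * u))) = norm (f u) * exp (- \<sigma> * u)" for u
    by (simp add: norm_mult)
  ultimately show "laplace_abs f \<sigma>"
    using integrable_norm[OF L] by (simp only: laplace_abs_def)
qed

lemma laplace_abs_add:
  assumes "laplace_abs f \<sigma>" "laplace_abs g \<sigma>"
  shows "laplace_abs (\<lambda>u. f u + g u) \<sigma>"
  using Bochner_Integration.integrable_add[OF assms[unfolded laplace_abs_iff_integrable]]
  unfolding laplace_abs_iff_integrable distrib_right .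

lemma laplace_add:
  assumes "laplace_abs f (Re s)" "laplace_abs g (Re s)"
  shows "laplace (\<lambda>u. f u + g u) s = laplace f s + laplace g s"
  using Bochner_Integration.integral_add[OF assms[THEN laplace_abs_imp_integrable]]
  unfolding laplace_def distrib_right .

lemma laplace_abs_cmult: "laplace_abs f \<sigma> \<Longrightarrow> laplace_abs (\<lambda>u. c * f u) \<sigma>"
  unfolding laplace_abs_iff_integrable mult.assoc
  by (rule Bochner_Integration.integrable_mult_right)

lemma laplace_cmult: "laplace (\<lambda>u. c * f u) s = c * laplace f s"
  unfolding laplace_def mult.assoc by (rule integral_mult_right_zero)

text \<open>Squaring x \<le> exp x at x = c * |u| / 2. The rate \<open>c\<close> may be as small as
  desired, so polynomial factors cost only a small shift of the abscissa.\<close>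

lemma square_le_exp:
  fixes u c :: real
  assumes "c > 0"
  shows "u\<^sup>2 \<le> (2 / c)\<^sup>2 * exp (c * \<bar>u\<bar>)"
proof -
  have "c * \<bar>u\<bar> / 2 \<le> exp (c * \<bar>u\<bar> / 2)"
    using exp_ge_add_one_self[of "c * \<bar>u\<bar> / 2"] by linarith
  then have "(c * \<bar>u\<bar> / 2)\<^sup>2 \<le> (exp (c * \<bar>u\<bar> / 2))\<^sup>2"
    using assms by (intro power_mono) auto
  also have "\<dots> = exp (c * \<bar>u\<bar>)"
    by (simp flip: exp_double)
  finally show ?thesis
    using assms by (simp add: field_simps power2_eq_square)
qed

lemma abs_le_exp:
  fixes u c :: real
  assumes "c > 0"
  shows "\<bar>u\<bar> \<le> (1 / c) * exp (c * \<bar>u\<bar>)"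
proof -
  have "c * \<bar>u\<bar> \<le> exp (c * \<bar>u\<bar>)"
    using exp_ge_add_one_self[of "c * \<bar>u\<bar>"] by linarith
  then show ?thesis using assms by (simp add: field_simps)
qed

text \<open>One of the two right-hand terms equals the left-hand side, depending on the sign of
  \<open>u\<close>. A loss exp (c * |u|) is thus paid for by convergence at both
  \<open>\<sigma> - c\<close> and \<open>\<sigma> + c\<close>.\<close>

lemma exp_abs_le: "exp (c * \<bar>u\<bar>) * exp (- \<sigma> * u) \<le> exp (- (\<sigma> - c) * u) + exp (- (\<sigma> + c) * u)"
  for u c \<sigma> :: real
proof -
  have "exp (c * \<bar>u\<bar>) * exp (- \<sigma> * u) = exp (c * \<bar>u\<bar> - \<sigma> * u)"
    by (simp add: exp_add exp_diff exp_minus divide_inverse)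
  also have "\<dots> = exp (- (\<sigma> - c) * u) \<or> \<dots> = exp (- (\<sigma> + c) * u)"
    by (auto simp: abs_if algebra_simps)
  finally show ?thesis
    by (metis add_increasing add_increasing2 exp_ge_zero order_refl)
qed

text \<open>Openness of \<open>X\<close> gives convergence slightly to the left and to the right of
  the abscissa, and this margin absorbs the powers of \<open>u\<close> produced by differentiation.
  The second order remainder of the exponential then gives a quadratic bound in the
  increment.\<close>

lemma
  assumes "open X" and abs: "\<And>\<sigma>. \<sigma> \<in> X \<Longrightarrow> laplace_abs f \<sigma>"
  shows laplace_abs_deriv: "\<sigma> \<in> X \<Longrightarrow> laplace_abs (\<lambda>u. - of_real u * f u) \<sigma>"
    and laplace_has_field_derivative: "Re s \<in> X \<Longrightarrow>
      (laplace f has_field_derivative laplace (\<lambda>u. - of_real u * f u) s) (at s)"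
proof -
  have *: "\<exists>\<eta>>0. integrable lebesgue (\<lambda>u. norm (f u) * (exp (\<eta> * \<bar>u\<bar>) * exp (- \<sigma> * u)))"
    if \<sigma>: "\<sigma> \<in> X" for \<sigma>
  proof -
    have "\<exists>\<eta>>0. cball \<sigma> \<eta> \<subseteq> X"
      using \<open>open X\<close> \<sigma> unfolding open_contains_cball by auto
    then obtain \<eta> where \<eta>: "\<eta> > 0" "cball \<sigma> \<eta> \<subseteq> X"
      by auto
    have "\<sigma> - \<eta> \<in> cball \<sigma> \<eta>" "\<sigma> + \<eta> \<in> cball \<sigma> \<eta>"
      using \<eta> by (auto simp: dist_real_def)
    then have L: "laplace_abs f (\<sigma> - \<eta>)" "laplace_abs f (\<sigma> + \<eta>)"
      using abs \<eta> by blast+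
    have 1: "integrable lebesgue
        (\<lambda>u. norm (f u) * exp (- (\<sigma> - \<eta>) * u) + norm (f u) * exp (- (\<sigma> + \<eta>) * u))"
      using L by (intro Bochner_Integration.integrable_add) (auto simp: laplace_abs_def)
    have [measurable]: "(\<lambda>u. exp (\<eta> * \<bar>u\<bar>) * exp (- \<sigma> * u)) \<in> borel_measurable lebesgue"
      by (intro continuous_imp_lebesgue_measurable continuous_intros)
    note L(1)[measurable]
    have "(\<lambda>u. norm (f u) * (exp (\<eta> * \<bar>u\<bar>) * exp (- \<sigma> * u))) \<in> borel_measurable lebesgue"
      by measurable
    then have "integrable lebesgue (\<lambda>u. norm (f u) * (exp (\<eta> * \<bar>u\<bar>) * exp (- \<sigma> * u)))"
    proof (rule Bochner_Integration.integrable_bound[OF 1]; (intro AE_I2)?)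
      fix u
      have "norm (f u) * (exp (\<eta> * \<bar>u\<bar>) * exp (- \<sigma> * u))
          \<le> norm (f u) * (exp (- (\<sigma> - \<eta>) * u) + exp (- (\<sigma> + \<eta>) * u))"
        by (intro mult_left_mono exp_abs_le) auto
      also have "\<dots> \<le> norm (norm (f u) * exp (- (\<sigma> - \<eta>) * u) + norm (f u) * exp (- (\<sigma> + \<eta>) * u))"
        by (simp add: algebra_simps)
      finally show "norm (norm (f u) * (exp (\<eta> * \<bar>u\<bar>) * exp (- \<sigma> * u)))
          \<le> norm (norm (f u) * exp (- (\<sigma> - \<eta>) * u) + norm (f u) * exp (- (\<sigma> + \<eta>) * u))"
        by simp
    qed
    then show ?thesis using \<eta> by blast
  qed
  have id_meas [measurable]: "(\<lambda>u::real. of_real u :: complex) \<in> borel_measurable lebesgue"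
    by (intro continuous_imp_lebesgue_measurable continuous_intros)
  show A: "laplace_abs (\<lambda>u. - of_real u * f u) \<sigma>" if "\<sigma> \<in> X" for \<sigma>
  proof -
    obtain \<eta> where \<eta>: "\<eta> > 0" and I: "integrable lebesgue (\<lambda>u. norm (f u) * (exp (\<eta> * \<bar>u\<bar>) * exp (- \<sigma> * u)))"
      using *[OF \<open>\<sigma> \<in> X\<close>] by blast
    note abs[OF \<open>\<sigma> \<in> X\<close>, measurable]
    show ?thesis
    proof (rule laplace_absI)
      show "integrable lebesgue (\<lambda>u. (1 / \<eta>) * (norm (f u) * (exp (\<eta> * \<bar>u\<bar>) * exp (- \<sigma> * u))))"
        using I by (rule integrable_mult_right)
      fix u
      have "\<bar>u\<bar> * (norm (f u) * exp (- \<sigma> * u)) \<le> (1 / \<eta>) * exp (\<eta> * \<bar>u\<bar>) * (norm (f u) * exp (- \<sigma> * u))"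
        by (intro mult_right_mono abs_le_exp \<eta>) auto
      then show "norm (- of_real u * f u) * exp (- \<sigma> * u) \<le> (1 / \<eta>) * (norm (f u) * (exp (\<eta> * \<bar>u\<bar>) * exp (- \<sigma> * u)))"
        by (simp add: norm_mult mult_ac)
    qed measurable
  qed
  show "(laplace f has_field_derivative laplace (\<lambda>u. - of_real u * f u) s) (at s)" if s: "Re s \<in> X"
  proof -
    obtain \<eta> where \<eta>: "\<eta> > 0" and I: "integrable lebesgue (\<lambda>u. norm (f u) * (exp (\<eta> * \<bar>u\<bar>) * exp (- Re s * u)))"
      using *[OF s] by blast
    have "\<forall>\<^sub>F z in nhds (0::complex). Re (s + z) \<in> X"
    proof -
      have "open ((\<lambda>z. Re (s + z)) -` X)"
        by (intro open_vimage \<open>open X\<close> continuous_intros)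
      moreover have "0 \<in> (\<lambda>z. Re (s + z)) -` X" using s by simp
      ultimately have "\<forall>\<^sub>F z in nhds 0. z \<in> (\<lambda>z. Re (s + z)) -` X"
        by (rule eventually_nhds_in_open)
      then show ?thesis by simp
    qed
    then obtain d where d: "d > 0" "\<And>z. norm z < d \<Longrightarrow> Re (s + z) \<in> X"
      by (auto simp: eventually_nhds_metric)
    let ?W = "LINT u|lebesgue. norm (f u) * (exp (\<eta> * \<bar>u\<bar>) * exp (- Re s * u))"
    show ?thesis
      unfolding has_field_derivative_def
    \<comment> \<open>Half of the margin \<open>\<eta>\<close> pays for exp (|z| * |u|), the other
      half for the factor u^2; \<open>square_le_exp\<close> with rate \<open>\<eta> / 2\<close>
      produces the constant (4 / \<eta>)^2.\<close>
    proof (rule has_derivative_from_quadratic_bound[where d = "min d (\<eta> / 2)" and K = "(4 / \<eta>)\<^sup>2 * ?W"])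
      fix z :: complex assume z: "norm z < min d (\<eta> / 2)"
      let ?d = "\<lambda>u. f u * exp (- (s + z) * of_real u) - f u * exp (- s * of_real u)
          - ((- of_real u * f u) * exp (- s * of_real u)) * z"
      have I1: "integrable lebesgue (\<lambda>u. f u * exp (- (s + z) * of_real u))"
        using d z by (intro laplace_abs_imp_integrable abs) auto
      have I2: "integrable lebesgue (\<lambda>u. f u * exp (- s * of_real u))"
        using s by (intro laplace_abs_imp_integrable abs)
      have I3: "integrable lebesgue (\<lambda>u. (- of_real u * f u) * exp (- s * of_real u))"
        using s by (intro laplace_abs_imp_integrable A)
      have "laplace f (s + z) - laplace f s - laplace (\<lambda>u. - of_real u * f u) s * z
          = (LINT u|lebesgue. ?d u)"
        unfolding laplace_def
        by (simp only: Bochner_Integration.integral_diff[OF Bochner_Integration.integrable_diff[OF I1 I2]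
              Bochner_Integration.integrable_mult_left[OF I3]]
              Bochner_Integration.integral_diff[OF I1 I2] integral_mult_left_zero)
      also have "norm \<dots> \<le> (LINT u|lebesgue. ((4 / \<eta>)\<^sup>2 * (norm z)\<^sup>2) * (norm (f u) * (exp (\<eta> * \<bar>u\<bar>) * exp (- Re s * u))))"
      proof (rule Bochner_Integration.integral_norm_bound_integral)
        show "integrable lebesgue (\<lambda>u. ?d u)"
          using I1 I2 I3 by (intro Bochner_Integration.integrable_diff integrable_mult_left)
        fix u
        have "?d u
            = f u * exp (- s * of_real u) * (exp (- z * of_real u) - 1 - (- z * of_real u))"
          by (simp add: algebra_simps exp_add exp_diff exp_minus divide_simps)
        also have "norm \<dots> = norm (f u) * exp (- Re s * u) * norm (exp (- z * of_real u) - 1 - (- z * of_real u))"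
          by (simp add: norm_mult)
        also have "\<dots> \<le> norm (f u) * exp (- Re s * u) * ((norm z)\<^sup>2 * ((4 / \<eta>)\<^sup>2 * exp (\<eta> * \<bar>u\<bar>)))"
        proof (intro mult_left_mono)
          have "norm (exp (- z * of_real u) - 1 - (- z * of_real u)) \<le> (norm z * \<bar>u\<bar>)\<^sup>2 * exp (norm z * \<bar>u\<bar>)"
            using exp_diff_linear_le[of "- z * of_real u"] by (simp add: norm_mult)
          also have "\<dots> \<le> (norm z * \<bar>u\<bar>)\<^sup>2 * exp ((\<eta> / 2) * \<bar>u\<bar>)"
            using z mult_right_mono[of "norm z" "\<eta> / 2" "\<bar>u\<bar>"] by (intro mult_left_mono) auto
          also have "\<dots> = (norm z)\<^sup>2 * (u\<^sup>2 * exp ((\<eta> / 2) * \<bar>u\<bar>))"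
            by (simp add: power_mult_distrib)
          also have "\<dots> \<le> (norm z)\<^sup>2 * (((2 / (\<eta> / 2))\<^sup>2 * exp ((\<eta> / 2) * \<bar>u\<bar>)) * exp ((\<eta> / 2) * \<bar>u\<bar>))"
            using \<eta> by (intro mult_left_mono mult_right_mono square_le_exp) auto
          also have "\<dots> = (norm z)\<^sup>2 * ((4 / \<eta>)\<^sup>2 * exp (\<eta> * \<bar>u\<bar>))"
            by (simp flip: exp_add)
          finally show "norm (exp (- z * of_real u) - 1 - (- z * of_real u)) \<le> (norm z)\<^sup>2 * ((4 / \<eta>)\<^sup>2 * exp (\<eta> * \<bar>u\<bar>))" .
        qed auto
        finally show "norm (?d u)
            \<le> ((4 / \<eta>)\<^sup>2 * (norm z)\<^sup>2) * (norm (f u) * (exp (\<eta> * \<bar>u\<bar>) * exp (- Re s * u)))"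
          by (simp add: mult_ac)
      qed (use I in auto)
      also have "\<dots> = (4 / \<eta>)\<^sup>2 * ?W * (norm z)\<^sup>2"
        by simp
      finally show "norm (laplace f (s + z) - laplace f s - laplace (\<lambda>u. - of_real u * f u) s * z)
          \<le> (4 / \<eta>)\<^sup>2 * ?W * (norm z)\<^sup>2" .
    qed (use d \<eta> in \<open>auto intro: bounded_linear_mult_right\<close>)
  qed
qed

lemma laplace_holomorphic:
  assumes "open X" "\<And>\<sigma>. \<sigma> \<in> X \<Longrightarrow> laplace_abs f \<sigma>" "\<And>s. s \<in> S \<Longrightarrow> Re s \<in> X"
  shows "laplace f holomorphic_on S"
  using laplace_has_field_derivative[OF assms(1,2)] assms(3)
  by (auto simp: holomorphic_on_def field_differentiable_def intro: has_field_derivative_at_within)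

text \<open>Absolute convergence of the differentiated integrand on all of \<open>X\<close> is
  carried through the induction, since the next differentiation requires it in a
  neighbourhood.\<close>

lemma laplace_higher_deriv:
  assumes "open X" "\<And>\<sigma>. \<sigma> \<in> X \<Longrightarrow> laplace_abs f \<sigma>" "Re s \<in> X"
  shows "(deriv ^^ n) (laplace f) s = laplace (\<lambda>u. (- of_real u) ^ n * f u) s
    \<and> (\<forall>\<sigma>\<in>X. laplace_abs (\<lambda>u. (- of_real u) ^ n * f u) \<sigma>)"
  using assms(3)
proof (induction n arbitrary: s)
  case 0
  then show ?case using assms by simp
next
  case (Suc n)
  have ab: "laplace_abs (\<lambda>u. (- of_real u) ^ n * f u) \<sigma>" if "\<sigma> \<in> X" for \<sigma>
    using Suc that by blast
  have "open (Re -` X)"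
    by (intro open_vimage \<open>open X\<close> continuous_intros)
  have "(deriv ^^ Suc n) (laplace f) s = deriv ((deriv ^^ n) (laplace f)) s"
    by simp
  also have "\<dots> = deriv (laplace (\<lambda>u. (- of_real u) ^ n * f u)) s"
  proof (rule deriv_cong_ev)
    show "\<forall>\<^sub>F x in nhds s. (deriv ^^ n) (laplace f) x = laplace (\<lambda>u. (- of_real u) ^ n * f u) x"
      using eventually_nhds_in_open[OF \<open>open (Re -` X)\<close>, of s] Suc.prems
      by (auto elim!: eventually_mono simp: Suc.IH)
  qed auto
  also have "\<dots> = laplace (\<lambda>u. - of_real u * ((- of_real u) ^ n * f u)) s"
    by (intro DERIV_imp_deriv laplace_has_field_derivative[OF \<open>open X\<close> ab] Suc.prems)
  finally show ?case
    using laplace_abs_deriv[OF \<open>open X\<close> ab] by (simp add: mult.assoc)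
qed

subsection \<open>Landau's theorem\<close>

text \<open>All terms of the Taylor series at a point \<open>c\<close> to the right of \<open>\<sigma>0\<close> are
  nonnegative at the real point \<open>c - r\<close>, so sum and integral may be interchanged there.\<close>

lemma laplace_abs_beyond_abscissa:
  fixes f :: "real \<Rightarrow> real" and \<sigma>0 \<rho> :: real
  assumes abs: "\<And>\<sigma>. \<sigma> > \<sigma>0 \<Longrightarrow> laplace_abs (\<lambda>u. of_real (f u)) \<sigma>"
    and nonneg: "\<And>u. f u \<ge> 0" and supp: "\<And>u. u < 0 \<Longrightarrow> f u = 0"
    and "\<rho> > 0" and G: "G holomorphic_on ball (of_real \<sigma>0) \<rho>"
    and eq: "\<And>s. s \<in> ball (of_real \<sigma>0) \<rho> \<Longrightarrow> Re s > \<sigma>0 \<Longrightarrow> G s = laplace (\<lambda>u. of_real (f u)) s"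
  shows "laplace_abs (\<lambda>u. of_real (f u)) (\<sigma>0 - \<rho> / 8)"
proof -
  \<comment> \<open>The disc of radius \<rho> / 2 about \<open>c\<close> lies in the disc of radius
    \<rho> about \<open>\<sigma>0\<close> because 1/4 + 1/2 < 1. It contains \<open>c - r\<close>
    since 3/8 < 1/2, and this point lies to the left of \<open>\<sigma>0\<close> since 3/8 >
    1/4.\<close>
  define c where "c = \<sigma>0 + \<rho> / 4"
  define r where "r = 3 * \<rho> / 8"
  have cr: "c > \<sigma>0" "r > 0" "c - r = \<sigma>0 - \<rho> / 8"
    using \<open>\<rho> > 0\<close> by (auto simp: c_def r_def)
  \<comment> \<open>Taylor terms of exp (r * u), so that the sum over \<open>n\<close> is
    \<open>f u\<close> times exp (- (c - r) * u), the integrand at the new abscissa.\<close>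
  define F where "F n u = (r * u) ^ n / fact n * (f u * exp (- c * u))" for n u
  have der: "(deriv ^^ n) G (of_real c) = laplace (\<lambda>u. (- of_real u) ^ n * of_real (f u)) (of_real c)"
    and ab: "laplace_abs (\<lambda>u. (- of_real u) ^ n * of_real (f u)) c" for n
  proof -
    let ?V = "ball (of_real \<sigma>0) \<rho> \<inter> {s. \<sigma>0 < Re s}"
    have "open ?V"
      by (intro open_Int open_ball open_halfspace_Re_gt)
    moreover have "of_real c \<in> ?V"
      using \<open>\<rho> > 0\<close> by (auto simp: c_def dist_norm)
    ultimately have "\<forall>\<^sub>F s in nhds (of_real c). s \<in> ?V"
      by (rule eventually_nhds_in_open)
    then have "\<forall>\<^sub>F s in nhds (of_real c). G s = laplace (\<lambda>u. of_real (f u)) s"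
      by (rule eventually_mono) (use eq in auto)
    then have "(deriv ^^ n) G (of_real c) = (deriv ^^ n) (laplace (\<lambda>u. of_real (f u))) (of_real c)"
      by (intro higher_deriv_cong_ev) auto
    with laplace_higher_deriv[of "{\<sigma>0<..}" "\<lambda>u. of_real (f u)" "of_real c" n] abs cr
    show "(deriv ^^ n) G (of_real c) = laplace (\<lambda>u. (- of_real u) ^ n * of_real (f u)) (of_real c)"
      and "laplace_abs (\<lambda>u. (- of_real u) ^ n * of_real (f u)) c"
      by auto
  qed
  have F_nonneg: "F n u \<ge> 0" for n u
    using nonneg[of u] supp[of u] cr by (cases "u < 0") (auto simp: F_def)
  have term_eq: "complex_of_real (F n u)
      = of_real (r ^ n / fact n) * (- 1) ^ n * ((- of_real u) ^ n * of_real (f u) * exp (- of_real c * of_real u))"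
    for n u
  proof -
    have "(- (1::complex)) ^ n * (- of_real u) ^ n = of_real u ^ n"
      by (simp flip: power_mult_distrib)
    moreover have "complex_of_real (F n u)
        = of_real (r ^ n / fact n) * (of_real u ^ n) * (of_real (f u) * exp (- of_real c * of_real u))"
      unfolding F_def by (simp add: power_mult_distrib flip: exp_of_real)
    ultimately show ?thesis by (metis (no_types, lifting) mult.assoc)
  qed
  have int_c: "integrable lebesgue (\<lambda>u. complex_of_real (F n u))" for n
    unfolding term_eq using laplace_abs_imp_integrable[of _ "of_real c"] ab
    by (intro integrable_mult_right) auto
  then have int: "integrable lebesgue (F n)" for n
    using integrable_norm[OF int_c[of n]] F_nonneg by (simp add: abs_of_nonneg)
  \<comment> \<open>The signs (- 1)^n from differentiating the transform cancel those of the
    increment - r: the integrals are exactly the Taylor terms of \<open>G\<close> at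
    \<open>c\<close>, evaluated at \<open>c - r\<close>.\<close>
  have int_eq: "of_real (LINT u|lebesgue. F n u)
      = (deriv ^^ n) G (of_real c) / fact n * (- of_real r) ^ n" for n
  proof -
    have "of_real (LINT u|lebesgue. F n u) = (LINT u|lebesgue. complex_of_real (F n u))"
      by simp
    also have "\<dots> = of_real (r ^ n / fact n) * (- 1) ^ n * laplace (\<lambda>u. (- of_real u) ^ n * of_real (f u)) (of_real c)"
      unfolding term_eq laplace_def by (rule integral_mult_right_zero)
    also have "\<dots> = (deriv ^^ n) G (of_real c) / fact n * ((- 1) ^ n * of_real r ^ n)"
      unfolding der by simp
    also have "(- 1) ^ n * of_real r ^ n = (- complex_of_real r) ^ n"
      by (simp flip: power_mult_distrib)
    finally show ?thesis .
  qed
  have "G holomorphic_on ball (of_real c) (\<rho> / 2)"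
  proof (rule holomorphic_on_subset[OF G])
    show "ball (complex_of_real c) (\<rho> / 2) \<subseteq> ball (of_real \<sigma>0) \<rho>"
    proof
      fix s assume "s \<in> ball (complex_of_real c) (\<rho> / 2)"
      moreover have "dist (complex_of_real \<sigma>0) (of_real c) = \<rho> / 4"
        using \<open>\<rho> > 0\<close> by (simp add: c_def dist_norm)
      ultimately show "s \<in> ball (of_real \<sigma>0) \<rho>"
        using dist_triangle[of "complex_of_real \<sigma>0" s "of_real c"] \<open>\<rho> > 0\<close> by simp
    qed
  qed
  moreover have "of_real c - of_real r \<in> ball (complex_of_real c) (\<rho> / 2)"
    using \<open>\<rho> > 0\<close> by (simp add: dist_norm r_def norm_divide norm_mult)
  ultimately have "(\<lambda>n. (deriv ^^ n) G (of_real c) / fact n * (of_real c - of_real r - of_real c) ^ n)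
      sums G (of_real c - of_real r)"
    by (rule holomorphic_power_series)
  then have "summable (\<lambda>n. complex_of_real (LINT u|lebesgue. F n u))"
    unfolding int_eq by (simp add: sums_iff)
  then have summ: "summable (\<lambda>n. LINT u|lebesgue. F n u)"
    by (simp only: summable_complex_of_real)
  have F_sums: "(\<lambda>n. F n u) sums (exp (r * u) * (f u * exp (- c * u)))" for u
    unfolding F_def by (intro sums_mult2) (use exp_converges[of "r * u"] in \<open>simp add: divide_inverse mult.commute\<close>)
  \<comment> \<open>Termwise nonnegativity makes convergence of the sum of the integrals sufficient
    for integrability of the sum.\<close>
  have "integrable lebesgue (\<lambda>u. \<Sum>n. F n u)"
    by (rule integrable_suminf[OF int])
       (use F_sums F_nonneg summ in \<open>auto simp: sums_iff abs_of_nonneg\<close>)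
  then have "integrable lebesgue (\<lambda>u. exp (r * u) * (f u * exp (- c * u)))"
    using F_sums by (simp add: sums_iff)
  moreover have "exp (r * u) * (f u * exp (- c * u)) = norm (complex_of_real (f u)) * exp (- (\<sigma>0 - \<rho> / 8) * u)" for u
  proof -
    have "exp (- (\<sigma>0 - \<rho> / 8) * u) = exp (r * u) * exp (- c * u)"
      unfolding exp_add[symmetric] cr(3)[symmetric] by (simp add: algebra_simps)
    then show ?thesis using nonneg[of u] by simp
  qed
  ultimately show ?thesis
    using abs[of "\<sigma>0 + 1"] by (simp add: laplace_abs_def)
qed

section \<open>Convergence up to the first real singularity, and poles of quotients of entire
  functions\<close>

lemma laplace_abs_supported_mono:
  assumes "laplace_abs f \<sigma>" "\<sigma> \<le> \<sigma>'" and supp: "\<And>u. u < 0 \<Longrightarrow> f u = 0"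
  shows "laplace_abs f \<sigma>'"
proof (rule laplace_absI)
  show "f \<in> borel_measurable lebesgue" "integrable lebesgue (\<lambda>u. norm (f u) * exp (- \<sigma> * u))"
    using assms(1) by (auto simp: laplace_abs_def)
  show "norm (f u) * exp (- \<sigma>' * u) \<le> norm (f u) * exp (- \<sigma> * u)" for u
  proof (cases "u < 0")
    case False
    then show ?thesis
      using mult_right_mono[OF assms(2), of u] by (intro mult_left_mono) auto
  qed (simp add: supp)
qed

text \<open>A nonzero value \<open>D s\<close> would persist near \<open>s\<close>, where the zeros
  of the entire function \<open>B\<close> are isolated, so the product could not vanish. This is how
  \<open>B\<close> is cancelled from a product identity.\<close>

lemma holomorphic_mult_eq_zero:
  assumes "B holomorphic_on UNIV" "B \<beta> \<noteq> 0" "D holomorphic_on V" "open V"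
    and "\<And>s. s \<in> V \<Longrightarrow> B s * D s = 0" "s \<in> V"
  shows "D s = 0"
proof (rule ccontr)
  assume "D s \<noteq> 0"
  have "isCont D s"
    using assms holomorphic_on_imp_continuous_on continuous_on_eq_continuous_at by blast
  then have "\<forall>\<^sub>F z in at s. D z \<noteq> 0"
    using \<open>D s \<noteq> 0\<close> by (auto simp: isCont_def intro: tendsto_imp_eventually_ne)
  moreover have "\<forall>\<^sub>F z in at s. z \<in> V"
    using assms by (intro eventually_at_in_open') auto
  moreover have "\<forall>\<^sub>F z in at s. B z \<noteq> 0 \<and> z \<in> UNIV"
    by (rule non_zero_neighbour_alt[OF assms(1)]) (use assms(2) in auto)
  ultimately have "\<forall>\<^sub>F z in at s. False"
    by eventually_elim (use assms(5) in auto)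
  then show False by simp
qed

text \<open>Landau's theorem for a transform known only through a product identity. Were the
  abscissa of convergence to the right of \<open>b\<close>, the local factor \<open>G\<close> would
  continue the transform holomorphically across it, and convergence would reach further
  left.\<close>

lemma laplace_abs_up_to_singularity:
  fixes f :: "real \<Rightarrow> real" and a b :: real
  assumes abs: "\<And>\<sigma>. \<sigma> > a \<Longrightarrow> laplace_abs (\<lambda>u. of_real (f u)) \<sigma>"
    and nonneg: "\<And>u. f u \<ge> 0" and supp: "\<And>u. u < 0 \<Longrightarrow> f u = 0"
    and A: "A holomorphic_on UNIV" and B: "B holomorphic_on UNIV" "B \<beta> \<noteq> 0"
    and eq: "\<And>s. Re s > a \<Longrightarrow> A s = B s * laplace (\<lambda>u. of_real (f u)) s"
    and ext: "\<And>x. x > b \<Longrightarrow> \<exists>\<rho>>0. \<exists>G. G holomorphic_on ball (of_real x) \<rho> \<and>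
        (\<forall>s\<in>ball (of_real x) \<rho>. A s = B s * G s)"
    and "\<sigma> > b"
  shows "laplace_abs (\<lambda>u. of_real (f u)) \<sigma>"
proof (rule ccontr)
  let ?f = "\<lambda>u. complex_of_real (f u)"
  assume not: "\<not> laplace_abs ?f \<sigma>"
  define T where "T = {\<tau>. laplace_abs ?f \<tau>}"
  have up: "\<tau>' \<in> T" if "\<tau> \<in> T" "\<tau> \<le> \<tau>'" for \<tau> \<tau>'
    using laplace_abs_supported_mono[of ?f] that supp by (auto simp: T_def)
  have "\<sigma> \<notin> T" using not by (simp add: T_def)
  then have lb: "\<sigma> \<le> \<tau>" if "\<tau> \<in> T" for \<tau>
    using up[of \<tau> \<sigma>] that \<open>\<sigma> \<notin> T\<close> by linarith
  have "a + 1 \<in> T" using abs by (simp add: T_def)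
  have bdd: "bdd_below T" using lb by (auto simp: bdd_below_def)
  define \<sigma>0 where "\<sigma>0 = Inf T"
  have "\<sigma> \<le> \<sigma>0"
    unfolding \<sigma>0_def using \<open>a + 1 \<in> T\<close> lb by (intro cInf_greatest) auto
  have gt: "laplace_abs ?f \<tau>" if "\<tau> > \<sigma>0" for \<tau>
  proof -
    obtain \<tau>' where "\<tau>' \<in> T" "\<tau>' < \<tau>"
      using cInf_lessD[of T \<tau>] \<open>\<tau> > \<sigma>0\<close> \<open>a + 1 \<in> T\<close> unfolding \<sigma>0_def by blast
    then show ?thesis using up[of \<tau>' \<tau>] by (simp add: T_def)
  qed
  obtain \<rho> G where \<rho>: "\<rho> > 0" and G: "G holomorphic_on ball (of_real \<sigma>0) \<rho>"
    and AG: "\<And>s. s \<in> ball (of_real \<sigma>0) \<rho> \<Longrightarrow> A s = B s * G s"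
    using ext[of \<sigma>0] \<open>\<sigma> \<le> \<sigma>0\<close> \<open>\<sigma> > b\<close> by auto
  have holL: "laplace ?f holomorphic_on {s. Re s > \<sigma>0}"
    by (rule laplace_holomorphic[of "{\<sigma>0<..}"]) (use gt in auto)
  \<comment> \<open>The identity is given for Re s > a and continued to Re s > \<sigma>0; starting
    from the \<open>max\<close> avoids comparing \<open>a\<close> with
    \<open>\<sigma>0\<close>.\<close>
  have AL: "A s = B s * laplace ?f s" if "Re s > \<sigma>0" for s
  proof (rule analytic_continuation_open[where s = "{s. Re s > max a \<sigma>0}" and s' = "{s. Re s > \<sigma>0}"
        and f = A and g = "\<lambda>s. B s * laplace ?f s"])
    show "{s. Re s > max a \<sigma>0} \<noteq> {}"
    proof -
      have "of_real (\<bar>a\<bar> + \<bar>\<sigma>0\<bar> + 1) \<in> {s. Re s > max a \<sigma>0}"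
        by (simp, linarith)
      then show ?thesis by blast
    qed
    show "open {s. Re s > max a \<sigma>0}"
      by (rule open_halfspace_Re_gt)
    show "connected {s. \<sigma>0 < Re s}"
      by (intro convex_connected convex_halfspace_Re_gt)
    show "A holomorphic_on {s. \<sigma>0 < Re s}" "(\<lambda>s. B s * laplace ?f s) holomorphic_on {s. \<sigma>0 < Re s}"
      using A B holL by (auto intro!: holomorphic_intros intro: holomorphic_on_subset)
  qed (use that eq open_halfspace_Re_gt in auto)
  have "laplace_abs ?f (\<sigma>0 - \<rho> / 8)"
  proof (rule laplace_abs_beyond_abscissa[OF gt nonneg supp \<rho> G])
    fix s assume s: "s \<in> ball (of_real \<sigma>0) \<rho>" "Re s > \<sigma>0"
    let ?V = "ball (of_real \<sigma>0) \<rho> \<inter> {s. Re s > \<sigma>0}"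
    have "G s - laplace ?f s = 0"
    proof (rule holomorphic_mult_eq_zero[OF B, of "\<lambda>s. G s - laplace ?f s" ?V])
      show "(\<lambda>s. G s - laplace ?f s) holomorphic_on ?V"
        by (intro holomorphic_intros holomorphic_on_subset[OF G] holomorphic_on_subset[OF holL]) auto
      show "open ?V" by (intro open_Int open_ball open_halfspace_Re_gt)
      show "B z * (G z - laplace ?f z) = 0" if "z \<in> ?V" for z
        using AG[of z] AL[of z] that by (auto simp: algebra_simps)
    qed (use s in auto)
    then show "G s = laplace ?f s" by simp
  qed
  then have "\<sigma>0 \<le> \<sigma>0 - \<rho> / 8"
    using bdd unfolding \<sigma>0_def T_def by (intro cInf_lower) auto
  then show False using \<rho> by simp
qed

text \<open>A point that is no pole of a meromorphic quotient is a removable singularity, and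
  \<open>G\<close> is the quotient with the singularity removed. The product form holds at the point
  itself by continuity, even when \<open>B\<close> vanishes there.\<close>

lemma quotient_extends_at_nonpole:
  assumes A: "A holomorphic_on UNIV" and B: "B holomorphic_on UNIV" "B \<beta> \<noteq> 0"
    and "\<not> is_pole (\<lambda>s. A s / B s) x"
  shows "\<exists>\<rho>>0. \<exists>G. G holomorphic_on ball x \<rho> \<and> (\<forall>s\<in>ball x \<rho>. A s = B s * G s)"
proof -
  let ?F = "\<lambda>s. A s / B s"
  have "A meromorphic_on {x}" "B meromorphic_on {x}"
    using A B by (auto intro!: analytic_on_imp_meromorphic_on holomorphic_on_imp_analytic_at)
  then have mero: "?F meromorphic_on {x}"
    by (rule meromorphic_on_divide)
  note iso = meromorphic_on_isolated_singularity[OF mero]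
  obtain c where "?F \<midarrow>x\<rightarrow> c"
    using meromorphic_on_not_essential[OF mero] assms(4) unfolding not_essential_def by blast
  then have ana: "remove_sings ?F analytic_on {x}"
    using iso by (intro remove_sings_analytic_at)
  have "\<forall>\<^sub>F s in at x. remove_sings ?F s = ?F s"
    using iso by (rule eventually_remove_sings_eq_at)
  moreover have "\<forall>\<^sub>F s in at x. B s \<noteq> 0 \<and> s \<in> UNIV"
    by (rule non_zero_neighbour_alt[OF B(1)]) (use B(2) in auto)
  ultimately have ev: "\<forall>\<^sub>F s in at x. A s = B s * remove_sings ?F s"
    by eventually_elim auto
  have "isCont (remove_sings ?F) x"
    using ana by (rule analytic_at_imp_isCont)
  moreover have "isCont A x" "isCont B x"
    using holomorphic_on_imp_continuous_on[OF A] holomorphic_on_imp_continuous_on[OF B(1)]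
    by (auto simp: continuous_on_eq_continuous_at)
  ultimately have "(\<lambda>s. B s * remove_sings ?F s) \<midarrow>x\<rightarrow> B x * remove_sings ?F x" "A \<midarrow>x\<rightarrow> A x"
    by (auto intro!: tendsto_intros simp: isCont_def)
  then have "A x = B x * remove_sings ?F x"
    using ev tendsto_cong[OF ev] by (metis tendsto_unique at_neq_bot)
  with ev have "\<forall>\<^sub>F s in nhds x. A s = B s * remove_sings ?F s"
    by (simp add: eventually_nhds_conv_at)
  then obtain d where d: "d > 0" "\<And>s. dist s x < d \<Longrightarrow> A s = B s * remove_sings ?F s"
    by (auto simp: eventually_nhds_metric)
  obtain e where e: "e > 0" "remove_sings ?F holomorphic_on ball x e"
    using ana by (auto simp: analytic_on_def)
  show ?thesis
    using d e by (intro exI[of _ "min d e"] exI[of _ "remove_sings ?F"] conjI)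
      (auto intro: holomorphic_on_subset simp: dist_commute)
qed

text \<open>Away from the isolated zeros of \<open>B\<close> the quotient is \<open>L\<close>, and
  being a pole depends only on punctured neighbourhoods.\<close>

lemma quotient_no_pole:
  assumes B: "B holomorphic_on UNIV" "B \<beta> \<noteq> 0" and "open V" "s \<in> V" "L holomorphic_on V"
    and eq: "\<And>z. z \<in> V \<Longrightarrow> A z = B z * L z"
  shows "\<not> is_pole (\<lambda>s. A s / B s) s"
proof -
  have "\<forall>\<^sub>F z in at s. z \<in> V"
    using assms by (intro eventually_at_in_open') auto
  moreover have "\<forall>\<^sub>F z in at s. B z \<noteq> 0 \<and> z \<in> UNIV"
    by (rule non_zero_neighbour_alt[OF B(1)]) (use B(2) in auto)
  ultimately have "\<forall>\<^sub>F z in at s. A z / B z = L z"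
    by eventually_elim (auto simp: eq)
  then have "is_pole (\<lambda>s. A s / B s) s \<longleftrightarrow> is_pole L s"
    by (rule is_pole_cong) simp
  then show ?thesis
    using not_is_pole_holomorphic[OF assms(3,4,5)] by simp
qed

lemma lebesgue_measurable_id [measurable]: "(\<lambda>u::real. u) \<in> borel_measurable lebesgue"
  by (intro continuous_imp_lebesgue_measurable continuous_intros)

text \<open>The analytic core. Convergence of the transform for Re s > b lets the two half-plane
  identities spread to Re s > b and Re s < 1 - b, where the quotient agrees with a holomorphic
  function off the isolated zeros of \<open>B\<close>.\<close>

lemma poles_in_strip:
  fixes H :: "real \<Rightarrow> real" and a b :: real and \<kappa> :: complex
  defines "Hp \<equiv> \<lambda>u. complex_of_real (if u > 0 then H u else 0)"
  assumes abs: "\<And>\<sigma>. \<sigma> > a \<Longrightarrow> laplace_abs Hp \<sigma>"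
    and sign: "t0 > 0" "(\<forall>t>t0. H t \<ge> 0) \<or> (\<forall>t>t0. H t \<le> 0)"
    and A: "A holomorphic_on UNIV" and B: "B holomorphic_on UNIV"
    and right: "\<And>s. Re s > a \<Longrightarrow> A s = B s * laplace Hp s"
    and left: "\<And>s. Re s < 1 - a \<Longrightarrow> A s = \<kappa> * B s * laplace Hp (1 - s)"
    and no_poles: "\<And>x. x > b \<Longrightarrow> \<not> is_pole (\<lambda>s. A s / B s) (of_real x)"
    and pole: "is_pole (\<lambda>s. A s / B s) s"
  shows "1 - b \<le> Re s \<and> Re s \<le> b"
proof -
  \<comment> \<open>For \<open>B\<close> identically 0 the convention x / 0 = 0 makes the quotient
    constant, hence without poles.\<close>
  have "\<exists>\<beta>. B \<beta> \<noteq> 0"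
  proof (rule ccontr)
    assume "\<not> ?thesis"
    then have "(\<lambda>s. A s / B s) = (\<lambda>_. 0)" by auto
    then show False using pole by simp
  qed
  then obtain \<beta> where \<beta>: "B \<beta> \<noteq> 0" by auto
  \<comment> \<open>A sign with square 1 treats both cases at once; it enters as a factor that later
    cancels against itself.\<close>
  obtain sg :: real where sg: "sg * sg = 1" "\<And>t. t > t0 \<Longrightarrow> sg * H t \<ge> 0"
    using sign(2)
  proof
    assume "\<forall>t>t0. H t \<ge> 0"
    then show ?thesis by (intro that[of 1]) auto
  next
    assume "\<forall>t>t0. H t \<le> 0"
    then show ?thesis by (intro that[of "-1"]) auto
  qed
  define f where "f u = (if u > t0 then sg * H u else 0)" for u
  \<comment> \<open>Supported in (0, t0], where any abscissa may be exchanged for a + 1 at the price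
    of a bounded factor; hence its transform is entire.\<close>
  define g where "g u = (if u \<le> t0 then Hp u else 0)" for u
  have Hp_split: "Hp = (\<lambda>u. g u + of_real sg * of_real (f u))"
    using sg(1) sign(1) by (auto simp: fun_eq_iff g_def f_def Hp_def simp flip: of_real_mult mult.assoc)
  have f_eq: "of_real (f u) = of_real sg * (if t0 < u then Hp u else 0)" for u
    using sign(1) by (auto simp: f_def Hp_def)
  note abs[of "a + 1", simplified, measurable]
  have abs_f: "laplace_abs (\<lambda>u. of_real (f u)) \<sigma>" if "\<sigma> > a" for \<sigma>
    unfolding f_eq by (intro laplace_abs_cmult laplace_abs_mono[OF abs[OF that]]) auto
  have abs_g: "laplace_abs g \<sigma>" for \<sigma>
  proof (rule laplace_absI)
    show "g \<in> borel_measurable lebesgue" unfolding g_def by measurable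
    show "integrable lebesgue (\<lambda>u. norm (Hp u) * exp (- (a + 1) * u) * exp (\<bar>a + 1 - \<sigma>\<bar> * t0))"
      using abs[of "a + 1"] by (intro integrable_mult_left) (simp add: laplace_abs_def)
    show "norm (g u) * exp (- \<sigma> * u) \<le> norm (Hp u) * exp (- (a + 1) * u) * exp (\<bar>a + 1 - \<sigma>\<bar> * t0)" for u
    proof (cases "0 < u \<and> u \<le> t0")
      case True
      have "(a + 1 - \<sigma>) * u \<le> \<bar>a + 1 - \<sigma>\<bar> * t0"
        using True by (intro mult_mono) auto
      then have "exp (- \<sigma> * u) \<le> exp (- (a + 1) * u) * exp (\<bar>a + 1 - \<sigma>\<bar> * t0)"
        unfolding exp_add[symmetric] by (simp add: algebra_simps)
      with True show ?thesis
        by (simp add: g_def mult.assoc mult_left_mono)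
    qed (auto simp: g_def Hp_def)
  qed
  have hol_g: "laplace g holomorphic_on UNIV"
    by (rule laplace_holomorphic[of UNIV]) (use abs_g in auto)
  have laplace_split: "laplace Hp s = laplace g s + of_real sg * laplace (\<lambda>u. of_real (f u)) s" if "Re s > a" for s
    unfolding Hp_split using abs_g abs_f[OF that]
    by (subst laplace_add) (auto simp: laplace_cmult laplace_abs_cmult)
  have abs_f': "laplace_abs (\<lambda>u. of_real (f u)) \<sigma>" if "\<sigma> > b" for \<sigma>
  proof (rule laplace_abs_up_to_singularity[OF abs_f _ _ _ B \<beta> _ _ that])
    \<comment> \<open>Removing the entire contribution of \<open>g\<close> leaves a product identity
      for \<open>f\<close> alone, with the same factor \<open>B\<close>.\<close>
    let ?A = "\<lambda>s. of_real sg * (A s - B s * laplace g s)"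
    show "?A holomorphic_on UNIV"
      by (intro holomorphic_intros A B hol_g)
    show "?A s = B s * laplace (\<lambda>u. of_real (f u)) s" if "Re s > a" for s
    proof -
      have "?A s = (of_real sg * of_real sg) * (B s * laplace (\<lambda>u. of_real (f u)) s)"
        using right[OF that] laplace_split[OF that] by (simp add: algebra_simps)
      then show ?thesis using sg(1) by (simp flip: of_real_mult)
    qed
    show "\<exists>\<rho>>0. \<exists>G. G holomorphic_on ball (of_real x) \<rho> \<and> (\<forall>s\<in>ball (of_real x) \<rho>. ?A s = B s * G s)"
      if "x > b" for x
    proof -
      obtain \<rho> G where \<rho>: "\<rho> > 0" "G holomorphic_on ball (of_real x) \<rho>"
        and AG: "\<forall>s\<in>ball (of_real x) \<rho>. A s = B s * G s"
        using quotient_extends_at_nonpole[OF A B \<beta> no_poles[OF \<open>x > b\<close>]] by blast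
      show ?thesis
      proof (intro exI conjI)
        show "(\<lambda>s. of_real sg * (G s - laplace g s)) holomorphic_on ball (of_real x) \<rho>"
          by (intro holomorphic_intros \<rho> holomorphic_on_subset[OF hol_g]) auto
        show "\<forall>s\<in>ball (of_real x) \<rho>. ?A s = B s * (of_real sg * (G s - laplace g s))"
          using AG by (auto simp: algebra_simps)
      qed (use \<rho> in auto)
    qed
  qed (use sg sign in \<open>auto simp: f_def\<close>)
  have abs': "laplace_abs Hp \<sigma>" if "\<sigma> > b" for \<sigma>
    unfolding Hp_split by (intro laplace_abs_add laplace_abs_cmult abs_g abs_f' that)
  \<comment> \<open>With \<open>min\<close> the domain contains both the half plane where the
    identity is given and the one where it is wanted, whichever of \<open>a\<close> and
    \<open>b\<close> is smaller.\<close>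
  have holL: "laplace Hp holomorphic_on {s. Re s > min a b}"
    by (rule laplace_holomorphic[of "{min a b<..}"]) (use abs abs' in \<open>auto simp: min_less_iff_disj\<close>)
  have AL: "A s = B s * laplace Hp s" if "Re s > b" for s
  proof (rule analytic_continuation_open[where s = "{s. Re s > a}" and s' = "{s. Re s > min a b}"
        and f = A and g = "\<lambda>s. B s * laplace Hp s"])
    have "of_real (a + 1) \<in> {s. Re s > a}" by simp
    then show "{s. Re s > a} \<noteq> {}" by blast
    show "connected {s. min a b < Re s}"
      by (intro convex_connected convex_halfspace_Re_gt)
    show "A holomorphic_on {s. min a b < Re s}" "(\<lambda>s. B s * laplace Hp s) holomorphic_on {s. min a b < Re s}"
      using A B holL by (auto intro!: holomorphic_intros intro: holomorphic_on_subset)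
  qed (use that right open_halfspace_Re_gt in auto)
  have holR: "(\<lambda>s. laplace Hp (1 - s)) holomorphic_on {s. Re s < 1 - min a b}"
  proof -
    have "laplace Hp \<circ> (\<lambda>s. 1 - s) holomorphic_on {s. Re s < 1 - min a b}"
      by (rule holomorphic_on_compose_gen[OF _ holL]) (auto intro!: holomorphic_intros)
    then show ?thesis by (simp add: o_def)
  qed
  have AR: "A s = B s * (\<kappa> * laplace Hp (1 - s))" if "Re s < 1 - b" for s
  proof (rule analytic_continuation_open[where s = "{s. Re s < 1 - a}" and s' = "{s. Re s < 1 - min a b}"
        and f = A and g = "\<lambda>s. B s * (\<kappa> * laplace Hp (1 - s))"])
    have "of_real (- a) \<in> {s. Re s < 1 - a}" by simp
    then show "{s. Re s < 1 - a} \<noteq> {}" by blast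
    show "connected {s. Re s < 1 - min a b}"
      by (intro convex_connected convex_halfspace_Re_lt)
    show "A holomorphic_on {s. Re s < 1 - min a b}"
      "(\<lambda>s. B s * (\<kappa> * laplace Hp (1 - s))) holomorphic_on {s. Re s < 1 - min a b}"
      using A B holR by (auto intro!: holomorphic_intros intro: holomorphic_on_subset)
  qed (use that left open_halfspace_Re_lt in \<open>auto simp: mult_ac\<close>)
  show ?thesis
  proof (rule ccontr)
    assume "\<not> ?thesis"
    then consider "Re s > b" | "Re s < 1 - b" by linarith
    then show False
    proof cases
      case 1
      have "\<not> is_pole (\<lambda>s. A s / B s) s"
        by (rule quotient_no_pole[OF B \<beta>, of "{s. Re s > b}" _ "laplace Hp"])
           (use 1 AL open_halfspace_Re_gt in \<open>auto intro: holomorphic_on_subset[OF holL]\<close>)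
      then show False using pole by contradiction
    next
      case 2
      have "\<not> is_pole (\<lambda>s. A s / B s) s"
      proof (rule quotient_no_pole[OF B \<beta>, of "{s. Re s < 1 - b}" _ "\<lambda>s. \<kappa> * laplace Hp (1 - s)"])
        show "(\<lambda>s. \<kappa> * laplace Hp (1 - s)) holomorphic_on {s. Re s < 1 - b}"
          by (intro holomorphic_intros holomorphic_on_subset[OF holR]) auto
      qed (use 2 AR open_halfspace_Re_lt in auto)
      then show False using pole by contradiction
    qed
  qed
qed

subsection \<open>Passing from multiplicative to additive convolution\<close>

text \<open>Completion does not change the measure of Borel sets, so the exhaustion belonging to
  \<open>lborel\<close> serves. Fubini's theorem can then be applied to \<open>lebesgue\<close>
  itself.\<close>

lemma sigma_finite_lebesgue: "sigma_finite_measure (lebesgue :: real measure)"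
proof
  obtain A :: "nat \<Rightarrow> real set" where A: "range A \<subseteq> sets lborel" "(\<Union>i. A i) = space lborel"
    "\<And>i. emeasure lborel (A i) \<noteq> \<infinity>"
    using lborel.sigma_finite by metis
  show "\<exists>A. countable A \<and> A \<subseteq> sets lebesgue \<and> \<Union> A = space lebesgue \<and>
      (\<forall>a\<in>A. emeasure lebesgue (a :: real set) \<noteq> \<infinity>)"
    using A by (intro exI[of _ "range A"]) (auto simp: emeasure_completion)
qed

text \<open>Continuity makes \<open>F\<close> Borel, so that its composition with subtraction is
  measurable on the product; for a merely Lebesgue measurable \<open>F\<close> this argument breaks
  down. Absolute integrability follows from translation invariance.\<close>

lemma
  fixes F G :: "real \<Rightarrow> complex"
  assumes F: "integrable lebesgue F" "continuous_on UNIV F" and G: "integrable lebesgue G"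
  shows integrable_additive_conv: "integrable lebesgue (\<lambda>t. LINT u|lebesgue. F (t - u) * G u)"
    and integral_additive_conv: "(LINT t|lebesgue. LINT u|lebesgue. F (t - u) * G u)
      = (LINT t|lebesgue. F t) * (LINT u|lebesgue. G u)"
proof -
  interpret L: pair_sigma_finite "lebesgue :: real measure" "lebesgue :: real measure"
    unfolding pair_sigma_finite_def using sigma_finite_lebesgue by simp
  have Fm [measurable]: "F \<in> borel_measurable borel"
    using F(2) by (rule borel_measurable_continuous_onI)
  have Gm [measurable]: "G \<in> borel_measurable lebesgue"
    using G by auto
  have shift: "integrable lebesgue (\<lambda>t. F (t - u))" "(LINT t|lebesgue. F (t - u)) = (LINT t|lebesgue. F t)"
    and shift_norm: "(LINT t|lebesgue. norm (F (t - u))) = (LINT t|lebesgue. norm (F t))" for u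
    using lebesgue_integrable_real_affine_iff[of 1 F "-u"] F(1)
      lebesgue_integral_real_affine[of 1 F "-u"] lebesgue_integral_real_affine[of 1 "\<lambda>t. norm (F t)" "-u"]
    by simp_all
  have int: "integrable (lebesgue \<Otimes>\<^sub>M lebesgue) (\<lambda>(u, t). F (t - u) * G u)"
  proof (rule L.Fubini_integrable)
    show "(\<lambda>(u, t). F (t - u) * G u) \<in> borel_measurable (lebesgue \<Otimes>\<^sub>M lebesgue)"
      by measurable
    have "(LINT t|lebesgue. norm (F (t - u) * G u)) = (LINT t|lebesgue. norm (F t)) * norm (G u)" for u
      by (simp add: norm_mult shift_norm)
    then show "integrable lebesgue (\<lambda>u. LINT t|lebesgue. norm (case (u, t) of (u, t) \<Rightarrow> F (t - u) * G u))"
      using G by (auto intro!: integrable_mult_right integrable_norm)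
    show "AE u in lebesgue. integrable lebesgue (\<lambda>t. case (u, t) of (u, t) \<Rightarrow> F (t - u) * G u)"
      using shift(1) by (auto intro!: AE_I2 integrable_mult_left)
  qed
  show "integrable lebesgue (\<lambda>t. LINT u|lebesgue. F (t - u) * G u)"
    using L.integrable_snd[OF int] .
  show "(LINT t|lebesgue. LINT u|lebesgue. F (t - u) * G u) = (LINT t|lebesgue. F t) * (LINT u|lebesgue. G u)"
    unfolding L.Fubini_integral[OF int] using shift(2) by simp
qed

definition additive_conv :: "(real \<Rightarrow> complex) \<Rightarrow> (real \<Rightarrow> complex) \<Rightarrow> real \<Rightarrow> complex" where
  "additive_conv F G t = (LINT u|lebesgue. F (t - u) * G u)"

text \<open>The exponential weight is multiplicative, so weighting a convolution is the same as
  convolving the weighted functions; the rest is Fubini.\<close>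

lemma
  assumes "laplace_abs F (Re s)" "laplace_abs G (Re s)" "continuous_on UNIV F"
  shows laplace_abs_additive_conv: "laplace_abs (additive_conv F G) (Re s)"
    and laplace_additive_conv: "laplace (additive_conv F G) s = laplace F s * laplace G s"
proof -
  have weighted: "additive_conv F G t * exp (- z * of_real t)
      = (LINT u|lebesgue. (F (t - u) * exp (- z * of_real (t - u))) * (G u * exp (- z * of_real u)))" for z t
  proof -
    have split: "F (t - u) * G u * exp (- z * of_real t)
        = (F (t - u) * exp (- z * of_real (t - u))) * (G u * exp (- z * of_real u))" for u
    proof -
      have "exp (- z * of_real t) = exp (- z * of_real (t - u)) * exp (- z * of_real u)"
        unfolding exp_add[symmetric] by (simp add: algebra_simps)
      then show ?thesis by (simp add: mult_ac)
    qed
    show ?thesis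
      unfolding additive_conv_def split[symmetric] by (rule integral_mult_left_zero[symmetric])
  qed
  have cont: "continuous_on UNIV (\<lambda>u. F u * exp (- z * of_real u))" for z
    using assms(3) by (intro continuous_intros)
  show "laplace_abs (additive_conv F G) (Re s)"
  proof -
    have "integrable lebesgue (\<lambda>t. additive_conv F G t * exp (- of_real (Re s) * of_real t))"
      unfolding weighted
      by (rule integrable_additive_conv[OF _ cont]; rule laplace_abs_imp_integrable; simp add: assms)
    then show ?thesis
      by (simp add: laplace_abs_iff_integrable)
  qed
  show "laplace (additive_conv F G) s = laplace F s * laplace G s"
    unfolding laplace_def[of "additive_conv F G"] weighted unfolding laplace_def
    by (rule integral_additive_conv[OF _ cont]; rule laplace_abs_imp_integrable; rule assms)
qed

lemma integrable_exp_minus_abs: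
  fixes c :: real
  assumes "c > 0"
  shows "integrable lebesgue (\<lambda>u. exp (- c * \<bar>u\<bar>))"
proof -
  have "(\<lambda>u. exp (- c * u)) absolutely_integrable_on {0..}"
    using assms by (intro nonnegative_absolutely_integrable_1 integrable_on_exp_minus_to_infinity) auto
  then have 1: "integrable lebesgue (\<lambda>u. indicat_real {0..} u * exp (- c * u))"
    by (simp add: set_integrable_def)
  then have 2: "integrable lebesgue (\<lambda>u. indicat_real {0..} (- u) * exp (- c * (- u)))"
    using lebesgue_integrable_real_affine_iff[of "-1" "\<lambda>u. indicat_real {0..} u * exp (- c * u)" 0] by simp
  have "(\<lambda>u. exp (- c * \<bar>u\<bar>)) \<in> borel_measurable lebesgue"
    by (intro continuous_imp_lebesgue_measurable continuous_intros)
  then show ?thesis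
    by (rule Bochner_Integration.integrable_bound[OF Bochner_Integration.integrable_add[OF 1 2]])
       (auto intro!: AE_I2 simp: indicator_def)
qed

text \<open>The substitution x = exp (- u) turns dx/x into Lebesgue measure. The equality of the
  integrals is unconditional, so that convolutions and transforms can be rewritten before any
  convergence is known.\<close>

lemma
  fixes f :: "real \<Rightarrow> complex"
  shows integrable_exp_substitution:
      "set_integrable lebesgue {0<..} (\<lambda>x. f x / of_real x) \<longleftrightarrow> integrable lebesgue (\<lambda>u. f (exp (- u)))"
    and integral_exp_substitution:
      "(LINT x:{0<..}|lebesgue. f x / of_real x) = (LINT u|lebesgue. f (exp (- u)))"
proof -
  have range: "range (\<lambda>u::real. exp (- u)) = {0<..}"
  proof (intro set_eqI iffI)
    fix x :: real assume "x \<in> {0<..}"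
    then show "x \<in> range (\<lambda>u. exp (- u))"
      by (intro image_eqI[of _ _ "- ln x"]) auto
  qed auto
  have cov: "f absolutely_integrable_on UNIV \<and> integral UNIV f = b
      \<longleftrightarrow> (\<lambda>x. g x / of_real x) absolutely_integrable_on {0<..} \<and> integral {0<..} (\<lambda>x. g x / of_real x) = b"
    if "f = (\<lambda>u. g (exp (- u)))" for f g :: "real \<Rightarrow> complex" and b
  proof -
    have scale: "\<bar>- exp (- u)\<bar> *\<^sub>R (g (exp (- u)) / of_real (exp (- u))) = f u" for u
      by (simp add: scaleR_conv_of_real that)
    have "((\<lambda>u::real. exp (- u)) has_real_derivative - exp (- u)) (at u)" for u
      by (auto intro!: derivative_eq_intros)
    moreover have "inj (\<lambda>u::real. exp (- u))"
      by (auto intro: injI)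
    ultimately show ?thesis
      using has_absolute_integral_change_of_variables_real[of UNIV "\<lambda>u. exp (- u)" "\<lambda>u. - exp (- u)"
          "\<lambda>x. g x / of_real x" b]
      unfolding scale range by simp
  qed
  show iff: "set_integrable lebesgue {0<..} (\<lambda>x. f x / of_real x) \<longleftrightarrow> integrable lebesgue (\<lambda>u. f (exp (- u)))"
    using cov[OF refl, of f] by (auto simp: set_integrable_def)
  show "(LINT x:{0<..}|lebesgue. f x / of_real x) = (LINT u|lebesgue. f (exp (- u)))"
  proof (cases "integrable lebesgue (\<lambda>u. f (exp (- u)))")
    case True
    then have 1: "(\<lambda>u. f (exp (- u))) absolutely_integrable_on UNIV"
      by (simp add: set_integrable_def)
    have "(LINT u|lebesgue. f (exp (- u))) = integral UNIV (\<lambda>u. f (exp (- u)))"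
      using set_lebesgue_integral_eq_integral(2)[OF 1] by (simp add: set_lebesgue_integral_def)
    also have "\<dots> = integral {0<..} (\<lambda>x. f x / of_real x)"
      using cov[OF refl, of f] 1 by blast
    also have "\<dots> = (LINT x:{0<..}|lebesgue. f x / of_real x)"
      using True iff by (simp add: set_lebesgue_integral_eq_integral(2))
    finally show ?thesis ..
  next
    \<comment> \<open>Neither side is integrable, and both integrals take the default value
      0.\<close>
    case False
    with iff have "\<not> integrable lebesgue (\<lambda>x. indicat_real {0<..} x *\<^sub>R (f x / of_real x))"
      by (simp add: set_integrable_def)
    with False show ?thesis
      by (simp add: set_lebesgue_integral_def not_integrable_integral_eq)
  qed
qed

section \<open>Mellin transforms and convolutions in the logarithmic coordinate\<close>

lemma of_real_exp_powr: "complex_of_real (exp (- u)) powr s = exp (- s * of_real u)"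
proof -
  have "complex_of_real (exp (- u)) powr s = exp (s * Ln (of_real (exp (- u))))"
    by (simp add: powr_def)
  also have "Ln (of_real (exp (- u))) = complex_of_real (- u)"
    by (subst Ln_of_real) auto
  finally show ?thesis by simp
qed

lemma mellin_eq_laplace: "mellin f s = laplace (\<lambda>u. f (exp (- u))) s"
  unfolding mellin_def laplace_def integral_exp_substitution[of "\<lambda>x. f x * of_real x powr s"] of_real_exp_powr ..

lemma mconv_eq_additive_conv:
  "mconv f g (exp (- t)) = additive_conv (\<lambda>u. f (exp (- u))) (\<lambda>u. g (exp (- u))) t"
  unfolding mconv_def additive_conv_def integral_exp_substitution[of "\<lambda>y. f (exp (- t) / y) * g y"]
  by (simp add: exp_diff exp_minus divide_inverse mult.commute)

lemma additive_conv_commute: "additive_conv F G t = additive_conv G F t"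
  unfolding additive_conv_def
  by (subst lebesgue_integral_real_affine[of "-1" _ t]) (simp_all add: mult.commute)

text \<open>For H u = h (exp (- u)) this is \<open>h\<close> restricted to 0 < x < 1, that is
  \<open>h^+\<close>; the point u = 0 belongs to the other part.\<close>

definition pos_part :: "(real \<Rightarrow> real) \<Rightarrow> real \<Rightarrow> complex" where
  "pos_part H u = complex_of_real (if u > 0 then H u else 0)"

text \<open>Replacing u by - u exchanges s and 1 - s, the factor exp u supplying the 1. That factor
  is the \<open>x\<close> of the functional equation, taken at x = exp u.\<close>

lemma
  shows laplace_abs_reflect:
      "laplace_abs f (1 - \<sigma>) \<Longrightarrow> laplace_abs (\<lambda>u. c * (exp (of_real u) * f (- u))) \<sigma>"
    and laplace_reflect: "laplace (\<lambda>u. c * (exp (of_real u) * f (- u))) s = c * laplace f (1 - s)"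
proof -
  have eq: "c * (exp (of_real u) * f (- u)) * exp (- z * of_real u)
      = c * (\<lambda>v. f v * exp (- (1 - z) * of_real v)) (0 + - 1 * u)" for u z
  proof -
    have "exp (complex_of_real u) * exp (- z * of_real u) = exp (- (1 - z) * of_real (- u))"
      unfolding exp_add[symmetric] by (simp add: algebra_simps)
    then show ?thesis by (simp add: mult_ac)
  qed
  show "laplace_abs (\<lambda>u. c * (exp (of_real u) * f (- u))) \<sigma>" if "laplace_abs f (1 - \<sigma>)"
  proof -
    have "integrable lebesgue (\<lambda>v. f v * exp (- (1 - of_real \<sigma>) * of_real v))"
      using laplace_abs_imp_integrable[of f "1 - of_real \<sigma>"] that by simp
    then have "integrable lebesgue (\<lambda>u. c * (\<lambda>v. f v * exp (- (1 - of_real \<sigma>) * of_real v)) (0 + - 1 * u))"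
      by (intro integrable_mult_right) (subst lebesgue_integrable_real_affine_iff, auto)
    then have "integrable lebesgue (\<lambda>u. c * (exp (of_real u) * f (- u)) * exp (- of_real \<sigma> * of_real u))"
      unfolding eq .
    then show ?thesis by (simp add: laplace_abs_iff_integrable)
  qed
  show "laplace (\<lambda>u. c * (exp (of_real u) * f (- u))) s = c * laplace f (1 - s)"
    unfolding laplace_def eq
    by (subst lebesgue_integral_real_affine[of "-1" "\<lambda>v. f v * exp (- (1 - s) * of_real v)" 0]) simp_all
qed

text \<open>For u < 0 the functional equation expresses \<open>h\<close> through its values on the
  other side of 1. At u = 0 both terms on the right vanish, so this point is excluded; integrals do
  not see it.\<close>

lemma additive_functional_equation:
  fixes h :: "real \<Rightarrow> real"
  assumes "\<forall>x>0. h (1 / x) = - \<epsilon> * x * h x" and "u \<noteq> 0"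
  shows "complex_of_real (h (exp (- u)))
    = pos_part (\<lambda>v. h (exp (- v))) u
      + (- of_real \<epsilon>) * (exp (of_real u) * pos_part (\<lambda>v. h (exp (- v))) (- u))"
proof (cases "u > 0")
  case False
  have "h (exp (- u)) = - \<epsilon> * exp u * h (exp u)"
    using assms(1)[rule_format, of "exp u"] by (simp add: exp_minus divide_inverse)
  then show ?thesis
    using False assms(2) by (simp add: pos_part_def exp_of_real)
qed (simp add: pos_part_def)

lemma plus_part_exp: "plus_part (\<lambda>x. of_real (h x)) (exp (- u)) = pos_part (\<lambda>v. h (exp (- v))) u"
  by (simp add: plus_part_def pos_part_def)

subsection \<open>Mean-periodicity with respect to Schwartz functions\<close>

text \<open>Boundedness of x^m * |\<phi> x| becomes growth at most exp (m * u), for every integer m.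
  Integers at distance at least 1 from \<open>\<sigma>\<close> on either side provide the extra
  factor exp (- |u|).\<close>

lemma schwartz_exp_bound:
  assumes "\<phi> \<in> schwartz"
  shows "\<exists>C\<ge>0. \<forall>u. norm (\<phi> (exp (- u))) \<le> C * exp (\<sigma> * u - \<bar>u\<bar>)"
proof -
  have bd: "\<exists>C\<ge>0. \<forall>u. norm (\<phi> (exp (- u))) \<le> C * exp (real_of_int m * u)" for m :: int
  proof -
    have "bdd_above ((\<lambda>x. x powi m * norm (nth_deriv 0 \<phi> x)) ` {0<..})"
      using assms unfolding schwartz_def by (simp only: mem_Collect_eq)
    then obtain C where C: "\<And>x. x > 0 \<Longrightarrow> x powi m * norm (\<phi> x) \<le> C"
      by (auto simp: bdd_above_def nth_deriv_def)
    have "norm (\<phi> (exp (- u))) \<le> C * exp (real_of_int m * u)" for u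
    proof -
      have "exp (- u) powi m = exp (- (real_of_int m * u))"
        by (metis exp_power_int mult.commute mult_minus_right)
      then have "exp (- (real_of_int m * u)) * norm (\<phi> (exp (- u))) \<le> C"
        using C[of "exp (- u)"] by simp
      then show ?thesis by (simp add: exp_minus field_simps)
    qed
    moreover from this[of 0] have "C \<ge> 0"
      by (simp add: order_trans[OF norm_ge_zero])
    ultimately show ?thesis by blast
  qed
  obtain C1 where C1: "C1 \<ge> 0" "\<And>u. norm (\<phi> (exp (- u))) \<le> C1 * exp (real_of_int \<lfloor>\<sigma> - 1\<rfloor> * u)"
    using bd by blast
  obtain C2 where C2: "C2 \<ge> 0" "\<And>u. norm (\<phi> (exp (- u))) \<le> C2 * exp (real_of_int \<lceil>\<sigma> + 1\<rceil> * u)"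
    using bd by blast
  have "norm (\<phi> (exp (- u))) \<le> (C1 + C2) * exp (\<sigma> * u - \<bar>u\<bar>)" for u
  proof (cases "u \<ge> 0")
    case True
    have "norm (\<phi> (exp (- u))) \<le> C1 * exp (real_of_int \<lfloor>\<sigma> - 1\<rfloor> * u)" by (rule C1)
    also have "\<dots> \<le> C1 * exp (\<sigma> * u - \<bar>u\<bar>)"
    proof -
      have "real_of_int \<lfloor>\<sigma> - 1\<rfloor> * u \<le> (\<sigma> - 1) * u"
        using True by (intro mult_right_mono) auto
      then show ?thesis using C1(1) True by (intro mult_left_mono) (auto simp: algebra_simps)
    qed
    also have "\<dots> \<le> (C1 + C2) * exp (\<sigma> * u - \<bar>u\<bar>)"
      using C2(1) by (intro mult_right_mono) auto
    finally show ?thesis .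
  next
    case False
    have "norm (\<phi> (exp (- u))) \<le> C2 * exp (real_of_int \<lceil>\<sigma> + 1\<rceil> * u)" by (rule C2)
    also have "\<dots> \<le> C2 * exp (\<sigma> * u - \<bar>u\<bar>)"
    proof -
      have "real_of_int \<lceil>\<sigma> + 1\<rceil> * u \<le> (\<sigma> + 1) * u"
        using False by (intro mult_right_mono_neg) auto
      then show ?thesis using C2(1) False by (intro mult_left_mono) (auto simp: algebra_simps)
    qed
    also have "\<dots> \<le> (C1 + C2) * exp (\<sigma> * u - \<bar>u\<bar>)"
      using C1(1) by (intro mult_right_mono) auto
    finally show ?thesis .
  qed
  then show ?thesis using C1(1) C2(1) by (intro exI[of _ "C1 + C2"]) auto
qed

lemma schwartz_exp_continuous:
  assumes "\<phi> \<in> schwartz"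
  shows "continuous_on UNIV (\<lambda>u. \<phi> (exp (- u)))"
proof -
  have "\<forall>x\<in>{0<..}. nth_deriv 0 \<phi> differentiable (at x)"
    using assms unfolding schwartz_def smooth_on_def by blast
  then have "continuous_on {0<..} \<phi>"
    by (auto simp: nth_deriv_def intro!: continuous_at_imp_continuous_on differentiable_imp_continuous_within)
  then show ?thesis
    by (rule continuous_on_compose2) (auto intro!: continuous_intros)
qed

lemma schwartz_laplace_abs:
  assumes "\<phi> \<in> schwartz"
  shows "laplace_abs (\<lambda>u. \<phi> (exp (- u))) \<sigma>"
proof -
  obtain C where C: "\<And>u. norm (\<phi> (exp (- u))) \<le> C * exp (\<sigma> * u - \<bar>u\<bar>)"
    using schwartz_exp_bound[OF assms] by blast
  show ?thesis
  proof (rule laplace_absI)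
    show "(\<lambda>u. \<phi> (exp (- u))) \<in> borel_measurable lebesgue"
      by (intro continuous_imp_lebesgue_measurable schwartz_exp_continuous assms)
    show "integrable lebesgue (\<lambda>u. C * exp (- 1 * \<bar>u\<bar>))"
      by (intro integrable_mult_right integrable_exp_minus_abs) simp
    show "norm (\<phi> (exp (- u))) * exp (- \<sigma> * u) \<le> C * exp (- 1 * \<bar>u\<bar>)" for u
    proof -
      have "norm (\<phi> (exp (- u))) * exp (- \<sigma> * u) \<le> C * exp (\<sigma> * u - \<bar>u\<bar>) * exp (- \<sigma> * u)"
        by (intro mult_right_mono C) simp
      also have "\<dots> = C * exp (- 1 * \<bar>u\<bar>)"
        by (simp add: mult.assoc flip: exp_add)
      finally show ?thesis .
    qed
  qed
qed

lemma additive_conv_integrable: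
  assumes "laplace_abs g \<sigma>" and "continuous_on UNIV F"
    and bound: "\<And>v. norm (F v) \<le> C * exp (\<sigma> * v)"
  shows "integrable lebesgue (\<lambda>u. F (t - u) * g u)"
proof -
  have [measurable]: "(\<lambda>u. F (t - u)) \<in> borel_measurable lebesgue"
    by (intro continuous_imp_lebesgue_measurable continuous_on_compose2[OF assms(2)] continuous_intros) auto
  note assms(1)[measurable]
  have I: "integrable lebesgue (\<lambda>u. C * exp (\<sigma> * t) * (norm (g u) * exp (- \<sigma> * u)))"
    using assms(1) by (intro integrable_mult_right) (simp add: laplace_abs_def)
  have "(\<lambda>u. F (t - u) * g u) \<in> borel_measurable lebesgue" by measurable
  then show ?thesis
  proof (rule Bochner_Integration.integrable_bound[OF I]; intro AE_I2)
    fix u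
    have "norm (F (t - u) * g u) \<le> C * exp (\<sigma> * (t - u)) * norm (g u)"
      by (simp add: norm_mult mult_right_mono bound)
    also have "exp (\<sigma> * (t - u)) = exp (\<sigma> * t) * exp (- \<sigma> * u)"
      unfolding exp_add[symmetric] by (simp add: algebra_simps)
    finally show "norm (F (t - u) * g u) \<le> norm (C * exp (\<sigma> * t) * (norm (g u) * exp (- \<sigma> * u)))"
      by (simp add: mult_ac)
  qed
qed

lemma integral_cong_nonzero:
  fixes f g :: "real \<Rightarrow> complex"
  assumes f: "f \<in> borel_measurable lebesgue" and eq: "\<And>u. u \<noteq> 0 \<Longrightarrow> f u = g u"
  shows "(LINT u|lebesgue. f u) = (LINT u|lebesgue. g u)"
proof (rule integral_cong_AE[OF f])
  have "(\<lambda>u. if u = 0 then g 0 else f u) \<in> borel_measurable lebesgue"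
    by (intro measurable_If f) auto
  also have "(\<lambda>u. if u = 0 then g 0 else f u) = g"
    using eq by auto
  finally show "g \<in> borel_measurable lebesgue" .
  have "{u \<in> space lebesgue. f u \<noteq> g u} \<subseteq> {0}"
    using eq by blast
  then show "AE u in lebesgue. f u = g u"
    by (rule AE_I) auto
qed

text \<open>Only 0 < x < 1 matters: local integrability controls bounded \<open>u\<close>, and the
  growth bound at 0 gives exp (a * u) for large \<open>u\<close>.\<close>

lemma tempered_laplace_abs:
  fixes h :: "real \<Rightarrow> real"
  assumes "tempered (\<lambda>x. of_real (h x))"
  shows "\<exists>a. \<forall>\<sigma>>a. laplace_abs (pos_part (\<lambda>u. h (exp (- u)))) \<sigma>"
proof -
  define f where "f = pos_part (\<lambda>u. h (exp (- u)))"
  define g where "g N u = (if u \<le> N then f u else 0)" for N u :: real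
  have int_g: "integrable lebesgue (g N)" if "N > 0" for N
  proof -
    \<comment> \<open>On [exp (- N), 1) the density 1/x is at most exp N, so local integrability
      with respect to dx suffices.\<close>
    define k where "k x = indicat_real {exp (- N)..<1} x *\<^sub>R complex_of_real (h x)" for x
    have "set_integrable lebesgue {exp (- N)..1} (\<lambda>x. complex_of_real (h x))"
      using assms that unfolding tempered_def by auto
    then have "set_integrable lebesgue {exp (- N)..<1} (\<lambda>x. complex_of_real (h x))"
      by (rule set_integrable_subset) auto
    then have int_k: "integrable lebesgue k"
      by (simp add: set_integrable_def k_def[abs_def])
    then have [measurable]: "k \<in> borel_measurable lebesgue" by auto
    have [measurable]: "(\<lambda>x. complex_of_real x) \<in> borel_measurable lebesgue"
      by (intro continuous_imp_lebesgue_measurable continuous_intros)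
    have "set_integrable lebesgue {0<..} (\<lambda>x. k x / of_real x)"
      unfolding set_integrable_def
    proof (rule Bochner_Integration.integrable_bound[OF integrable_mult_right[OF int_k, of "of_real (exp N)"]])
      show "(\<lambda>x. indicat_real {0<..} x *\<^sub>R (k x / of_real x)) \<in> borel_measurable lebesgue"
        by measurable
      have "norm (indicat_real {0<..} x *\<^sub>R (k x / of_real x)) \<le> norm (complex_of_real (exp N) * k x)" for x
      proof (cases "x \<in> {exp (- N)..<1}")
        case True
        then have "x > 0" by (auto intro: less_le_trans[OF exp_gt_zero])
        moreover from this True have "1 / x \<le> exp N"
          by (simp add: exp_minus field_simps)
        ultimately show ?thesis
          using mult_right_mono[of "1 / x" "exp N" "norm (k x)"]
          by (simp add: norm_mult norm_divide)
      qed (simp add: k_def)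
      then show "AE x in lebesgue. norm (indicat_real {0<..} x *\<^sub>R (k x / of_real x)) \<le> norm (complex_of_real (exp N) * k x)"
        by simp
    qed
    then have "integrable lebesgue (\<lambda>u. k (exp (- u)))"
      by (simp add: integrable_exp_substitution)
    also have "(\<lambda>u. k (exp (- u))) = g N"
      by (auto simp: k_def g_def f_def pos_part_def fun_eq_iff indicator_def)
    finally show ?thesis .
  qed
  \<comment> \<open>Measurability of \<open>f\<close> comes from its integrable truncations, of
    which it is the pointwise limit.\<close>
  have meas_f: "f \<in> borel_measurable lebesgue"
  proof (rule borel_measurable_LIMSEQ_metric)
    show "g (real (Suc n)) \<in> borel_measurable lebesgue" for n
      using int_g[of "real (Suc n)"] by auto
    show "(\<lambda>n. g (real (Suc n)) u) \<longlonglongrightarrow> f u" for u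
    proof (rule tendsto_eventually)
      show "\<forall>\<^sub>F n in sequentially. g (real (Suc n)) u = f u"
        using eventually_ge_at_top[of "nat \<lceil>u\<rceil>"] by eventually_elim (auto simp: g_def nat_le_iff ceiling_le_iff)
    qed
  qed
  obtain a where "(\<lambda>x. norm (complex_of_real (h x))) \<in> O[at_right 0](\<lambda>x. x powr (- a))"
    using assms unfolding tempered_def by blast
  then obtain C where "C > 0" and C: "\<forall>\<^sub>F x in at_right 0. \<bar>h x\<bar> \<le> C * norm (x powr (- a))"
    by (auto elim: landau_o.bigE)
  from C obtain d where d: "d > 0" "\<And>x. 0 < x \<Longrightarrow> x < d \<Longrightarrow> \<bar>h x\<bar> \<le> C * norm (x powr (- a))"
    unfolding eventually_at_right_field by auto
  define N where "N = max 1 (- ln d)"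
  have far: "norm (f u) \<le> C * exp (a * u)" if "u > N" for u
  proof -
    have "exp (- u) < d"
    proof -
      have "- u < ln d" using that by (auto simp: N_def)
      then show ?thesis using d(1) by (metis exp_less_cancel_iff exp_ln)
    qed
    then have "\<bar>h (exp (- u))\<bar> \<le> C * norm (exp (- u) powr (- a))"
      by (intro d) auto
    also have "exp (- u) powr (- a) = exp (a * u)"
      by (simp add: powr_def)
    finally show ?thesis using that by (auto simp: f_def pos_part_def N_def)
  qed
  have "laplace_abs f \<sigma>" if "\<sigma> > a" for \<sigma>
  proof (rule laplace_absI[OF meas_f])
    show "integrable lebesgue (\<lambda>u. norm (g N u) * exp (\<bar>\<sigma>\<bar> * N) + C * exp (- (\<sigma> - a) * \<bar>u\<bar>))"
      using int_g[of N] that by (intro Bochner_Integration.integrable_add integrable_mult_left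
          integrable_mult_right integrable_exp_minus_abs integrable_norm) (auto simp: N_def)
    show "norm (f u) * exp (- \<sigma> * u) \<le> norm (g N u) * exp (\<bar>\<sigma>\<bar> * N) + C * exp (- (\<sigma> - a) * \<bar>u\<bar>)" for u
    proof -
      consider "u \<le> 0" | "0 < u" "u \<le> N" | "u > N" "u > 0" by (force simp: N_def)
      then show ?thesis
      proof cases
        case 1
        then show ?thesis using \<open>C > 0\<close> by (simp add: f_def pos_part_def)
      next
        case 2
        have "- \<sigma> * u \<le> \<bar>\<sigma>\<bar> * N" using 2 by (intro mult_mono) auto
        then have "norm (f u) * exp (- \<sigma> * u) \<le> norm (g N u) * exp (\<bar>\<sigma>\<bar> * N)"
          using 2 by (simp add: g_def mult_left_mono)
        then show ?thesis using \<open>C > 0\<close> by (simp add: add_increasing2)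
      next
        case 3
        have "norm (f u) * exp (- \<sigma> * u) \<le> C * exp (a * u) * exp (- \<sigma> * u)"
          using far 3 by (intro mult_right_mono) auto
        also have "\<dots> = C * exp (- (\<sigma> - a) * \<bar>u\<bar>)"
          using 3 by (simp add: mult.assoc algebra_simps flip: exp_add)
        finally show ?thesis by (simp add: add_increasing)
      qed
    qed
  qed
  then show ?thesis unfolding f_def by blast
qed

text \<open>The convolution of \<open>\<phi>\<close> with \<open>h^+\<close> is minus the
  convolution with the reflected part. In the first form its transform converges far to the right,
  in the second far to the left; convergence at the abscissae in between makes \<open>A\<close>
  entire.\<close>

lemma Mellin_Carleman_via_schwartz:
  fixes h :: "real \<Rightarrow> real"
  assumes temp: "tempered (\<lambda>x. of_real (h x))" and fe: "\<forall>x>0. h (1 / x) = - \<epsilon> * x * h x"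
    and \<phi>: "\<phi> \<in> schwartz_annihilators (\<lambda>x. of_real (h x))"
  defines "Hp \<equiv> pos_part (\<lambda>u. h (exp (- u)))"
    and "A \<equiv> mellin (mconv \<phi> (plus_part (\<lambda>x. of_real (h x))))" and "B \<equiv> mellin \<phi>"
  shows "A holomorphic_on UNIV \<and> B holomorphic_on UNIV \<and>
    (\<exists>a. (\<forall>\<sigma>>a. laplace_abs Hp \<sigma>) \<and> (\<forall>s. Re s > a \<longrightarrow> A s = B s * laplace Hp s) \<and>
      (\<forall>s. Re s < 1 - a \<longrightarrow> A s = of_real \<epsilon> * B s * laplace Hp (1 - s)))"
proof -
  define F where "F u = \<phi> (exp (- u))" for u
  define Hm where "Hm u = (- of_real \<epsilon>) * (exp (of_real u) * Hp (- u))" for u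
  have \<phi>s: "\<phi> \<in> schwartz" and \<phi>0: "\<And>x. x > 0 \<Longrightarrow> mconv (\<lambda>x. of_real (h x)) \<phi> x = 0"
    using \<phi> unfolding schwartz_annihilators_def by auto
  have F_abs: "laplace_abs F \<sigma>" for \<sigma>
    unfolding F_def using \<phi>s by (rule schwartz_laplace_abs)
  have F_cont: "continuous_on UNIV F"
    unfolding F_def using \<phi>s by (rule schwartz_exp_continuous)
  have F_bd: "\<exists>C. \<forall>v. norm (F v) \<le> C * exp (\<sigma> * v)" for \<sigma>
  proof -
    obtain C where C: "C \<ge> 0" "\<And>u. norm (F u) \<le> C * exp (\<sigma> * u - \<bar>u\<bar>)"
      unfolding F_def using schwartz_exp_bound[OF \<phi>s] by blast
    have "norm (F u) \<le> C * exp (\<sigma> * u)" for u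
      by (rule order_trans[OF C(2)]) (intro mult_left_mono, auto simp: C)
    then show ?thesis by blast
  qed
  obtain a where a: "\<And>\<sigma>. \<sigma> > a \<Longrightarrow> laplace_abs Hp \<sigma>"
    using tempered_laplace_abs[OF temp] unfolding Hp_def by blast
  have Hm_abs: "laplace_abs Hm \<sigma>" if "\<sigma> < 1 - a" for \<sigma>
    unfolding Hm_def using that a by (intro laplace_abs_reflect) auto
  have B_eq: "B = laplace F"
    by (simp add: B_def fun_eq_iff mellin_eq_laplace F_def[abs_def])
  have A_eq: "A = laplace (additive_conv F Hp)"
    unfolding A_def fun_eq_iff mellin_eq_laplace mconv_eq_additive_conv plus_part_exp F_def Hp_def by simp
  have conv_neg: "additive_conv F Hp = (\<lambda>t. - 1 * additive_conv F Hm t)"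
  proof
    fix t
    \<comment> \<open>Rates at which the two parts converge absolutely: a + 1 > a for
      \<open>Hp\<close> and - a < 1 - a for \<open>Hm\<close>.\<close>
    obtain C1 where C1: "\<And>v. norm (F v) \<le> C1 * exp ((a + 1) * v)" using F_bd by blast
    obtain C2 where C2: "\<And>v. norm (F v) \<le> C2 * exp ((- a) * v)" using F_bd by blast
    have 1: "integrable lebesgue (\<lambda>u. F (t - u) * Hp u)"
      by (rule additive_conv_integrable[OF a F_cont C1]) simp
    have 2: "integrable lebesgue (\<lambda>u. F (t - u) * Hm u)"
      by (rule additive_conv_integrable[OF Hm_abs F_cont C2]) simp
    have "additive_conv F Hp t + additive_conv F Hm t = (LINT u|lebesgue. F (t - u) * Hp u + F (t - u) * Hm u)"
      unfolding additive_conv_def by (rule Bochner_Integration.integral_add[OF 1 2, symmetric])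
    also have "\<dots> = (LINT u|lebesgue. F (t - u) * of_real (h (exp (- u))))"
    proof (rule integral_cong_nonzero)
      show "(\<lambda>u. F (t - u) * Hp u + F (t - u) * Hm u) \<in> borel_measurable lebesgue"
        using 1 2 by (intro borel_measurable_add) auto
      show "F (t - u) * Hp u + F (t - u) * Hm u = F (t - u) * of_real (h (exp (- u)))" if "u \<noteq> 0" for u
        unfolding additive_functional_equation[OF fe that] Hp_def Hm_def by (rule distrib_left[symmetric])
    qed
    also have "\<dots> = additive_conv F (\<lambda>u. of_real (h (exp (- u)))) t"
      by (simp add: additive_conv_def)
    also have "\<dots> = mconv (\<lambda>x. of_real (h x)) \<phi> (exp (- t))"
      unfolding mconv_eq_additive_conv F_def[symmetric] by (rule additive_conv_commute)
    also have "\<dots> = 0" by (rule \<phi>0) simp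
    finally show "additive_conv F Hp t = - 1 * additive_conv F Hm t"
      by (simp add: eq_neg_iff_add_eq_0)
  qed
  have R: "laplace_abs (additive_conv F Hp) (Re s)" "laplace (additive_conv F Hp) s = laplace F s * laplace Hp s"
    if "Re s > a" for s
    using laplace_abs_additive_conv[OF F_abs a[OF that] F_cont] laplace_additive_conv[OF F_abs a[OF that] F_cont]
    by auto
  have L: "laplace_abs (additive_conv F Hp) (Re s)"
    "laplace (additive_conv F Hp) s = of_real \<epsilon> * laplace F s * laplace Hp (1 - s)"
    if "Re s < 1 - a" for s
  proof -
    show "laplace_abs (additive_conv F Hp) (Re s)"
      unfolding conv_neg
      by (intro laplace_abs_cmult laplace_abs_additive_conv[OF F_abs Hm_abs[OF that] F_cont])
    have "laplace (additive_conv F Hp) s = - (laplace F s * laplace Hm s)"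
      unfolding conv_neg laplace_cmult
      by (simp add: laplace_additive_conv[OF F_abs Hm_abs[OF that] F_cont])
    also have "laplace Hm s = - of_real \<epsilon> * laplace Hp (1 - s)"
      unfolding Hm_def by (rule laplace_reflect)
    finally show "laplace (additive_conv F Hp) s = of_real \<epsilon> * laplace F s * laplace Hp (1 - s)"
      by simp
  qed
  have conv_abs: "laplace_abs (additive_conv F Hp) \<sigma>" for \<sigma>
  proof (rule laplace_abs_between)
    show "laplace_abs (additive_conv F Hp) (min \<sigma> (- a))"
      using L(1)[of "of_real (min \<sigma> (- a))"] by (simp add: min_less_iff_disj)
    show "laplace_abs (additive_conv F Hp) (max \<sigma> (a + 1))"
      using R(1)[of "of_real (max \<sigma> (a + 1))"] by (simp add: less_max_iff_disj)
  qed auto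
  have "A holomorphic_on UNIV" "B holomorphic_on UNIV"
    unfolding A_eq B_eq by (rule laplace_holomorphic[of UNIV]; use conv_abs F_abs in auto)+
  then show ?thesis
    using a R(2) L(2) unfolding A_eq B_eq by blast
qed

subsection \<open>Continuous functionals on functions of exponential growth\<close>

lemma nth_deriv_0 [simp]: "nth_deriv 0 f = f"
  by (simp add: nth_deriv_def)

lemma nth_deriv_Suc: "nth_deriv (Suc n) f = (\<lambda>x. vector_derivative (nth_deriv n f) (at x))"
  by (simp add: nth_deriv_def)

lemma nth_deriv_add: "nth_deriv n (nth_deriv k f) = nth_deriv (n + k) f"
  by (simp add: nth_deriv_def funpow_add)

lemma smooth_on_has_vector_derivative:
  assumes "smooth_on A f" "x \<in> A"
  shows "(nth_deriv n f has_vector_derivative nth_deriv (Suc n) f x) (at x)"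
  using assms unfolding smooth_on_def nth_deriv_Suc by (simp add: vector_derivative_works)

text \<open>Iterated derivatives are pinned down by exhibiting a candidate sequence
  \<open>D\<close>. Openness of \<open>A\<close> lets a derivative be computed from the values on
  \<open>A\<close> only.\<close>

lemma
  assumes "open A" and base: "\<And>x. x \<in> A \<Longrightarrow> f x = D 0 x"
    and step: "\<And>n x. x \<in> A \<Longrightarrow> (D n has_vector_derivative D (Suc n) x) (at x)"
  shows nth_deriv_eqI: "x \<in> A \<Longrightarrow> nth_deriv n f x = D n x"
    and smooth_onI: "smooth_on A f"
proof -
  have eq: "nth_deriv n f x = D n x" if "x \<in> A" for n x
    using that
  proof (induction n arbitrary: x)
    case 0
    then show ?case using base by simp
  next
    case (Suc n)
    have "(nth_deriv n f has_vector_derivative D (Suc n) x) (at x)"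
      by (rule has_vector_derivative_transform_within_open[OF step[OF Suc.prems] \<open>open A\<close> Suc.prems])
         (simp add: Suc.IH)
    then show ?case by (simp add: nth_deriv_Suc vector_derivative_at)
  qed
  then show "nth_deriv n f x = D n x" if "x \<in> A" using that by blast
  show "smooth_on A f"
    unfolding smooth_on_def
  proof (intro allI ballI)
    fix n x assume x: "x \<in> A"
    have "(nth_deriv n f has_vector_derivative D (Suc n) x) (at x)"
      by (rule has_vector_derivative_transform_within_open[OF step[OF x] \<open>open A\<close> x]) (simp add: eq)
    then show "nth_deriv n f differentiable at x"
      by (rule differentiableI_vector)
  qed
qed

lemma
  assumes "smooth_on UNIV f" "smooth_on UNIV g"
  shows nth_deriv_lincomb: "nth_deriv n (\<lambda>x. a * f x + b * g x) x = a * nth_deriv n f x + b * nth_deriv n g x"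
    and smooth_on_lincomb: "smooth_on UNIV (\<lambda>x. a * f x + b * g x)"
proof -
  have *: "((\<lambda>x. a * nth_deriv n f x + b * nth_deriv n g x) has_vector_derivative
      a * nth_deriv (Suc n) f x + b * nth_deriv (Suc n) g x) (at x)" for n x
    by (intro has_vector_derivative_add has_vector_derivative_mult_right
        smooth_on_has_vector_derivative[OF assms(1)] smooth_on_has_vector_derivative[OF assms(2)]) auto
  show "nth_deriv n (\<lambda>x. a * f x + b * g x) x = a * nth_deriv n f x + b * nth_deriv n g x"
    by (rule nth_deriv_eqI[of UNIV _ "\<lambda>n x. a * nth_deriv n f x + b * nth_deriv n g x"]) (use * in auto)
  show "smooth_on UNIV (\<lambda>x. a * f x + b * g x)"
    by (rule smooth_onI[of UNIV _ "\<lambda>n x. a * nth_deriv n f x + b * nth_deriv n g x"]) (use * in auto)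
qed

lemma F_space_iff:
  "f \<in> F_space m \<longleftrightarrow> smooth_on UNIV f \<and>
     (\<forall>n. \<exists>C. \<forall>x. norm (nth_deriv n f x) \<le> C * exp (real m * \<bar>x\<bar>))"
proof -
  have "norm (nth_deriv n f x) * exp (- (real m * \<bar>x\<bar>)) \<le> C \<longleftrightarrow>
      norm (nth_deriv n f x) \<le> C * exp (real m * \<bar>x\<bar>)" for n x C
    by (simp add: exp_minus field_simps)
  then show ?thesis
    by (auto simp: F_space_def bdd_above_def)
qed

lemma F_space_smooth: "f \<in> F_space m \<Longrightarrow> smooth_on UNIV f"
  by (simp add: F_space_iff)

lemma F_space_uniform_bound:
  assumes "f \<in> F_space m"
  shows "\<exists>C\<ge>0. \<forall>n\<le>N. \<forall>x. norm (nth_deriv n f x) \<le> C * exp (real m * \<bar>x\<bar>)"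
proof -
  obtain C where C: "\<And>n x. norm (nth_deriv n f x) \<le> C n * exp (real m * \<bar>x\<bar>)"
    using assms unfolding F_space_iff by metis
  have nonneg: "C n \<ge> 0" for n
    using order_trans[OF norm_ge_zero C[of n 0]] by simp
  have "norm (nth_deriv n f x) \<le> (\<Sum>k\<le>N. C k) * exp (real m * \<bar>x\<bar>)" if "n \<le> N" for n x
    by (rule order_trans[OF C]) (intro mult_right_mono member_le_sum, use that nonneg in auto)
  then show ?thesis
    by (intro exI[of _ "\<Sum>k\<le>N. C k"]) (auto intro: sum_nonneg nonneg)
qed

lemma F_space_lincomb:
  assumes "f \<in> F_space m" "g \<in> F_space m"
  shows "(\<lambda>x. a * f x + b * g x) \<in> F_space m"
  unfolding F_space_iff
proof (intro conjI allI)
  show "smooth_on UNIV (\<lambda>x. a * f x + b * g x)"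
    by (intro smooth_on_lincomb F_space_smooth[OF assms(1)] F_space_smooth[OF assms(2)])
  fix n
  obtain C1 C2 where C: "\<And>x. norm (nth_deriv n f x) \<le> C1 * exp (real m * \<bar>x\<bar>)"
    "\<And>x. norm (nth_deriv n g x) \<le> C2 * exp (real m * \<bar>x\<bar>)"
    using assms unfolding F_space_iff by meson
  have "norm (nth_deriv n (\<lambda>x. a * f x + b * g x) x) \<le> (norm a * C1 + norm b * C2) * exp (real m * \<bar>x\<bar>)" for x
  proof -
    have "norm (nth_deriv n (\<lambda>x. a * f x + b * g x) x) \<le> norm a * norm (nth_deriv n f x) + norm b * norm (nth_deriv n g x)"
      unfolding nth_deriv_lincomb[OF F_space_smooth[OF assms(1)] F_space_smooth[OF assms(2)]]
      by (rule order_trans[OF norm_triangle_ineq]) (simp add: norm_mult)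
    also have "\<dots> \<le> norm a * (C1 * exp (real m * \<bar>x\<bar>)) + norm b * (C2 * exp (real m * \<bar>x\<bar>))"
      by (intro add_mono mult_left_mono C) auto
    finally show ?thesis by (simp add: algebra_simps)
  qed
  then show "\<exists>C. \<forall>x. norm (nth_deriv n (\<lambda>x. a * f x + b * g x) x) \<le> C * exp (real m * \<bar>x\<bar>)" by blast
qed

lemma F_space_mono: "m \<le> m' \<Longrightarrow> F_space m \<subseteq> F_space m'"
proof
  fix f assume "m \<le> m'" "f \<in> F_space m"
  have "\<exists>C. \<forall>x. norm (nth_deriv n f x) \<le> C * exp (real m' * \<bar>x\<bar>)" for n
  proof -
    obtain C where C: "C \<ge> 0" "\<And>x. norm (nth_deriv n f x) \<le> C * exp (real m * \<bar>x\<bar>)"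
      using F_space_uniform_bound[OF \<open>f \<in> F_space m\<close>, of n] by auto
    have "norm (nth_deriv n f x) \<le> C * exp (real m' * \<bar>x\<bar>)" for x
      by (rule order_trans[OF C(2)])
         (use \<open>m \<le> m'\<close> C(1) in \<open>auto intro!: mult_left_mono mult_right_mono\<close>)
    then show ?thesis by blast
  qed
  then show "f \<in> F_space m'"
    using \<open>f \<in> F_space m\<close> by (simp add: F_space_iff)
qed

lemma F_space_zero: "(\<lambda>_. 0) \<in> F_space m"
proof -
  have *: "((\<lambda>_. 0) has_vector_derivative (0::complex)) (at x)" for x :: real by simp
  have "smooth_on UNIV (\<lambda>_. 0)"
    by (rule smooth_onI[of UNIV _ "\<lambda>_ _. 0"]) (use * in auto)
  moreover have "nth_deriv n (\<lambda>_. 0) x = 0" for n x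
    by (rule nth_deriv_eqI[of UNIV _ "\<lambda>_ _. 0"]) (use * in auto)
  ultimately show ?thesis
    unfolding F_space_iff by (auto intro!: exI[of _ 0])
qed

lemma nth_deriv_zero [simp]: "nth_deriv n (\<lambda>_. 0) x = 0"
  by (rule nth_deriv_eqI[of UNIV _ "\<lambda>_ _. 0"]) auto

lemma F_space_nth_deriv: "f \<in> F_space m \<Longrightarrow> nth_deriv k f \<in> F_space m"
  unfolding F_space_iff smooth_on_def nth_deriv_add by auto

lemma C_exp_iff: "f \<in> C_exp \<longleftrightarrow> (\<exists>m\<ge>1. f \<in> F_space m)"
  by (auto simp: C_exp_def)

lemma C_expI: "f \<in> F_space m \<Longrightarrow> f \<in> C_exp"
  unfolding C_exp_iff using F_space_mono[of m "Suc m"] by (intro exI[of _ "Suc m"]) auto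

lemma C_exp_lincomb:
  assumes "f \<in> C_exp" "g \<in> C_exp"
  shows "(\<lambda>x. a * f x + b * g x) \<in> C_exp"
proof -
  obtain m m' where "f \<in> F_space m" "g \<in> F_space m'"
    using assms by (auto simp: C_exp_iff)
  then have "f \<in> F_space (max m m')" "g \<in> F_space (max m m')"
    using F_space_mono[of m "max m m'"] F_space_mono[of m' "max m m'"] by auto
  then show ?thesis by (intro C_expI F_space_lincomb)
qed

section \<open>Topologies and continuous functionals\<close>

lemma topspace_F_top [simp]: "topspace (F_top m) = F_space m"
proof -
  have "f \<in> {g \<in> F_space m. F_seminorm m 0 (\<lambda>x. g x - f x) < 1}" if "f \<in> F_space m" for f
    using that by (simp add: F_seminorm_def)
  then have "F_space m \<subseteq> \<Union> {{g \<in> F_space m. F_seminorm m n (\<lambda>x. g x - f x) < r} | f n r. f \<in> F_space m \<and> r > 0}"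
    using zero_less_one[where 'a = real] by blast
  moreover have "\<Union> {{g \<in> F_space m. F_seminorm m n (\<lambda>x. g x - f x) < r} | f n r. f \<in> F_space m \<and> r > 0} \<subseteq> F_space m"
    by blast
  ultimately show ?thesis
    unfolding F_top_def topology_generated_by_topspace by (rule equalityI[rotated])
qed

lemma topspace_C_exp_top [simp]: "topspace C_exp_top = C_exp"
proof -
  have "fun_convex C_exp"
    unfolding fun_convex_def by (intro ballI allI impI C_exp_lincomb)
  moreover have "openin (F_top m) (C_exp \<inter> F_space m)" if "m \<ge> 1" for m
  proof -
    have "C_exp \<inter> F_space m = topspace (F_top m)" using C_expI by auto
    then show ?thesis by (metis openin_topspace)
  qed
  ultimately show ?thesis
    unfolding C_exp_top_def topology_generated_by_topspace by blast
qed

text \<open>Continuity of the inclusion of \<open>F_space m\<close>: it holds by definition for the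
  generating sets and passes through finite intersections and unions. This is how the inductive
  limit topology is exploited.\<close>

lemma openin_C_exp_top_F_top:
  assumes "openin C_exp_top V" "m \<ge> 1"
  shows "openin (F_top m) (V \<inter> F_space m)"
  using assms(1) unfolding C_exp_top_def openin_topology_generated_by_iff
proof induction
  case (Int a b)
  have eq: "a \<inter> b \<inter> F_space m = (a \<inter> F_space m) \<inter> (b \<inter> F_space m)" by auto
  show ?case unfolding eq by (intro openin_Int Int.IH)
next
  case (UN K)
  have eq: "\<Union>K \<inter> F_space m = (\<Union>k\<in>K. k \<inter> F_space m)" by auto
  show ?case unfolding eq by (rule openin_Union) (use UN.IH in blast)
qed (use assms(2) in auto)

text \<open>Neighbourhoods in \<open>F_top m\<close> are controlled by finitely many derivatives
  with one weight; induction over the generation of the topology takes maxima of the orders and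
  minima of the radii.\<close>

lemma openin_F_top_nbhd:
  assumes "openin (F_top m) W" "g \<in> W"
  shows "\<exists>N. \<exists>r>0. \<forall>f\<in>F_space m.
    (\<forall>n\<le>N. \<forall>x. norm (nth_deriv n (\<lambda>x. f x - g x) x) \<le> r * exp (real m * \<bar>x\<bar>)) \<longrightarrow> f \<in> W"
  using assms unfolding F_top_def openin_topology_generated_by_iff
proof induction
  case Empty
  then show ?case by simp
next
  case (Int a b)
  let ?P = "\<lambda>N r W. \<forall>f\<in>F_space m.
    (\<forall>n\<le>N. \<forall>x. norm (nth_deriv n (\<lambda>x. f x - g x) x) \<le> r * exp (real m * \<bar>x\<bar>)) \<longrightarrow> f \<in> W"
  have "g \<in> a" "g \<in> b" using Int.prems by auto
  from Int.IH(1)[OF \<open>g \<in> a\<close>] obtain N1 r1 where 1: "r1 > 0" "?P N1 r1 a"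
    by (elim exE conjE)
  from Int.IH(2)[OF \<open>g \<in> b\<close>] obtain N2 r2 where 2: "r2 > 0" "?P N2 r2 b"
    by (elim exE conjE)
  show ?case
  proof (intro exI[of _ "max N1 N2"] exI[of _ "min r1 r2"] conjI ballI impI)
    show "min r1 r2 > 0" using 1 2 by simp
    fix f assume f: "f \<in> F_space m"
      and bd: "\<forall>n\<le>max N1 N2. \<forall>x. norm (nth_deriv n (\<lambda>x. f x - g x) x) \<le> min r1 r2 * exp (real m * \<bar>x\<bar>)"
    have le: "min r1 r2 * exp (real m * \<bar>x\<bar>) \<le> r1 * exp (real m * \<bar>x\<bar>)"
      "min r1 r2 * exp (real m * \<bar>x\<bar>) \<le> r2 * exp (real m * \<bar>x\<bar>)" for x
      by (auto intro!: mult_right_mono)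
    have "f \<in> a"
    proof (rule 1(2)[rule_format, OF f])
      show "norm (nth_deriv n (\<lambda>x. f x - g x) x) \<le> r1 * exp (real m * \<bar>x\<bar>)" if "n \<le> N1" for n x
        using bd[rule_format, of n x] le(1)[of x] that by linarith
    qed
    moreover have "f \<in> b"
    proof (rule 2(2)[rule_format, OF f])
      show "norm (nth_deriv n (\<lambda>x. f x - g x) x) \<le> r2 * exp (real m * \<bar>x\<bar>)" if "n \<le> N2" for n x
        using bd[rule_format, of n x] le(2)[of x] that by linarith
    qed
    ultimately show "f \<in> a \<inter> b" by simp
  qed
next
  case (UN K)
  then obtain k where k: "k \<in> K" "g \<in> k" by auto
  from UN.IH[OF k] obtain N r where "r > 0" "\<forall>f\<in>F_space m.
      (\<forall>n\<le>N. \<forall>x. norm (nth_deriv n (\<lambda>x. f x - g x) x) \<le> r * exp (real m * \<bar>x\<bar>)) \<longrightarrow> f \<in> k"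
    by (elim exE conjE)
  then show ?case using k(1) by (intro exI[of _ N] exI[of _ r]) auto
next
  case (Basis s)
  then obtain c n r where s: "s = {g \<in> F_space m. F_seminorm m n (\<lambda>x. g x - c x) < r}" and c: "c \<in> F_space m"
    by auto
  \<comment> \<open>Distance of \<open>g\<close> from the centre \<open>c\<close>. Half of the
    remaining room serves as radius, because a supremum yields only a weak inequality while the ball
    is strict.\<close>
  define \<rho> where "\<rho> = F_seminorm m n (\<lambda>x. g x - c x)"
  have g: "g \<in> F_space m" "\<rho> < r" using Basis s by (auto simp: \<rho>_def)
  have diff: "(\<lambda>x. f x - c x) \<in> F_space m" if "f \<in> F_space m" for f
    using F_space_lincomb[OF that c, of 1 "-1"] by simp
  have gc: "norm (nth_deriv n (\<lambda>x. g x - c x) x) \<le> \<rho> * exp (real m * \<bar>x\<bar>)" for x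
  proof -
    have "bdd_above (range (\<lambda>x. norm (nth_deriv n (\<lambda>x. g x - c x) x) * exp (- (real m * \<bar>x\<bar>))))"
      using diff[OF g(1)] unfolding F_space_def by (simp only: mem_Collect_eq)
    then have "norm (nth_deriv n (\<lambda>x. g x - c x) x) * exp (- (real m * \<bar>x\<bar>)) \<le> \<rho>"
      unfolding \<rho>_def F_seminorm_def by (intro cSUP_upper) auto
    then show ?thesis by (simp add: exp_minus field_simps)
  qed
  show ?case
  proof (intro exI[of _ n] exI[of _ "(r - \<rho>) / 2"] conjI ballI impI)
    show "(r - \<rho>) / 2 > 0" using g by simp
    fix f assume f: "f \<in> F_space m"
      and bd: "\<forall>k\<le>n. \<forall>x. norm (nth_deriv k (\<lambda>x. f x - g x) x) \<le> (r - \<rho>) / 2 * exp (real m * \<bar>x\<bar>)"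
    have fg: "(\<lambda>x. f x - g x) \<in> F_space m"
      using F_space_lincomb[OF f g(1), of 1 "-1"] by simp
    have "F_seminorm m n (\<lambda>x. f x - c x) \<le> (r - \<rho>) / 2 + \<rho>"
      unfolding F_seminorm_def
    proof (rule cSUP_least)
      fix x
      have "nth_deriv n (\<lambda>x. f x - c x) x
          = nth_deriv n (\<lambda>x. f x - g x) x + nth_deriv n (\<lambda>x. g x - c x) x"
        using nth_deriv_lincomb[OF F_space_smooth[OF fg] F_space_smooth[OF diff[OF g(1)]], of n 1 1 x] by simp
      then have "norm (nth_deriv n (\<lambda>x. f x - c x) x)
          \<le> norm (nth_deriv n (\<lambda>x. f x - g x) x) + norm (nth_deriv n (\<lambda>x. g x - c x) x)"
        by (simp add: norm_triangle_ineq)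
      also have "\<dots> \<le> (r - \<rho>) / 2 * exp (real m * \<bar>x\<bar>) + \<rho> * exp (real m * \<bar>x\<bar>)"
        using bd gc by (intro add_mono) auto
      finally have "norm (nth_deriv n (\<lambda>x. f x - c x) x) \<le> ((r - \<rho>) / 2 + \<rho>) * exp (real m * \<bar>x\<bar>)"
        by (simp add: algebra_simps)
      then show "norm (nth_deriv n (\<lambda>x. f x - c x) x) * exp (- (real m * \<bar>x\<bar>)) \<le> (r - \<rho>) / 2 + \<rho>"
        by (simp add: exp_minus field_simps)
    qed simp
    then show "f \<in> s" using f g by (simp add: s field_simps)
  qed
qed

text \<open>Continuity in quantitative form: on each \<open>F_space m\<close> the functional is
  bounded by finitely many seminorms. The number \<open>B\<close> stands for a common bound of these
  seminorms, so that no suprema have to be formed.\<close>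

definition exp_functional :: "((real \<Rightarrow> complex) \<Rightarrow> complex) \<Rightarrow> bool" where
  "exp_functional \<Phi> \<longleftrightarrow>
     (\<forall>f\<in>C_exp. \<forall>g\<in>C_exp. \<forall>a b. \<Phi> (\<lambda>x. a * f x + b * g x) = a * \<Phi> f + b * \<Phi> g) \<and>
     (\<forall>m\<ge>1. \<exists>N. \<exists>C\<ge>0. \<forall>f\<in>F_space m. \<forall>B\<ge>0.
        (\<forall>n\<le>N. \<forall>x. norm (nth_deriv n f x) \<le> B * exp (real m * \<bar>x\<bar>)) \<longrightarrow> norm (\<Phi> f) \<le> C * B)"

definition from_exp :: "(real \<Rightarrow> complex) \<Rightarrow> real \<Rightarrow> complex" where
  "from_exp f = on_pos (\<lambda>x. f (- ln x))"

lemma from_exp_exp: "(\<lambda>t. from_exp f (exp (- t))) = f"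
  by (simp add: from_exp_def on_pos_def)

lemma from_exp_C_poly: "f \<in> C_exp \<Longrightarrow> from_exp f \<in> C_poly"
  unfolding C_poly_def mem_Collect_eq from_exp_exp
  by (auto simp: from_exp_def on_pos_def)

lemma exp_functional_linear:
  assumes "exp_functional \<Phi>" "f \<in> C_exp" "g \<in> C_exp"
  shows "\<Phi> (\<lambda>x. a * f x + b * g x) = a * \<Phi> f + b * \<Phi> g"
  using assms(1)[unfolded exp_functional_def, THEN conjunct1, rule_format, OF assms(2,3)] .

lemma exp_functional_bounded:
  assumes "exp_functional \<Phi>" "m \<ge> 1"
  shows "\<exists>N. \<exists>C\<ge>0. \<forall>f\<in>F_space m. \<forall>B\<ge>0.
        (\<forall>n\<le>N. \<forall>x. norm (nth_deriv n f x) \<le> B * exp (real m * \<bar>x\<bar>)) \<longrightarrow> norm (\<Phi> f) \<le> C * B"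
  using assms(1)[unfolded exp_functional_def, THEN conjunct2, rule_format, OF assms(2)] .

lemma exp_functional_diff:
  assumes "exp_functional \<Phi>" "f \<in> C_exp" "g \<in> C_exp"
  shows "\<Phi> (\<lambda>x. f x - g x) = \<Phi> f - \<Phi> g"
  using exp_functional_linear[OF assms, of 1 "-1"] by simp

text \<open>The preimage of the unit disc meets \<open>F_space m\<close> in a neighbourhood of 0,
  and scaling a function into that neighbourhood gives the linear bound.\<close>

lemma exp_functional_from_dual:
  assumes "\<phi> \<in> topological_dual C_poly_top"
  shows "exp_functional (\<lambda>f. \<phi> (from_exp f))"
proof -
  define \<Phi> where "\<Phi> f = \<phi> (from_exp f)" for f
  have space: "topspace C_poly_top = C_poly"
    unfolding C_poly_top_def topspace_pullback_topology by (auto simp: C_poly_def)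
  have cont: "continuous_map C_poly_top euclidean \<phi>"
    and lin: "\<And>f g a b. f \<in> C_poly \<Longrightarrow> g \<in> C_poly \<Longrightarrow> \<phi> (\<lambda>x. a * f x + b * g x) = a * \<phi> f + b * \<phi> g"
    using assms unfolding topological_dual_def space by auto
  have linear: "\<Phi> (\<lambda>x. a * f x + b * g x) = a * \<Phi> f + b * \<Phi> g" if "f \<in> C_exp" "g \<in> C_exp" for f g a b
  proof -
    have "from_exp (\<lambda>x. a * f x + b * g x) = (\<lambda>x. a * from_exp f x + b * from_exp g x)"
      by (auto simp: from_exp_def on_pos_def)
    then show ?thesis
      unfolding \<Phi>_def using lin[OF from_exp_C_poly[OF that(1)] from_exp_C_poly[OF that(2)]] by simp
  qed
  have zero: "\<Phi> (\<lambda>_. 0) = 0"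
    using linear[OF C_expI[OF F_space_zero] C_expI[OF F_space_zero], of 0 0] by simp
  have "openin C_poly_top {f \<in> topspace C_poly_top. \<phi> f \<in> ball 0 1}"
    using cont by (intro openin_continuous_map_preimage) auto
  then obtain V where V: "openin C_exp_top V"
    and V_eq: "{f \<in> C_poly. \<phi> f \<in> ball 0 1} = (\<lambda>f t. f (exp (- t))) -` V \<inter> C_poly"
    unfolding space unfolding C_poly_top_def openin_pullback_topology by blast
  have V_iff: "f \<in> V \<longleftrightarrow> norm (\<Phi> f) < 1" if "f \<in> C_exp" for f
  proof -
    have "from_exp f \<in> {f \<in> C_poly. \<phi> f \<in> ball 0 1} \<longleftrightarrow> from_exp f \<in> (\<lambda>f t. f (exp (- t))) -` V \<inter> C_poly"
      using V_eq by blast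
    then show ?thesis
      using from_exp_C_poly[OF that] by (simp add: from_exp_exp \<Phi>_def)
  qed
  have "\<exists>N. \<exists>C\<ge>0. \<forall>f\<in>F_space m. \<forall>B\<ge>0.
      (\<forall>n\<le>N. \<forall>x. norm (nth_deriv n f x) \<le> B * exp (real m * \<bar>x\<bar>)) \<longrightarrow> norm (\<Phi> f) \<le> C * B" if "m \<ge> 1" for m
  proof -
    have "(\<lambda>_. 0) \<in> V \<inter> F_space m"
      using V_iff[OF C_expI[OF F_space_zero]] zero F_space_zero by simp
    then obtain N r where "r > 0" and nb': "\<forall>f\<in>F_space m.
        (\<forall>n\<le>N. \<forall>x. norm (nth_deriv n (\<lambda>x. f x - 0) x) \<le> r * exp (real m * \<bar>x\<bar>)) \<longrightarrow> f \<in> V \<inter> F_space m"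
      using openin_F_top_nbhd[OF openin_C_exp_top_F_top[OF V \<open>m \<ge> 1\<close>], of "\<lambda>_. 0"] by blast
    then have nb: "f \<in> V" if "f \<in> F_space m"
        "\<And>n x. n \<le> N \<Longrightarrow> norm (nth_deriv n f x) \<le> r * exp (real m * \<bar>x\<bar>)" for f
      using that by simp
    have bound: "norm (\<Phi> f) \<le> (1 / r) * B"
      if f: "f \<in> F_space m" and "B > 0" and B: "\<And>n x. n \<le> N \<Longrightarrow> norm (nth_deriv n f x) \<le> B * exp (real m * \<bar>x\<bar>)" for f B
    proof -
      let ?c = "of_real (r / B) :: complex"
      let ?g = "\<lambda>x. ?c * f x + 0 * f x"
      have g: "?g \<in> F_space m" using f by (intro F_space_lincomb)
      have "?g \<in> V"
      proof (rule nb[OF g])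
        fix n x assume "n \<le> N"
        have "norm (nth_deriv n ?g x) = (r / B) * norm (nth_deriv n f x)"
          unfolding nth_deriv_lincomb[OF F_space_smooth[OF f] F_space_smooth[OF f]]
          using \<open>r > 0\<close> \<open>B > 0\<close> by (simp add: norm_mult norm_divide)
        also have "\<dots> \<le> (r / B) * (B * exp (real m * \<bar>x\<bar>))"
          using \<open>r > 0\<close> \<open>B > 0\<close> B[OF \<open>n \<le> N\<close>] by (intro mult_left_mono) auto
        finally show "norm (nth_deriv n ?g x) \<le> r * exp (real m * \<bar>x\<bar>)"
          using \<open>B > 0\<close> by simp
      qed
      then have "norm (\<Phi> ?g) < 1"
        using V_iff[OF C_expI[OF g]] by simp
      also have "\<Phi> ?g = ?c * \<Phi> f"
        using linear[OF C_expI[OF f] C_expI[OF f], of ?c 0] by simp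
      finally show ?thesis
        using \<open>r > 0\<close> \<open>B > 0\<close> by (simp add: norm_mult norm_divide field_simps)
    qed
    show ?thesis
    proof (intro exI[of _ N] exI[of _ "1 / r"] conjI ballI allI impI)
      show "0 \<le> 1 / r" using \<open>r > 0\<close> by simp
      fix f B assume f: "f \<in> F_space m" and "0 \<le> (B::real)"
        and B: "\<forall>n\<le>N. \<forall>x. norm (nth_deriv n f x) \<le> B * exp (real m * \<bar>x\<bar>)"
      show "norm (\<Phi> f) \<le> 1 / r * B"
      \<comment> \<open>Scaling divides by the bound, so the case \<open>B = 0\<close> is approached
        through \<open>B + r * e\<close>.\<close>
      proof (rule field_le_epsilon)
        fix e :: real assume "e > 0"
        have "norm (\<Phi> f) \<le> (1 / r) * (B + r * e)"
        proof (rule bound[OF f])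
          show "B + r * e > 0" using \<open>0 \<le> B\<close> \<open>r > 0\<close> \<open>e > 0\<close> by (simp add: add_nonneg_pos)
          fix n x assume "n \<le> N"
          then have "norm (nth_deriv n f x) \<le> B * exp (real m * \<bar>x\<bar>)" using B by blast
          also have "\<dots> \<le> (B + r * e) * exp (real m * \<bar>x\<bar>)"
            using \<open>r > 0\<close> \<open>e > 0\<close> by (intro mult_right_mono) auto
          finally show "norm (nth_deriv n f x) \<le> (B + r * e) * exp (real m * \<bar>x\<bar>)" .
        qed
        then show "norm (\<Phi> f) \<le> 1 / r * B + e"
          using \<open>r > 0\<close> by (simp add: field_simps)
      qed
    qed
  qed
  then show ?thesis
    using linear unfolding exp_functional_def \<Phi>_def[symmetric] by simp
qed

text \<open>Cauchy's estimates turn one bound on the strip \<open>\<bar>Im z\<bar> \<le> 1\<close> into bounds for all derivatives on the real line.\<close>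

lemma entire_strip_bound:
  fixes G :: "complex \<Rightarrow> complex"
  assumes G: "G holomorphic_on UNIV"
    and bd: "\<And>z. \<bar>Im z\<bar> \<le> 1 \<Longrightarrow> norm (G z) \<le> B * exp (real m * \<bar>Re z\<bar>)"
  shows "(\<lambda>t. G (of_real t)) \<in> F_space m"
    and "norm (nth_deriv n (\<lambda>t. G (of_real t)) t) \<le> fact n * (B * exp (real m)) * exp (real m * \<bar>t\<bar>)"
proof -
  have step: "((\<lambda>t. (deriv ^^ n) G (of_real t)) has_vector_derivative (deriv ^^ Suc n) G (of_real t)) (at t)" for n t
  proof -
    have "(deriv ^^ n) G holomorphic_on UNIV"
      by (rule holomorphic_higher_deriv[OF G]) simp
    then have "((deriv ^^ n) G has_field_derivative (deriv ^^ Suc n) G (of_real t)) (at (of_real t))"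
      by (simp add: holomorphic_derivI)
    then show ?thesis
      by (rule has_vector_derivative_real_field)
  qed
  have nth: "nth_deriv n (\<lambda>t. G (of_real t)) t = (deriv ^^ n) G (of_real t)" for n t
    by (rule nth_deriv_eqI[of UNIV _ "\<lambda>n t. (deriv ^^ n) G (of_real t)"]) (use step in auto)
  have "0 \<le> B" using order_trans[OF norm_ge_zero bd[of 0]] by simp
  have bound: "norm (nth_deriv n (\<lambda>t. G (of_real t)) t) \<le> fact n * (B * exp (real m)) * exp (real m * \<bar>t\<bar>)" for n t
  proof -
    \<comment> \<open>The unit circle about a real point stays in the strip, and moving away by at
      most 1 costs the factor exp m.\<close>
    have "norm ((deriv ^^ n) G (of_real t)) \<le> fact n * (B * exp (real m * (\<bar>t\<bar> + 1))) / 1 ^ n"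
    proof (rule Cauchy_inequality)
      show "G holomorphic_on ball (of_real t) 1" "continuous_on (cball (of_real t) 1) G"
        using G by (auto intro: holomorphic_on_subset holomorphic_on_imp_continuous_on continuous_on_subset)
      fix z :: complex assume z: "norm (of_real t - z) = 1"
      have "\<bar>Im z\<bar> \<le> 1" "\<bar>Re z\<bar> \<le> \<bar>t\<bar> + 1"
        using abs_Im_le_cmod[of "of_real t - z"] abs_Re_le_cmod[of "of_real t - z"] z by auto
      then have "norm (G z) \<le> B * exp (real m * \<bar>Re z\<bar>)" "exp (real m * \<bar>Re z\<bar>) \<le> exp (real m * (\<bar>t\<bar> + 1))"
        using bd by (auto intro: mult_left_mono)
      then show "norm (G z) \<le> B * exp (real m * (\<bar>t\<bar> + 1))"
        using \<open>0 \<le> B\<close> mult_left_mono by (meson order_trans)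
    qed auto
    also have "exp (real m * (\<bar>t\<bar> + 1)) = exp (real m) * exp (real m * \<bar>t\<bar>)"
      by (simp add: algebra_simps flip: exp_add)
    finally show ?thesis unfolding nth by (simp add: mult_ac)
  qed
  then show "norm (nth_deriv n (\<lambda>t. G (of_real t)) t) \<le> fact n * (B * exp (real m)) * exp (real m * \<bar>t\<bar>)" .
  have "smooth_on UNIV (\<lambda>t. G (of_real t))"
    by (rule smooth_onI[of UNIV _ "\<lambda>n t. (deriv ^^ n) G (of_real t)"]) (use step in auto)
  then show "(\<lambda>t. G (of_real t)) \<in> F_space m"
    unfolding F_space_iff using bound by blast
qed

text \<open>A single estimate on the strip replaces the bounds on the derivatives up to order
  \<open>N\<close>; the factor fact N * exp m is the price of Cauchy's estimates on unit
  circles.\<close>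

lemma exp_functional_entire_bound:
  assumes "exp_functional \<Phi>" "m \<ge> 1"
  shows "\<exists>C\<ge>0. \<forall>(G :: complex \<Rightarrow> complex) B. G holomorphic_on UNIV \<longrightarrow>
    (\<forall>z. \<bar>Im z\<bar> \<le> 1 \<longrightarrow> norm (G z) \<le> B * exp (real m * \<bar>Re z\<bar>)) \<longrightarrow> norm (\<Phi> (\<lambda>t. G (of_real t))) \<le> C * B"
proof -
  obtain N C where C: "C \<ge> 0" "\<And>f B. f \<in> F_space m \<Longrightarrow> B \<ge> 0 \<Longrightarrow>
      (\<And>n x. n \<le> N \<Longrightarrow> norm (nth_deriv n f x) \<le> B * exp (real m * \<bar>x\<bar>)) \<Longrightarrow> norm (\<Phi> f) \<le> C * B"
    using exp_functional_bounded[OF assms] by metis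
  show ?thesis
  proof (intro exI[of _ "C * (fact N * exp (real m))"] conjI allI impI)
    show "0 \<le> C * (fact N * exp (real m))" using C(1) by simp
    fix G :: "complex \<Rightarrow> complex" and B assume G: "G holomorphic_on UNIV"
      and bd: "\<forall>z. \<bar>Im z\<bar> \<le> 1 \<longrightarrow> norm (G z) \<le> B * exp (real m * \<bar>Re z\<bar>)"
    have "0 \<le> B" using order_trans[OF norm_ge_zero bd[rule_format, of 0]] by simp
    have "norm (\<Phi> (\<lambda>t. G (of_real t))) \<le> C * (fact N * (B * exp (real m)))"
    proof (rule C(2))
      show "(\<lambda>t. G (of_real t)) \<in> F_space m"
        using entire_strip_bound(1)[OF G, of B m] bd by blast
      fix n x assume "n \<le> N"
      have "norm (nth_deriv n (\<lambda>t. G (of_real t)) x) \<le> fact n * (B * exp (real m)) * exp (real m * \<bar>x\<bar>)"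
        using entire_strip_bound(2)[OF G, of B m] bd by blast
      also have "\<dots> \<le> fact N * (B * exp (real m)) * exp (real m * \<bar>x\<bar>)"
        using \<open>n \<le> N\<close> \<open>0 \<le> B\<close> by (intro mult_right_mono fact_mono) auto
      finally show "norm (nth_deriv n (\<lambda>t. G (of_real t)) x) \<le> fact N * (B * exp (real m)) * exp (real m * \<bar>x\<bar>)" .
    qed (use \<open>0 \<le> B\<close> in simp)
    then show "norm (\<Phi> (\<lambda>t. G (of_real t))) \<le> C * (fact N * exp (real m)) * B"
      by (simp add: mult_ac)
  qed
qed

subsection \<open>Gaussian regularization of exponentials\<close>

text \<open>The mean value inequality on a half plane. Only Re x enters the exponent, which matters
  for x = - q * w^2 on a horizontal strip: there |x| is unbounded while Re x stays bounded
  above.\<close>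

lemma norm_exp_diff_one_le:
  fixes x :: complex
  shows "norm (exp x - 1) \<le> exp (max 0 (Re x)) * norm x"
proof -
  have "norm (exp x - exp 0) \<le> exp (max 0 (Re x)) * norm (x - 0)"
  proof (rule field_differentiable_bound[where S = "{y. Re y \<le> max 0 (Re x)}" and f' = exp])
    show "convex {y. Re y \<le> max 0 (Re x)}" by (rule convex_halfspace_Re_le)
    show "(exp has_field_derivative exp z) (at z within {y. Re y \<le> max 0 (Re x)})" for z :: complex
      by (rule has_field_derivative_at_within) (rule DERIV_exp)
  qed auto
  then show ?thesis by simp
qed

lemma quadratic_le: "q > 0 \<Longrightarrow> b * x - q * x\<^sup>2 \<le> b\<^sup>2 / (4 * q)" for b x q :: real
proof -
  assume "q > 0"
  have "0 \<le> (b - 2 * q * x)\<^sup>2" by simp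
  then have "4 * q * (b * x - q * x\<^sup>2) \<le> b\<^sup>2"
    by (simp add: power2_eq_square algebra_simps)
  then show ?thesis using \<open>q > 0\<close> by (simp add: field_simps)
qed

lemma exp_minus_le_exp_abs: "\<bar>\<tau>\<bar> \<le> real m \<Longrightarrow> exp (- \<tau> * x) \<le> exp (real m * \<bar>x\<bar>)"
  using mult_mono[of "\<bar>\<tau>\<bar>" "real m" "\<bar>x\<bar>" "\<bar>x\<bar>"] abs_ge_self[of "- \<tau> * x"] by (simp add: abs_mult)

text \<open>An entire function of \<open>w\<close>, so that Cauchy's estimates apply; for q > 0 it
  decreases on horizontal strips faster than every exponential, in both directions.\<close>

definition gauss :: "real \<Rightarrow> complex \<Rightarrow> complex \<Rightarrow> complex" where
  "gauss q s w = exp (- s * w - of_real q * w\<^sup>2)"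

lemma gauss_holomorphic: "gauss q s holomorphic_on S"
  unfolding gauss_def[abs_def] by (intro holomorphic_intros)

lemma Re_mult_strip_le:
  assumes "\<bar>Im w\<bar> \<le> 1"
  shows "Re (- s * w) \<le> - Re s * Re w + norm s"
proof -
  have "Im s * Im w \<le> \<bar>Im s\<bar> * \<bar>Im w\<bar>"
    by (metis abs_ge_self abs_mult)
  also have "\<dots> \<le> norm s * 1"
    using assms by (intro mult_mono abs_Im_le_cmod) auto
  finally show ?thesis by simp
qed

text \<open>Completing the square: the Gaussian absorbs the difference between the linear exponents
  for any rate \<open>\<tau>\<close>, and the imaginary part of \<open>w\<close> costs the summands
  norm s and q.\<close>

lemma gauss_bound:
  assumes "q > 0"
  shows "\<exists>M\<ge>0. \<forall>w. \<bar>Im w\<bar> \<le> 1 \<longrightarrow> norm (gauss q s w) \<le> M * exp (- \<tau> * Re w)"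
proof (intro exI conjI allI impI)
  let ?M = "exp ((\<tau> - Re s)\<^sup>2 / (4 * q) + norm s + q)"
  show "0 \<le> ?M" by simp
  fix w :: complex assume w: "\<bar>Im w\<bar> \<le> 1"
  have "(Im w)\<^sup>2 \<le> 1" using w by (simp add: abs_square_le_1)
  then have "q * (Im w)\<^sup>2 \<le> q" using assms by (simp add: mult_left_le)
  then have "Re (- s * w - of_real q * w\<^sup>2) \<le> (\<tau> - Re s)\<^sup>2 / (4 * q) + norm s + q + - \<tau> * Re w"
    using quadratic_le[OF assms, of "\<tau> - Re s" "Re w"] Re_mult_strip_le[OF w, of s]
    by (simp add: power2_eq_square algebra_simps)
  then show "norm (gauss q s w) \<le> ?M * exp (- \<tau> * Re w)"
    unfolding gauss_def norm_exp_eq_Re exp_add[symmetric] by simp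
qed

text \<open>The factor \<open>q\<close> is the gain. It comes from exp (- q * w^2) - 1, and the
  |w|^2 that accompanies it is absorbed by widening the exponent by \<open>\<eta>\<close> on both
  sides.\<close>

lemma gauss_diff_bound:
  assumes q: "0 < q" "q \<le> 1" and "\<eta> > 0" and w: "\<bar>Im w\<bar> \<le> 1"
  shows "norm (gauss q s w - exp (- s * w)) \<le> q * (exp (1 + norm s + \<eta>) * (2 / \<eta>)\<^sup>2) *
    (exp (- (Re s - \<eta>) * Re w) + exp (- (Re s + \<eta>) * Re w))"
proof -
  have im: "(Im w)\<^sup>2 \<le> 1" using w by (simp add: abs_square_le_1)
  then have im': "q * (Im w)\<^sup>2 \<le> 1 * 1" using q by (intro mult_mono) auto
  have "Re (- of_real q * w\<^sup>2) \<le> 1"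
  proof -
    have "Re (- of_real q * w\<^sup>2) = q * (Im w)\<^sup>2 - q * (Re w)\<^sup>2"
      by (simp add: power2_eq_square algebra_simps)
    moreover have "0 \<le> q * (Re w)\<^sup>2" using q by simp
    ultimately show ?thesis using im' by linarith
  qed
  then have "norm (exp (- of_real q * w\<^sup>2) - 1) \<le> exp 1 * norm (- of_real q * w\<^sup>2)"
    by (intro order_trans[OF norm_exp_diff_one_le] mult_right_mono) auto
  also have "norm (- of_real q * w\<^sup>2) = q * (norm w)\<^sup>2"
    using q by (simp add: norm_mult norm_power)
  also have "(norm w)\<^sup>2 \<le> (\<bar>Re w\<bar> + 1)\<^sup>2"
    unfolding cmod_power2 power2_sum using im by simp
  also have "(\<bar>Re w\<bar> + 1)\<^sup>2 \<le> (2 / \<eta>)\<^sup>2 * exp (\<eta> * (\<bar>Re w\<bar> + 1))"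
    using square_le_exp[OF \<open>\<eta> > 0\<close>, of "\<bar>Re w\<bar> + 1"] by simp
  finally have 1: "norm (exp (- of_real q * w\<^sup>2) - 1) \<le> exp 1 * (q * ((2 / \<eta>)\<^sup>2 * exp (\<eta> * (\<bar>Re w\<bar> + 1))))"
    using q by (simp add: mult_left_mono)
  have 2: "norm (exp (- s * w)) \<le> exp (- Re s * Re w + norm s)"
    unfolding norm_exp_eq_Re using Re_mult_strip_le[OF w] by simp
  have "gauss q s w - exp (- s * w) = exp (- s * w) * (exp (- of_real q * w\<^sup>2) - 1)"
    unfolding gauss_def by (simp add: algebra_simps exp_diff exp_minus divide_inverse)
  then have "norm (gauss q s w - exp (- s * w))
      \<le> exp (- Re s * Re w + norm s) * (exp 1 * (q * ((2 / \<eta>)\<^sup>2 * exp (\<eta> * (\<bar>Re w\<bar> + 1)))))"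
    using mult_mono[OF 2 1] by (simp add: norm_mult)
  also have "\<dots> = q * (exp (1 + norm s + \<eta>) * (2 / \<eta>)\<^sup>2) * (exp (\<eta> * \<bar>Re w\<bar>) * exp (- Re s * Re w))"
  proof -
    have "exp (- Re s * Re w + norm s) = exp (- Re s * Re w) * exp (norm s)"
      "exp (\<eta> * (\<bar>Re w\<bar> + 1)) = exp (\<eta> * \<bar>Re w\<bar>) * exp \<eta>"
      "exp (1 + norm s + \<eta>) = exp 1 * exp (norm s) * exp \<eta>"
      by (simp_all only: exp_add distrib_left mult_1_right)
    then show ?thesis by (simp only: mult_ac)
  qed
  also have "\<dots> \<le> q * (exp (1 + norm s + \<eta>) * (2 / \<eta>)\<^sup>2) *
      (exp (- (Re s - \<eta>) * Re w) + exp (- (Re s + \<eta>) * Re w))"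
    using q by (intro mult_left_mono exp_abs_le) auto
  finally show ?thesis .
qed

text \<open>The test function to which \<open>\<phi>\<close> is applied in
  \<open>is_dual_conv\<close>, in logarithmic coordinates and with complex argument: multiplication
  by x becomes translation by \<open>u\<close>.\<close>

definition gauss_conv :: "real \<Rightarrow> complex \<Rightarrow> (real \<Rightarrow> complex) \<Rightarrow> complex \<Rightarrow> complex" where
  "gauss_conv q s f z = (LINT u|lebesgue. gauss q s (z + of_real u) * f u)"

lemma laplace_abs_gauss_damped:
  assumes "laplace_abs f \<tau>" "q > 0"
  shows "laplace_abs (\<lambda>u. f u * exp (- of_real (q * u\<^sup>2))) \<sigma>"
proof (rule laplace_absI)
  have [measurable]: "(\<lambda>u::real. exp (- of_real (q * u\<^sup>2)) :: complex) \<in> borel_measurable lebesgue"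
    by (intro continuous_imp_lebesgue_measurable continuous_intros)
  note assms(1)[measurable]
  show "(\<lambda>u. f u * exp (- of_real (q * u\<^sup>2))) \<in> borel_measurable lebesgue" by measurable
  show "integrable lebesgue (\<lambda>u. (norm (f u) * exp (- \<tau> * u)) * exp ((\<tau> - \<sigma>)\<^sup>2 / (4 * q)))"
    using assms(1) by (intro integrable_mult_left) (simp add: laplace_abs_def)
  fix u
  have "exp (- (q * u\<^sup>2)) * exp (- \<sigma> * u) \<le> exp (- \<tau> * u) * exp ((\<tau> - \<sigma>)\<^sup>2 / (4 * q))"
    unfolding exp_add[symmetric] using quadratic_le[OF assms(2), of "\<tau> - \<sigma>" u] by (simp add: algebra_simps)
  then show "norm (f u * exp (- of_real (q * u\<^sup>2))) * exp (- \<sigma> * u) \<le> (norm (f u) * exp (- \<tau> * u)) * exp ((\<tau> - \<sigma>)\<^sup>2 / (4 * q))"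
    by (simp add: norm_mult mult.assoc mult_left_mono)
qed

text \<open>Expanding (z + u)^2 leaves a factor free of \<open>u\<close>, a Gaussian damping of
  \<open>f\<close> and a linear exponent. A Gaussian convolution is thus a multiple of a Laplace
  transform at s + 2 * q * z, whence its holomorphy in \<open>z\<close>.\<close>

lemma gauss_shift:
  "gauss q s (z + of_real u) * f u
    = exp (- s * z - of_real q * z\<^sup>2) * (f u * exp (- of_real (q * u\<^sup>2)) * exp (- (s + 2 * of_real q * z) * of_real u))"
proof -
  have "gauss q s (z + of_real u)
      = exp (- s * z - of_real q * z\<^sup>2) * exp (- of_real (q * u\<^sup>2)) * exp (- (s + 2 * of_real q * z) * of_real u)"
    unfolding gauss_def exp_add[symmetric] by (simp add: power2_eq_square algebra_simps)
  then show ?thesis by (simp add: mult_ac)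
qed

lemma
  assumes "laplace_abs f \<tau>" "q > 0"
  shows gauss_conv_integrable: "integrable lebesgue (\<lambda>u. gauss q s (z + of_real u) * f u)"
    and gauss_conv_holomorphic: "gauss_conv q s f holomorphic_on UNIV"
proof -
  let ?f = "\<lambda>u. f u * exp (- of_real (q * u\<^sup>2))"
  note abs = laplace_abs_gauss_damped[OF assms]
  show "integrable lebesgue (\<lambda>u. gauss q s (z + of_real u) * f u)"
    unfolding gauss_shift by (intro integrable_mult_right laplace_abs_imp_integrable abs)
  have eq: "gauss_conv q s f = (\<lambda>z. exp (- s * z - of_real q * z\<^sup>2) * laplace ?f (s + 2 * of_real q * z))"
    unfolding gauss_conv_def gauss_shift laplace_def by (intro ext integral_mult_right_zero)
  have "laplace ?f holomorphic_on UNIV"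
    by (rule laplace_holomorphic[of UNIV]) (use abs in auto)
  then have "laplace ?f \<circ> (\<lambda>z. s + 2 * of_real q * z) holomorphic_on UNIV"
    by (intro holomorphic_on_compose holomorphic_intros) (auto intro: holomorphic_on_subset)
  then show "gauss_conv q s f holomorphic_on UNIV"
    unfolding eq by (intro holomorphic_intros) (simp add: o_def)
qed

lemma gauss_conv_C_exp:
  assumes "laplace_abs f \<tau>" "q > 0"
  shows "(\<lambda>t. gauss_conv q s f (of_real t)) \<in> C_exp"
proof -
  obtain M where M: "M \<ge> 0" "\<And>w. \<bar>Im w\<bar> \<le> 1 \<Longrightarrow> norm (gauss q s w) \<le> M * exp (- \<tau> * Re w)"
    using gauss_bound[OF assms(2)] by blast
  define I where "I = (LINT u|lebesgue. norm (f u) * exp (- \<tau> * u))"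
  have int: "integrable lebesgue (\<lambda>u. norm (f u) * exp (- \<tau> * u))"
    using assms(1) by (simp add: laplace_abs_def)
  have "I \<ge> 0" unfolding I_def by simp
  define m where "m = nat \<lceil>\<bar>\<tau>\<bar>\<rceil>"
  have m: "\<bar>\<tau>\<bar> \<le> real m" unfolding m_def by linarith
  have "norm (gauss_conv q s f z) \<le> M * I * exp (real m * \<bar>Re z\<bar>)" if z: "\<bar>Im z\<bar> \<le> 1" for z
  proof -
    have "norm (gauss_conv q s f z) \<le> (LINT u|lebesgue. (M * exp (- \<tau> * Re z)) * (norm (f u) * exp (- \<tau> * u)))"
      unfolding gauss_conv_def
    proof (rule Bochner_Integration.integral_norm_bound_integral)
      show "integrable lebesgue (\<lambda>u. gauss q s (z + of_real u) * f u)"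
        by (rule gauss_conv_integrable[OF assms])
      show "integrable lebesgue (\<lambda>u. (M * exp (- \<tau> * Re z)) * (norm (f u) * exp (- \<tau> * u)))"
        using int by (rule integrable_mult_right)
      fix u
      have "norm (gauss q s (z + of_real u) * f u) \<le> (M * exp (- \<tau> * Re (z + of_real u))) * norm (f u)"
        unfolding norm_mult using z by (intro mult_right_mono M) auto
      also have "exp (- \<tau> * Re (z + of_real u)) = exp (- \<tau> * Re z) * exp (- \<tau> * u)"
        unfolding exp_add[symmetric] by (simp add: algebra_simps)
      finally show "norm (gauss q s (z + of_real u) * f u) \<le> (M * exp (- \<tau> * Re z)) * (norm (f u) * exp (- \<tau> * u))"
        by (simp add: mult_ac)
    qed
    also have "\<dots> = M * I * exp (- \<tau> * Re z)"
      by (simp add: I_def)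
    also have "\<dots> \<le> M * I * exp (real m * \<bar>Re z\<bar>)"
      using M(1) \<open>I \<ge> 0\<close> by (intro mult_left_mono exp_minus_le_exp_abs m) auto
    finally show ?thesis .
  qed
  then show ?thesis
    by (intro C_expI entire_strip_bound(1) gauss_conv_holomorphic[OF assms])
qed

section \<open>Functionals applied to exponentials and their regularizations\<close>

lemma entire_exp_bound_C_exp:
  assumes "G holomorphic_on UNIV" and bd: "\<And>w. norm (G w) \<le> B * exp (k * norm w)" and "k \<ge> 0" "B \<ge> 0"
  shows "(\<lambda>t. G (of_real t)) \<in> C_exp"
proof -
  define m where "m = nat \<lceil>k\<rceil>"
  have m: "k \<le> real m" unfolding m_def by linarith
  have "norm (G z) \<le> B * exp k * exp (real m * \<bar>Re z\<bar>)" if z: "\<bar>Im z\<bar> \<le> 1" for z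
  proof -
    have "norm z \<le> \<bar>Re z\<bar> + 1" using cmod_le[of z] z by linarith
    then have "k * norm z \<le> k * (\<bar>Re z\<bar> + 1)" using \<open>k \<ge> 0\<close> by (rule mult_left_mono)
    also have "\<dots> \<le> k + real m * \<bar>Re z\<bar>" using mult_right_mono[OF m, of "\<bar>Re z\<bar>"] by (simp add: distrib_left)
    finally have "norm (G z) \<le> B * exp (k + real m * \<bar>Re z\<bar>)"
      using \<open>B \<ge> 0\<close> by (intro order_trans[OF bd] mult_left_mono) auto
    then show ?thesis by (simp add: exp_add mult.assoc)
  qed
  then show ?thesis
    by (intro C_expI entire_strip_bound(1) assms(1))
qed

lemma exp_in_C_exp: "(\<lambda>t. exp (- s * of_real t)) \<in> C_exp"
proof (rule entire_exp_bound_C_exp[of "\<lambda>w. exp (- s * w)" 1 "norm s"])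
  show "norm (exp (- s * w)) \<le> 1 * exp (norm s * norm w)" for w
    unfolding norm_exp_eq_Re using complex_Re_le_cmod[of "- s * w"] by (simp add: norm_mult)
qed (auto intro!: holomorphic_intros)

lemma gauss_C_exp:
  assumes "q > 0"
  shows "(\<lambda>t. gauss q s (of_real t)) \<in> C_exp"
proof -
  obtain M where M: "\<And>w. \<bar>Im w\<bar> \<le> 1 \<Longrightarrow> norm (gauss q s w) \<le> M * exp (- 0 * Re w)"
    using gauss_bound[OF assms] by blast
  then have "\<And>w. \<bar>Im w\<bar> \<le> 1 \<Longrightarrow> norm (gauss q s w) \<le> M * exp (real 0 * \<bar>Re w\<bar>)" by simp
  then show ?thesis
    by (intro C_expI entire_strip_bound(1) gauss_holomorphic)
qed

text \<open>The derivative is the value of the functional at the derivative of exp (- s * t) with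
  respect to s. The Taylor remainder extends to an entire function of t that is quadratically small
  on the strip, up to the exponential weight.\<close>

lemma functional_exp_holomorphic:
  assumes "exp_functional \<Phi>"
  shows "(\<lambda>s. \<Phi> (\<lambda>t. exp (- s * of_real t))) holomorphic_on UNIV"
  unfolding holomorphic_on_def field_differentiable_def
proof (rule ballI)
  fix s :: complex
  define e where "e z t = exp (- z * of_real t)" for z :: complex and t :: real
  define d where "d t = - of_real t * exp (- s * of_real t)" for t :: real
  have e_C: "e z \<in> C_exp" for z unfolding e_def[abs_def] by (rule exp_in_C_exp)
  have w_exp: "norm w \<le> 1 * exp (norm w)" for w :: complex
    using abs_le_exp[of 1 "norm w"] by simp
  have d_C: "d \<in> C_exp"
    unfolding d_def[abs_def]
  proof (rule entire_exp_bound_C_exp[of "\<lambda>w. - w * exp (- s * w)" 1 "norm s + 1"])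
    fix w
    have "norm (- w * exp (- s * w)) \<le> (1 * exp (norm w)) * exp (norm s * norm w)"
      unfolding norm_mult norm_minus_cancel norm_exp_eq_Re
      using complex_Re_le_cmod[of "- s * w"] by (intro mult_mono w_exp) (auto simp: norm_mult)
    then show "norm (- w * exp (- s * w)) \<le> 1 * exp ((norm s + 1) * norm w)"
      by (simp add: distrib_right add.commute flip: exp_add)
  qed (auto intro!: holomorphic_intros)
  \<comment> \<open>Two extra units beyond norm s: one factor exp |w| bounds |w|^2 up to the
    constant 4, another bounds exp (|z| * |w|) for |z| < 1.\<close>
  define m where "m = nat \<lceil>norm s + 2\<rceil> + 1"
  have m: "norm s + 2 \<le> real m" "m \<ge> 1" unfolding m_def by linarith+
  obtain C where C: "C \<ge> 0" "\<And>G B. G holomorphic_on UNIV \<Longrightarrow>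
      (\<And>z. \<bar>Im z\<bar> \<le> 1 \<Longrightarrow> norm (G z) \<le> B * exp (real m * \<bar>Re z\<bar>)) \<Longrightarrow> norm (\<Phi> (\<lambda>t. G (of_real t))) \<le> C * B"
    using exp_functional_entire_bound[OF assms m(2)] by metis
  have main: "norm (\<Phi> (e (s + z)) - \<Phi> (e s) - \<Phi> d * z) \<le> C * (4 * exp (real m)) * (norm z)\<^sup>2" if z: "norm z < 1" for z
  proof -
    let ?G = "\<lambda>w. exp (- (s + z) * w) - exp (- s * w) - z * (- w * exp (- s * w))"
    have "\<Phi> (\<lambda>t. (e (s + z) t - e s t) - z * d t) = \<Phi> (e (s + z)) - \<Phi> (e s) - z * \<Phi> d"
    proof -
      have 1: "(\<lambda>t. e (s + z) t - e s t) \<in> C_exp"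
        using C_exp_lincomb[OF e_C e_C, of 1 "s + z" "-1" s] by simp
      show ?thesis
        using exp_functional_linear[OF assms 1 d_C, of 1 "- z"] exp_functional_diff[OF assms e_C e_C, of "s + z" s] by simp
    qed
    moreover have "(\<lambda>t. (e (s + z) t - e s t) - z * d t) = (\<lambda>t. ?G (of_real t))"
      by (simp add: e_def d_def fun_eq_iff)
    ultimately have "\<Phi> (e (s + z)) - \<Phi> (e s) - \<Phi> d * z = \<Phi> (\<lambda>t. ?G (of_real t))"
      by (simp add: mult.commute)
    also have "norm \<dots> \<le> C * (4 * exp (real m) * (norm z)\<^sup>2)"
    proof (rule C(2))
      show "?G holomorphic_on UNIV" by (intro holomorphic_intros)
      fix w :: complex assume w: "\<bar>Im w\<bar> \<le> 1"
      have wr: "norm w \<le> \<bar>Re w\<bar> + 1" using cmod_le[of w] w by linarith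
      have "?G w = exp (- s * w) * (exp (- z * w) - 1 - (- z * w))"
        by (simp add: algebra_simps exp_add exp_diff exp_minus divide_simps)
      then have "norm (?G w) = norm (exp (- s * w)) * norm (exp (- z * w) - 1 - (- z * w))"
        by (simp add: norm_mult)
      also have "\<dots> \<le> exp (norm s * norm w) * ((norm (- z * w))\<^sup>2 * exp (norm (- z * w)))"
        using complex_Re_le_cmod[of "- s * w"]
        by (intro mult_mono exp_diff_linear_le) (auto simp: norm_mult norm_exp_eq_Re)
      also have "\<dots> = (norm z)\<^sup>2 * (exp (norm s * norm w) * ((norm w)\<^sup>2 * exp (norm z * norm w)))"
        by (simp add: norm_mult power_mult_distrib mult_ac)
      also have "\<dots> \<le> (norm z)\<^sup>2 * (exp (norm s * norm w) * ((4 * exp (norm w)) * exp (norm w)))"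
      proof (intro mult_left_mono mult_mono)
        show "(norm w)\<^sup>2 \<le> 4 * exp (norm w)" using square_le_exp[of 1 "norm w"] by simp
        show "exp (norm z * norm w) \<le> exp (norm w)" using z by (simp add: mult_left_le_one_le)
      qed auto
      also have "\<dots> = 4 * (norm z)\<^sup>2 * exp ((norm s + 2) * norm w)"
        by (simp add: algebra_simps flip: exp_add)
      also have "\<dots> \<le> 4 * (norm z)\<^sup>2 * exp (real m + real m * \<bar>Re w\<bar>)"
      proof -
        have "(norm s + 2) * norm w \<le> real m * (\<bar>Re w\<bar> + 1)"
          using m wr by (intro mult_mono) auto
        then show ?thesis by (intro mult_left_mono) (auto simp: algebra_simps)
      qed
      also have "\<dots> = 4 * exp (real m) * (norm z)\<^sup>2 * exp (real m * \<bar>Re w\<bar>)"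
        by (simp add: exp_add mult_ac)
      finally show "norm (?G w) \<le> 4 * exp (real m) * (norm z)\<^sup>2 * exp (real m * \<bar>Re w\<bar>)" .
    qed
    finally show ?thesis by (simp add: mult.assoc)
  qed
  have "((\<lambda>s. \<Phi> (\<lambda>t. exp (- s * of_real t))) has_field_derivative \<Phi> d) (at s)"
    unfolding has_field_derivative_def e_def[symmetric]
    by (rule has_derivative_from_quadratic_bound[OF bounded_linear_mult_right zero_less_one])
       (use main in \<open>simp add: e_def[abs_def]\<close>)
  then show "\<exists>f'. ((\<lambda>s. \<Phi> (\<lambda>t. exp (- s * of_real t))) has_field_derivative f') (at s within UNIV)"
    by blast
qed

lemma gauss_approx:
  assumes "exp_functional \<Phi>"
  shows "\<exists>C. \<forall>q\<in>{0<..1}. norm (\<Phi> (\<lambda>t. gauss q s (of_real t)) - \<Phi> (\<lambda>t. exp (- s * of_real t))) \<le> C * q"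
proof -
  define m where "m = nat \<lceil>\<bar>Re s\<bar> + 1\<rceil>"
  have m: "\<bar>Re s\<bar> + 1 \<le> real m" "m \<ge> 1" unfolding m_def by linarith+
  obtain C where C: "C \<ge> 0" "\<And>G B. G holomorphic_on UNIV \<Longrightarrow>
      (\<And>z. \<bar>Im z\<bar> \<le> 1 \<Longrightarrow> norm (G z) \<le> B * exp (real m * \<bar>Re z\<bar>)) \<Longrightarrow> norm (\<Phi> (\<lambda>t. G (of_real t))) \<le> C * B"
    using exp_functional_entire_bound[OF assms m(2)] by metis
  define K where "K = exp (1 + norm s + 1) * (2 / 1)\<^sup>2"
  have "norm (\<Phi> (\<lambda>t. gauss q s (of_real t)) - \<Phi> (\<lambda>t. exp (- s * of_real t))) \<le> C * (2 * K) * q" if q: "q \<in> {0<..1}" for q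
  proof -
    have "\<Phi> (\<lambda>t. gauss q s (of_real t)) - \<Phi> (\<lambda>t. exp (- s * of_real t)) = \<Phi> (\<lambda>t. gauss q s (of_real t) - exp (- s * of_real t))"
      using q by (intro exp_functional_diff[OF assms, symmetric] gauss_C_exp exp_in_C_exp) auto
    also have "norm \<dots> \<le> C * (2 * K * q)"
    proof (rule C(2)[of "\<lambda>z. gauss q s z - exp (- s * z)"])
      show "(\<lambda>z. gauss q s z - exp (- s * z)) holomorphic_on UNIV"
        by (intro holomorphic_intros gauss_holomorphic)
      fix z :: complex assume z: "\<bar>Im z\<bar> \<le> 1"
      have "norm (gauss q s z - exp (- s * z)) \<le> q * K * (exp (- (Re s - 1) * Re z) + exp (- (Re s + 1) * Re z))"
        unfolding K_def using q z by (intro gauss_diff_bound) auto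
      also have "\<dots> \<le> q * K * (exp (real m * \<bar>Re z\<bar>) + exp (real m * \<bar>Re z\<bar>))"
        using q m by (intro mult_left_mono add_mono exp_minus_le_exp_abs) (auto simp: K_def)
      finally show "norm (gauss q s z - exp (- s * z)) \<le> 2 * K * q * exp (real m * \<bar>Re z\<bar>)"
        by (simp add: mult_ac)
    qed
    finally show ?thesis by (simp add: mult.assoc)
  qed
  then show ?thesis by blast
qed

text \<open>Convolving the pure exponential with \<open>f\<close> reproduces it with the factor
  \<open>laplace f s\<close>. No exchange of the functional with the integral is made: the
  difference from the regularized convolution is an entire function of order q on the strip.\<close>

lemma gauss_conv_approx:
  assumes "exp_functional \<Phi>" and "\<eta> > 0"
    and abs: "laplace_abs f (Re s - \<eta>)" "laplace_abs f (Re s + \<eta>)"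
  shows "\<exists>C. \<forall>q\<in>{0<..1}.
    norm (\<Phi> (\<lambda>t. gauss_conv q s f (of_real t)) - \<Phi> (\<lambda>t. exp (- s * of_real t)) * laplace f s) \<le> C * q"
proof -
  define m where "m = nat \<lceil>\<bar>Re s\<bar> + \<eta>\<rceil>"
  have m: "\<bar>Re s\<bar> + \<eta> \<le> real m" "m \<ge> 1" unfolding m_def using \<open>\<eta> > 0\<close> by linarith+
  obtain C where C: "C \<ge> 0" "\<And>G B. G holomorphic_on UNIV \<Longrightarrow>
      (\<And>z. \<bar>Im z\<bar> \<le> 1 \<Longrightarrow> norm (G z) \<le> B * exp (real m * \<bar>Re z\<bar>)) \<Longrightarrow> norm (\<Phi> (\<lambda>t. G (of_real t))) \<le> C * B"
    using exp_functional_entire_bound[OF assms(1) m(2)] by metis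
  define K where "K = exp (1 + norm s + \<eta>) * (2 / \<eta>)\<^sup>2"
  define I where "I \<tau> = (LINT u|lebesgue. norm (f u) * exp (- \<tau> * u))" for \<tau>
  have int: "integrable lebesgue (\<lambda>u. norm (f u) * exp (- (Re s - \<eta>) * u))"
    "integrable lebesgue (\<lambda>u. norm (f u) * exp (- (Re s + \<eta>) * u))"
    using abs by (auto simp: laplace_abs_def)
  have I_nonneg: "I \<tau> \<ge> 0" for \<tau> unfolding I_def by simp
  have abs_s: "laplace_abs f (Re s)"
    by (rule laplace_abs_between[OF abs]) (use \<open>\<eta> > 0\<close> in auto)
  have int_exp: "integrable lebesgue (\<lambda>u. exp (- s * (z + of_real u)) * f u)"
    and val_exp: "(LINT u|lebesgue. exp (- s * (z + of_real u)) * f u) = laplace f s * exp (- s * z)" for z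
  proof -
    have eq: "exp (- s * (z + of_real u)) * f u = (f u * exp (- s * of_real u)) * exp (- s * z)" for u
    proof -
      have "exp (- s * (z + of_real u)) = exp (- s * z) * exp (- s * of_real u)"
        unfolding exp_add[symmetric] by (simp add: algebra_simps)
      then show ?thesis by (simp add: mult_ac)
    qed
    show "integrable lebesgue (\<lambda>u. exp (- s * (z + of_real u)) * f u)"
      unfolding eq by (intro integrable_mult_left laplace_abs_imp_integrable abs_s)
    show "(LINT u|lebesgue. exp (- s * (z + of_real u)) * f u) = laplace f s * exp (- s * z)"
      unfolding eq laplace_def by (rule integral_mult_left_zero)
  qed
  have "norm (\<Phi> (\<lambda>t. gauss_conv q s f (of_real t)) - \<Phi> (\<lambda>t. exp (- s * of_real t)) * laplace f s)
      \<le> C * (K * (I (Re s - \<eta>) + I (Re s + \<eta>))) * q" if q: "q \<in> {0<..1}" for q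
  proof -
    let ?G = "\<lambda>z. gauss_conv q s f z - laplace f s * exp (- s * z)"
    have "\<Phi> (\<lambda>t. gauss_conv q s f (of_real t)) - \<Phi> (\<lambda>t. exp (- s * of_real t)) * laplace f s = \<Phi> (\<lambda>t. ?G (of_real t))"
      using exp_functional_linear[OF assms(1) gauss_conv_C_exp[OF abs_s, of q s] exp_in_C_exp, of 1 "- laplace f s" s] q
      by (simp add: mult.commute)
    also have "norm \<dots> \<le> C * (K * (I (Re s - \<eta>) + I (Re s + \<eta>)) * q)"
    proof (rule C(2))
      show "?G holomorphic_on UNIV"
        using q by (intro holomorphic_intros gauss_conv_holomorphic[OF abs_s]) auto
      fix z :: complex assume z: "\<bar>Im z\<bar> \<le> 1"
      let ?H = "\<lambda>u. (gauss q s (z + of_real u) - exp (- s * (z + of_real u))) * f u"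
      let ?E = "\<lambda>u. q * K * (exp (- (Re s - \<eta>) * Re z) * (norm (f u) * exp (- (Re s - \<eta>) * u)) +
          exp (- (Re s + \<eta>) * Re z) * (norm (f u) * exp (- (Re s + \<eta>) * u)))"
      have ig: "integrable lebesgue (\<lambda>u. gauss q s (z + of_real u) * f u)"
        using q by (intro gauss_conv_integrable[OF abs_s]) auto
      have N1: "?G z = (LINT u|lebesgue. ?H u)"
        unfolding left_diff_distrib gauss_conv_def
        by (simp only: Bochner_Integration.integral_diff[OF ig int_exp] val_exp)
      have N2: "norm (LINT u|lebesgue. ?H u) \<le> (LINT u|lebesgue. ?E u)"
      proof (rule Bochner_Integration.integral_norm_bound_integral)
        show "integrable lebesgue ?H"
          unfolding left_diff_distrib by (rule Bochner_Integration.integrable_diff[OF ig int_exp])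
        show "integrable lebesgue ?E"
          by (intro integrable_mult_right Bochner_Integration.integrable_add int)
        fix u
        have "norm (?H u) \<le> (q * K * (exp (- (Re s - \<eta>) * Re (z + of_real u)) + exp (- (Re s + \<eta>) * Re (z + of_real u)))) * norm (f u)"
          unfolding norm_mult K_def using q z \<open>\<eta> > 0\<close> by (intro mult_right_mono gauss_diff_bound) auto
        also have "\<dots> = ?E u"
        proof -
          have shift: "exp (- \<tau> * Re (z + of_real u)) = exp (- \<tau> * Re z) * exp (- \<tau> * u)" for \<tau>
            unfolding exp_add[symmetric] by (simp add: algebra_simps)
          show ?thesis unfolding shift by (simp add: algebra_simps)
        qed
        finally show "norm (?H u) \<le> ?E u" .
      qed
      have N3: "(LINT u|lebesgue. ?E u) = q * K * (exp (- (Re s - \<eta>) * Re z) * I (Re s - \<eta>) + exp (- (Re s + \<eta>) * Re z) * I (Re s + \<eta>))"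
      proof -
        let ?e1 = "exp (- (Re s - \<eta>) * Re z)" and ?e2 = "exp (- (Re s + \<eta>) * Re z)"
        have "(LINT u|lebesgue. ?e1 * (norm (f u) * exp (- (Re s - \<eta>) * u)) + ?e2 * (norm (f u) * exp (- (Re s + \<eta>) * u)))
            = (LINT u|lebesgue. ?e1 * (norm (f u) * exp (- (Re s - \<eta>) * u)))
              + (LINT u|lebesgue. ?e2 * (norm (f u) * exp (- (Re s + \<eta>) * u)))"
          by (rule Bochner_Integration.integral_add) (rule integrable_mult_right, rule int)+
        also have "\<dots> = ?e1 * I (Re s - \<eta>) + ?e2 * I (Re s + \<eta>)"
          unfolding I_def by (intro arg_cong2[of _ _ _ _ "(+)"] integral_mult_right_zero)
        finally show ?thesis
          by (simp only: integral_mult_right_zero)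
      qed
      have "norm (?G z) \<le> q * K * (exp (- (Re s - \<eta>) * Re z) * I (Re s - \<eta>) + exp (- (Re s + \<eta>) * Re z) * I (Re s + \<eta>))"
        using N2 unfolding N1 N3 .
      also have "\<dots> \<le> q * K * (exp (real m * \<bar>Re z\<bar>) * I (Re s - \<eta>) + exp (real m * \<bar>Re z\<bar>) * I (Re s + \<eta>))"
        using q m \<open>\<eta> > 0\<close> I_nonneg
        by (intro mult_left_mono add_mono mult_right_mono exp_minus_le_exp_abs) (auto simp: K_def)
      finally show "norm (?G z) \<le> K * (I (Re s - \<eta>) + I (Re s + \<eta>)) * q * exp (real m * \<bar>Re z\<bar>)"
        by (simp add: algebra_simps)
    qed
    finally show ?thesis by (simp add: mult.assoc)
  qed
  then show ?thesis by blast
qed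

subsection \<open>Functionals that kill all translates of a function\<close>

lemma vector_lipschitz:
  fixes f :: "real \<Rightarrow> complex"
  assumes "\<And>z. z \<in> closed_segment x y \<Longrightarrow> (f has_vector_derivative f' z) (at z)"
    and "\<And>z. z \<in> closed_segment x y \<Longrightarrow> norm (f' z) \<le> B"
  shows "norm (f y - f x) \<le> B * \<bar>y - x\<bar>"
proof -
  have "B \<ge> 0" using order_trans[OF norm_ge_zero assms(2)[of x]] by simp
  have "norm (f y - f x) \<le> B * norm (y - x)"
  proof (rule differentiable_bound[where S = "closed_segment x y" and f' = "\<lambda>z h. h *\<^sub>R f' z"])
    show "(f has_derivative (\<lambda>h. h *\<^sub>R f' z)) (at z within closed_segment x y)" if "z \<in> closed_segment x y" for z
      using assms(1)[OF that] unfolding has_vector_derivative_def by (rule has_derivative_at_withinI)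
    show "onorm (\<lambda>h. h *\<^sub>R f' z) \<le> B" if "z \<in> closed_segment x y" for z
    proof (rule onorm_bound[OF \<open>B \<ge> 0\<close>])
      show "norm (h *\<^sub>R f' z) \<le> B * norm h" for h
        using mult_right_mono[OF assms(2)[OF that], of "norm h"] by (simp add: mult.commute)
    qed
  qed auto
  then show ?thesis by simp
qed

lemma closed_segment_near:
  fixes x y z :: real
  assumes "z \<in> closed_segment x y"
  shows "\<bar>z - x\<bar> \<le> \<bar>y - x\<bar>" "\<bar>z\<bar> \<le> \<bar>x\<bar> + \<bar>y - x\<bar>"
  using assms by (auto simp: closed_segment_eq_real_ivl split: if_splits)

lemma F_space_lipschitz:
  assumes H: "H \<in> F_space m" and C: "\<And>x. norm (nth_deriv (Suc n) H x) \<le> C * exp (real m * \<bar>x\<bar>)" "C \<ge> 0"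
    and "\<bar>y - x\<bar> \<le> 1"
  shows "norm (nth_deriv n H y - nth_deriv n H x) \<le> C * exp (real m * (\<bar>x\<bar> + 1)) * \<bar>y - x\<bar>"
proof (rule vector_lipschitz)
  show "(nth_deriv n H has_vector_derivative nth_deriv (Suc n) H z) (at z)" for z
    by (rule smooth_on_has_vector_derivative[OF F_space_smooth[OF H]]) simp
  fix z assume "z \<in> closed_segment x y"
  then have "\<bar>z\<bar> \<le> \<bar>x\<bar> + 1" using closed_segment_near(2)[of z x y] assms(4) by linarith
  then have "C * exp (real m * \<bar>z\<bar>) \<le> C * exp (real m * (\<bar>x\<bar> + 1))"
    using C(2) by (intro mult_left_mono) (auto intro: mult_left_mono)
  then show "norm (nth_deriv (Suc n) H z) \<le> C * exp (real m * (\<bar>x\<bar> + 1))"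
    using C(1)[of z] by linarith
qed

lemma F_space_taylor:
  assumes H: "H \<in> F_space m" and C: "\<And>x. norm (nth_deriv (Suc (Suc 0)) H x) \<le> C * exp (real m * \<bar>x\<bar>)" "C \<ge> 0"
    and "\<bar>d\<bar> \<le> 1"
  shows "norm (H (x + d) - H x - of_real d * nth_deriv (Suc 0) H x) \<le> C * exp (real m * (\<bar>x\<bar> + 1)) * d\<^sup>2"
proof -
  have "norm (H (x + d) - H x - (x + d - x) *\<^sub>R nth_deriv (Suc 0) H x)
      \<le> norm (x + d - x) * (C * exp (real m * (\<bar>x\<bar> + 1)) * \<bar>d\<bar>)"
  proof (rule vector_differentiable_bound_linearization[where S = "closed_segment x (x + d)"])
    show "(H has_vector_derivative nth_deriv (Suc 0) H z) (at z within closed_segment x (x + d))" for z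
      using smooth_on_has_vector_derivative[OF F_space_smooth[OF H], of z 0]
      by (simp add: has_vector_derivative_at_within)
    fix z assume "z \<in> closed_segment x (x + d)"
    then have z: "\<bar>z - x\<bar> \<le> \<bar>d\<bar>" using closed_segment_near(1)[of z x "x + d"] by simp
    then have "norm (nth_deriv (Suc 0) H z - nth_deriv (Suc 0) H x) \<le> C * exp (real m * (\<bar>x\<bar> + 1)) * \<bar>z - x\<bar>"
      using assms(4) by (intro F_space_lipschitz[OF H C]) auto
    also have "\<dots> \<le> C * exp (real m * (\<bar>x\<bar> + 1)) * \<bar>d\<bar>"
      using z C(2) by (intro mult_left_mono) auto
    finally show "norm (nth_deriv (Suc 0) H z - nth_deriv (Suc 0) H x) \<le> C * exp (real m * (\<bar>x\<bar> + 1)) * \<bar>d\<bar>" .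
  qed auto
  then show ?thesis
    by (simp add: scaleR_conv_of_real power2_eq_square mult_ac)
qed

lemma F_space_continuous:
  assumes "H \<in> F_space m"
  shows "continuous_on UNIV H"
  using smooth_on_has_vector_derivative[OF F_space_smooth[OF assms], of _ 0]
  by (auto intro!: continuous_at_imp_continuous_on has_vector_derivative_continuous)

text \<open>A superposition, with weights \<open>g v\<close>, of the translates t \<mapsto> H (v -
  t), which are the functions that an annihilator of \<open>H\<close> kills.\<close>

definition kernel_conv :: "(real \<Rightarrow> complex) \<Rightarrow> (real \<Rightarrow> complex) \<Rightarrow> real \<Rightarrow> complex" where
  "kernel_conv g H t = (LINT v|lebesgue. g v * H (v - t))"

definition exp_weighted :: "nat \<Rightarrow> (real \<Rightarrow> complex) \<Rightarrow> bool" where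
  "exp_weighted m g \<longleftrightarrow> g \<in> borel_measurable lebesgue \<and> integrable lebesgue (\<lambda>v. norm (g v) * exp (real m * \<bar>v\<bar>))"

abbreviation exp_norm :: "nat \<Rightarrow> (real \<Rightarrow> complex) \<Rightarrow> real" where
  "exp_norm m g \<equiv> LINT v|lebesgue. norm (g v) * exp (real m * \<bar>v\<bar>)"

lemma exp_abs_diff_le: "exp (real m * \<bar>v - t\<bar>) \<le> exp (real m * \<bar>v\<bar>) * exp (real m * \<bar>t\<bar>)"
proof -
  have "real m * \<bar>v - t\<bar> \<le> real m * (\<bar>v\<bar> + \<bar>t\<bar>)" by (intro mult_left_mono) auto
  then show ?thesis by (simp add: distrib_left flip: exp_add)
qed

lemma kernel_dominated:
  assumes "exp_weighted m g" and k: "k \<in> borel_measurable lebesgue"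
    and "\<And>v. norm (k v) \<le> C * exp (real m * \<bar>v - t\<bar>)"
  shows "integrable lebesgue (\<lambda>v. g v * k v)"
    and "norm (LINT v|lebesgue. g v * k v) \<le> C * exp_norm m g * exp (real m * \<bar>t\<bar>)"
proof -
  have "C \<ge> 0" using order_trans[OF norm_ge_zero assms(3)[of t]] by simp
  have g [measurable]: "g \<in> borel_measurable lebesgue"
    and gi: "integrable lebesgue (\<lambda>v. norm (g v) * exp (real m * \<bar>v\<bar>))"
    using assms(1) by (auto simp: exp_weighted_def)
  note k [measurable]
  have I: "integrable lebesgue (\<lambda>v. C * exp (real m * \<bar>t\<bar>) * (norm (g v) * exp (real m * \<bar>v\<bar>)))"
    using gi by (rule integrable_mult_right)
  have le: "norm (g v * k v) \<le> C * exp (real m * \<bar>t\<bar>) * (norm (g v) * exp (real m * \<bar>v\<bar>))" for v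
  proof -
    have "norm (k v) \<le> C * (exp (real m * \<bar>v\<bar>) * exp (real m * \<bar>t\<bar>))"
      using \<open>C \<ge> 0\<close> by (intro order_trans[OF assms(3)] mult_left_mono exp_abs_diff_le)
    from mult_left_mono[OF this, of "norm (g v)"] show ?thesis
      by (simp add: norm_mult mult_ac)
  qed
  show int: "integrable lebesgue (\<lambda>v. g v * k v)"
  proof (rule Bochner_Integration.integrable_bound[OF I])
    show "(\<lambda>v. g v * k v) \<in> borel_measurable lebesgue" by measurable
    show "AE v in lebesgue. norm (g v * k v) \<le> norm (C * exp (real m * \<bar>t\<bar>) * (norm (g v) * exp (real m * \<bar>v\<bar>)))"
      unfolding real_norm_def by (intro AE_I2 order_trans[OF le abs_ge_self])
  qed
  have "norm (LINT v|lebesgue. g v * k v) \<le> (LINT v|lebesgue. C * exp (real m * \<bar>t\<bar>) * (norm (g v) * exp (real m * \<bar>v\<bar>)))"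
    by (rule Bochner_Integration.integral_norm_bound_integral[OF int I le])
  also have "\<dots> = C * exp (real m * \<bar>t\<bar>) * exp_norm m g"
    by (rule integral_mult_right_zero)
  finally show "norm (LINT v|lebesgue. g v * k v) \<le> C * exp_norm m g * exp (real m * \<bar>t\<bar>)"
    by (simp add: mult_ac)
qed

lemma F_space_shift_measurable:
  assumes "H \<in> F_space m"
  shows "(\<lambda>v. H (v - t)) \<in> borel_measurable lebesgue"
  by (intro continuous_imp_lebesgue_measurable continuous_on_compose2[OF F_space_continuous[OF assms]] continuous_intros) auto

lemma kernel_conv_integrable:
  assumes "exp_weighted m g" "H \<in> F_space m"
  shows "integrable lebesgue (\<lambda>v. g v * H (v - t))"
proof -
  obtain C where "\<And>x. norm (H x) \<le> C * exp (real m * \<bar>x\<bar>)"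
    using F_space_uniform_bound[OF assms(2), of 0] by auto
  then show ?thesis
    by (intro kernel_dominated(1)[OF assms(1)] F_space_shift_measurable[OF assms(2)]) auto
qed

lemma kernel_conv_has_vector_derivative:
  assumes g: "exp_weighted m g" and H: "H \<in> F_space m"
  shows "(kernel_conv g H has_vector_derivative - kernel_conv g (nth_deriv (Suc 0) H) t) (at t)"
proof -
  let ?H' = "nth_deriv (Suc 0) H"
  have H': "?H' \<in> F_space m" using H by (rule F_space_nth_deriv)
  obtain C where C: "C \<ge> 0" "\<And>x. norm (nth_deriv (Suc (Suc 0)) H x) \<le> C * exp (real m * \<bar>x\<bar>)"
    using F_space_uniform_bound[OF H, of "Suc (Suc 0)"] by auto
  let ?I = "LINT v|lebesgue. norm (g v) * exp (real m * \<bar>v\<bar>)"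
  show ?thesis
    unfolding has_vector_derivative_def
  proof (rule has_derivative_from_quadratic_bound[where d = 1 and K = "C * exp (real m) * ?I * exp (real m * \<bar>t\<bar>)"])
    fix d :: real assume d: "norm d < 1"
    let ?k = "\<lambda>v. H (v - (t + d)) - H (v - t) + of_real d * ?H' (v - t)"
    have meas: "?k \<in> borel_measurable lebesgue"
      by (intro borel_measurable_add borel_measurable_diff borel_measurable_times F_space_shift_measurable[OF H]
          F_space_shift_measurable[OF H']) simp
    have bd: "norm (?k v) \<le> C * exp (real m) * d\<^sup>2 * exp (real m * \<bar>v - t\<bar>)" for v
      using F_space_taylor[OF H C(2,1), of "- d" "v - t"] d
      by (simp add: algebra_simps exp_add)
    have int: "integrable lebesgue (\<lambda>v. g v * H (v - (t + d)))" "integrable lebesgue (\<lambda>v. g v * H (v - t))"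
      "integrable lebesgue (\<lambda>v. of_real d * (g v * ?H' (v - t)))"
      by (intro kernel_conv_integrable[OF g] integrable_mult_right H H')+
    have eq: "kernel_conv g H (t + d) - kernel_conv g H t - d *\<^sub>R - kernel_conv g ?H' t = (LINT v|lebesgue. g v * ?k v)"
    proof -
      have "(LINT v|lebesgue. g v * ?k v)
          = (LINT v|lebesgue. (g v * H (v - (t + d)) - g v * H (v - t)) + of_real d * (g v * ?H' (v - t)))"
        by (simp add: algebra_simps)
      also have "\<dots> = (LINT v|lebesgue. g v * H (v - (t + d)) - g v * H (v - t)) + (LINT v|lebesgue. of_real d * (g v * ?H' (v - t)))"
        by (rule Bochner_Integration.integral_add[OF Bochner_Integration.integrable_diff[OF int(1,2)] int(3)])
      also have "(LINT v|lebesgue. g v * H (v - (t + d)) - g v * H (v - t)) = kernel_conv g H (t + d) - kernel_conv g H t"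
        unfolding kernel_conv_def by (rule Bochner_Integration.integral_diff[OF int(1,2)])
      also have "(LINT v|lebesgue. of_real d * (g v * ?H' (v - t))) = of_real d * kernel_conv g ?H' t"
        unfolding kernel_conv_def by (rule integral_mult_right_zero)
      finally show ?thesis by (simp add: scaleR_conv_of_real)
    qed
    show "norm (kernel_conv g H (t + d) - kernel_conv g H t - d *\<^sub>R - kernel_conv g ?H' t)
        \<le> C * exp (real m) * ?I * exp (real m * \<bar>t\<bar>) * (norm d)\<^sup>2"
      unfolding eq using kernel_dominated(2)[OF g meas bd] by (simp add: mult_ac)
  qed (rule bounded_linear_scaleR_left, simp)
qed

lemma
  assumes g: "exp_weighted m g" and H: "H \<in> F_space m"
  shows nth_deriv_kernel_conv: "nth_deriv n (kernel_conv g H) t = (- 1) ^ n * kernel_conv g (nth_deriv n H) t"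
    and kernel_conv_F_space: "kernel_conv g H \<in> F_space m"
proof -
  have step: "((\<lambda>t. (- 1) ^ n * kernel_conv g (nth_deriv n H) t) has_vector_derivative
      (- 1) ^ Suc n * kernel_conv g (nth_deriv (Suc n) H) t) (at t)" for n t
  proof -
    have "((\<lambda>t. (- 1) ^ n * kernel_conv g (nth_deriv n H) t) has_vector_derivative
      (- 1) ^ n * - kernel_conv g (nth_deriv (Suc 0) (nth_deriv n H)) t) (at t)"
      by (intro has_vector_derivative_mult_right kernel_conv_has_vector_derivative[OF g] F_space_nth_deriv H)
    then show ?thesis by (simp add: nth_deriv_add)
  qed
  have nth: "nth_deriv n (kernel_conv g H) t = (- 1) ^ n * kernel_conv g (nth_deriv n H) t" for n t
    by (rule nth_deriv_eqI[of UNIV _ "\<lambda>n t. (- 1) ^ n * kernel_conv g (nth_deriv n H) t"]) (use step in auto)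
  then show "nth_deriv n (kernel_conv g H) t = (- 1) ^ n * kernel_conv g (nth_deriv n H) t" .
  have "smooth_on UNIV (kernel_conv g H)"
    by (rule smooth_onI[of UNIV _ "\<lambda>n t. (- 1) ^ n * kernel_conv g (nth_deriv n H) t"]) (use step in auto)
  moreover have "\<exists>C. \<forall>t. norm (nth_deriv n (kernel_conv g H) t) \<le> C * exp (real m * \<bar>t\<bar>)" for n
  proof -
    obtain C where "\<And>x. norm (nth_deriv n H x) \<le> C * exp (real m * \<bar>x\<bar>)"
      using H unfolding F_space_iff by blast
    then have "norm (kernel_conv g (nth_deriv n H) t) \<le> C * exp_norm m g * exp (real m * \<bar>t\<bar>)" for t
      unfolding kernel_conv_def
      by (intro kernel_dominated(2)[OF g] F_space_shift_measurable[OF F_space_nth_deriv[OF H]])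
    then show ?thesis unfolding nth by (auto simp: norm_mult norm_power)
  qed
  ultimately show "kernel_conv g H \<in> F_space m" unfolding F_space_iff by blast
qed

lemma
  assumes H: "H \<in> F_space m"
  shows nth_deriv_reflect: "nth_deriv n (\<lambda>t. H (x - t)) t = (- 1) ^ n * nth_deriv n H (x - t)"
    and F_space_reflect: "(\<lambda>t. H (x - t)) \<in> F_space m"
proof -
  have step: "((\<lambda>t. (- 1) ^ n * nth_deriv n H (x - t)) has_vector_derivative
      (- 1) ^ Suc n * nth_deriv (Suc n) H (x - t)) (at t)" for n t
  proof -
    have "((\<lambda>t. x - t) has_vector_derivative - 1) (at t)"
      by (auto intro!: derivative_eq_intros)
    then have "(nth_deriv n H \<circ> (\<lambda>t. x - t) has_vector_derivative - 1 *\<^sub>R nth_deriv (Suc n) H (x - t)) (at t)"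
      by (rule vector_diff_chain_at) (rule smooth_on_has_vector_derivative[OF F_space_smooth[OF H] UNIV_I])
    then have "((\<lambda>t. (- 1) ^ n * nth_deriv n H (x - t)) has_vector_derivative
      (- 1) ^ n * (- 1 *\<^sub>R nth_deriv (Suc n) H (x - t))) (at t)"
      unfolding o_def by (rule has_vector_derivative_mult_right)
    then show ?thesis by simp
  qed
  have nth: "nth_deriv n (\<lambda>t. H (x - t)) t = (- 1) ^ n * nth_deriv n H (x - t)" for n t
    by (rule nth_deriv_eqI[of UNIV _ "\<lambda>n t. (- 1) ^ n * nth_deriv n H (x - t)"]) (use step in auto)
  then show "nth_deriv n (\<lambda>t. H (x - t)) t = (- 1) ^ n * nth_deriv n H (x - t)" .
  have "smooth_on UNIV (\<lambda>t. H (x - t))"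
    by (rule smooth_onI[of UNIV _ "\<lambda>n t. (- 1) ^ n * nth_deriv n H (x - t)"]) (use step in auto)
  moreover have "\<exists>C. \<forall>t. norm (nth_deriv n (\<lambda>t. H (x - t)) t) \<le> C * exp (real m * \<bar>t\<bar>)" for n
  proof -
    obtain C where C: "C \<ge> 0" "\<And>x. norm (nth_deriv n H x) \<le> C * exp (real m * \<bar>x\<bar>)"
      using F_space_uniform_bound[OF H, of n] by auto
    have "norm (nth_deriv n H (x - t)) \<le> C * exp (real m * \<bar>x\<bar>) * exp (real m * \<bar>t\<bar>)" for t
      using C(1) mult_left_mono[OF exp_abs_diff_le[of m x t] C(1)] order_trans[OF C(2)[of "x - t"]] by (simp add: mult.assoc)
    then show ?thesis unfolding nth by (auto simp: norm_mult norm_power)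
  qed
  ultimately show "(\<lambda>t. H (x - t)) \<in> F_space m" unfolding F_space_iff by blast
qed

section \<open>From killed translates to killed superpositions\<close>

text \<open>All derivatives of a superposition fall on \<open>H\<close>, so it stays in
  \<open>F_space m\<close>. The bound by a weighted L1 norm makes distant pieces of the kernel
  negligible.\<close>

lemma exp_functional_kernel_bound:
  assumes \<Phi>: "exp_functional \<Phi>" "m \<ge> 1" and H: "H \<in> F_space m"
  shows "\<exists>A\<ge>0. \<forall>g. exp_weighted m g \<longrightarrow>
    norm (\<Phi> (kernel_conv g H)) \<le> A * exp_norm m g"
proof -
  obtain N C where C: "C \<ge> 0" "\<And>f B. f \<in> F_space m \<Longrightarrow> B \<ge> 0 \<Longrightarrow>
      (\<And>n x. n \<le> N \<Longrightarrow> norm (nth_deriv n f x) \<le> B * exp (real m * \<bar>x\<bar>)) \<Longrightarrow> norm (\<Phi> f) \<le> C * B"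
    using exp_functional_bounded[OF \<Phi>] by metis
  obtain D where D: "D \<ge> 0" "\<And>n x. n \<le> N \<Longrightarrow> norm (nth_deriv n H x) \<le> D * exp (real m * \<bar>x\<bar>)"
    using F_space_uniform_bound[OF H, of N] by blast
  have "norm (\<Phi> (kernel_conv g H)) \<le> C * D * exp_norm m g"
    if g: "exp_weighted m g" for g
  proof -
    have "norm (\<Phi> (kernel_conv g H)) \<le> C * (D * exp_norm m g)"
    proof (rule C(2)[OF kernel_conv_F_space[OF g H]])
      show "0 \<le> D * exp_norm m g"
        using D(1) by simp
      fix n x assume "n \<le> N"
      have "norm (kernel_conv g (nth_deriv n H) x)
          \<le> D * exp_norm m g * exp (real m * \<bar>x\<bar>)"
        unfolding kernel_conv_def
        by (intro kernel_dominated(2)[OF g] F_space_shift_measurable[OF F_space_nth_deriv[OF H]] D(2) \<open>n \<le> N\<close>)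
      then show "norm (nth_deriv n (kernel_conv g H) x)
          \<le> D * exp_norm m g * exp (real m * \<bar>x\<bar>)"
        unfolding nth_deriv_kernel_conv[OF g H] by (simp add: norm_mult norm_power)
    qed
    then show ?thesis by (simp add: mult.assoc)
  qed
  then show ?thesis
    using C(1) D(1) by (intro exI[of _ "C * D"]) auto
qed

text \<open>If \<open>\<Phi>\<close> kills all the translates \<open>t \<mapsto> H (x - t)\<close>, a kernel supported on an interval of length
  \<open>y - x\<close> contributes only to first order: subtract the translate at \<open>x\<close>.\<close>

lemma exp_functional_short_kernel:
  assumes \<Phi>: "exp_functional \<Phi>" "m \<ge> 1" and H: "H \<in> F_space m"
    and kill: "\<And>x. \<Phi> (\<lambda>t. H (x - t)) = 0"
  shows "\<exists>A\<ge>0. \<forall>p x y. exp_weighted m p \<longrightarrow> x \<le> y \<longrightarrow> y \<le> x + 1 \<longrightarrow> (\<forall>v. v \<notin> {x<..y} \<longrightarrow> p v = 0) \<longrightarrow>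
    norm (\<Phi> (kernel_conv p H)) \<le> A * (y - x) * exp_norm m p"
proof -
  obtain N C where C: "C \<ge> 0" "\<And>f B. f \<in> F_space m \<Longrightarrow> B \<ge> 0 \<Longrightarrow>
      (\<And>n x. n \<le> N \<Longrightarrow> norm (nth_deriv n f x) \<le> B * exp (real m * \<bar>x\<bar>)) \<Longrightarrow> norm (\<Phi> f) \<le> C * B"
    using exp_functional_bounded[OF \<Phi>] by metis
  \<comment> \<open>One derivative more than the functional sees, for the Lipschitz bounds on the
    derivatives of order up to \<open>N\<close>.\<close>
  obtain D where D: "D \<ge> 0" "\<And>n x. n \<le> Suc N \<Longrightarrow> norm (nth_deriv n H x) \<le> D * exp (real m * \<bar>x\<bar>)"
    using F_space_uniform_bound[OF H, of "Suc N"] by blast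
  have "norm (\<Phi> (kernel_conv p H)) \<le> C * (D * exp (2 * real m)) * (y - x) * exp_norm m p"
    if p: "exp_weighted m p" and xy: "x \<le> y" "y \<le> x + 1" and supp: "\<And>v. v \<notin> {x<..y} \<Longrightarrow> p v = 0" for p x y
  proof -
    define I where "I = exp_norm m p"
    \<comment> \<open>Total mass of \<open>p\<close>. Subtracting \<open>c\<close> times the killed
      translate at \<open>x\<close> does not change the value of \<open>\<Phi>\<close> and replaces
      H (v - t) by its increment from H (x - t).\<close>
    define c where "c = (LINT v|lebesgue. p v)"
    let ?f = "\<lambda>t. kernel_conv p H t - c * H (x - t)"
    have "I \<ge> 0" unfolding I_def by simp
    have pm: "p \<in> borel_measurable lebesgue"
      and pi: "integrable lebesgue (\<lambda>v. norm (p v) * exp (real m * \<bar>v\<bar>))"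
      using p by (auto simp: exp_weighted_def)
    have p_int: "integrable lebesgue p"
    proof (rule Bochner_Integration.integrable_bound[OF pi pm]; intro AE_I2)
      show "norm (p v) \<le> norm (norm (p v) * exp (real m * \<bar>v\<bar>))" for v
        using mult_left_mono[of 1 "exp (real m * \<bar>v\<bar>)" "norm (p v)"] by simp
    qed
    have K: "kernel_conv p H \<in> F_space m" by (rule kernel_conv_F_space[OF p H])
    have R: "(\<lambda>t. H (x - t)) \<in> F_space m" by (rule F_space_reflect[OF H])
    have f: "?f \<in> F_space m"
      using F_space_lincomb[OF K R, of 1 "- c"] by simp
    have "\<Phi> (kernel_conv p H) = \<Phi> ?f"
      using exp_functional_linear[OF \<Phi>(1) C_expI[OF K] C_expI[OF R], of 1 "- c"] kill[of x] by simp
    also have "norm \<dots> \<le> C * (D * exp (2 * real m) * (y - x) * I)"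
    proof (rule C(2)[OF f])
      show "0 \<le> D * exp (2 * real m) * (y - x) * I" using D(1) xy \<open>I \<ge> 0\<close> by simp
      fix n t assume n: "n \<le> N"
      let ?Hn = "nth_deriv n H"
      let ?E = "\<lambda>v. D * exp (2 * real m) * exp (real m * \<bar>t\<bar>) * (y - x) * (norm (p v) * exp (real m * \<bar>v\<bar>))"
      have Hn: "?Hn \<in> F_space m" by (rule F_space_nth_deriv[OF H])
      have eq: "kernel_conv p ?Hn t - c * ?Hn (x - t) = (LINT v|lebesgue. p v * (?Hn (v - t) - ?Hn (x - t)))"
        unfolding kernel_conv_def c_def right_diff_distrib
        by (simp only: Bochner_Integration.integral_diff[OF kernel_conv_integrable[OF p Hn] integrable_mult_left[OF p_int]]
            integral_mult_left_zero)
      have le: "norm (p v * (?Hn (v - t) - ?Hn (x - t)))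
          \<le> ?E v" for v
      proof (cases "v \<in> {x<..y}")
        case True
        have "norm (?Hn (x - t) - ?Hn (v - t)) \<le> D * exp (real m * (\<bar>v - t\<bar> + 1)) * \<bar>(x - t) - (v - t)\<bar>"
          using True xy n by (intro F_space_lipschitz[OF H D(2) D(1)]) auto
        also have "\<dots> \<le> D * (exp (2 * real m) * (exp (real m * \<bar>v\<bar>) * exp (real m * \<bar>t\<bar>))) * (y - x)"
        proof (intro mult_mono mult_left_mono)
          have "exp (real m * (\<bar>v - t\<bar> + 1)) = exp (real m) * exp (real m * \<bar>v - t\<bar>)"
            by (simp add: distrib_left add.commute flip: exp_add)
          also have "\<dots> \<le> exp (2 * real m) * (exp (real m * \<bar>v\<bar>) * exp (real m * \<bar>t\<bar>))"
            by (intro mult_mono exp_abs_diff_le) auto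
          finally show "exp (real m * (\<bar>v - t\<bar> + 1)) \<le> exp (2 * real m) * (exp (real m * \<bar>v\<bar>) * exp (real m * \<bar>t\<bar>))" .
        qed (use True D(1) in auto)
        finally have "norm (p v) * norm (?Hn (x - t) - ?Hn (v - t))
            \<le> norm (p v) * (D * (exp (2 * real m) * (exp (real m * \<bar>v\<bar>) * exp (real m * \<bar>t\<bar>))) * (y - x))"
          by (intro mult_left_mono) auto
        then show ?thesis by (simp add: norm_mult norm_minus_commute mult_ac)
      qed (simp add: supp)
      have "norm (nth_deriv n ?f t) = norm (kernel_conv p ?Hn t - c * ?Hn (x - t))"
      proof -
        have "nth_deriv n ?f t = (- 1) ^ n * (kernel_conv p ?Hn t - c * ?Hn (x - t))"
          using nth_deriv_lincomb[OF F_space_smooth[OF K] F_space_smooth[OF R], of n 1 "- c" t]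
          by (simp add: nth_deriv_kernel_conv[OF p H] nth_deriv_reflect[OF H] algebra_simps)
        then show ?thesis by (simp add: norm_mult norm_power)
      qed
      also have "\<dots> \<le> (LINT v|lebesgue. ?E v)"
        unfolding eq
      proof (rule Bochner_Integration.integral_norm_bound_integral[OF _ _ le])
        show "integrable lebesgue (\<lambda>v. p v * (?Hn (v - t) - ?Hn (x - t)))"
          unfolding right_diff_distrib
          by (intro Bochner_Integration.integrable_diff kernel_conv_integrable[OF p Hn] integrable_mult_left p_int)
        show "integrable lebesgue (\<lambda>v. ?E v)"
          using pi by (rule integrable_mult_right)
      qed
      also have "\<dots> = D * exp (2 * real m) * exp (real m * \<bar>t\<bar>) * (y - x) * I"
        unfolding I_def by (rule integral_mult_right_zero)
      finally show "norm (nth_deriv n ?f t) \<le> D * exp (2 * real m) * (y - x) * I * exp (real m * \<bar>t\<bar>)"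
        by (simp add: mult_ac)
    qed
    finally show ?thesis unfolding I_def by (simp add: mult.assoc)
  qed
  then show ?thesis
    using C(1) D(1) by (intro exI[of _ "C * (D * exp (2 * real m))"]) auto
qed

text \<open>Formally \<open>\<Phi>\<close> passes under the integral over \<open>v\<close> and meets
  only zeros. In place of an exchange theorem the kernel is cut off at a point x: as a function of x
  the value of \<open>\<Phi>\<close> has increments of second order, hence is constant; it tends to
  0 at the left end and to the full value at the right end.\<close>

lemma exp_functional_kernel_zero:
  assumes \<Phi>: "exp_functional \<Phi>" "m \<ge> 1" and H: "H \<in> F_space m"
    and kill: "\<And>x. \<Phi> (\<lambda>t. H (x - t)) = 0"
    and g: "g \<in> borel_measurable lebesgue"
    and decay: "\<And>v. norm (g v) * exp (real m * \<bar>v\<bar>) \<le> M * exp (- 1 * \<bar>v\<bar>)"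
  shows "\<Phi> (kernel_conv g H) = 0"
proof -
  have "M \<ge> 0" using order_trans[OF _ decay[of 0]] by simp
  define r where "r S v = (if v \<in> S then g v else 0)" for S v
  have r_meas: "r S \<in> borel_measurable lebesgue" if "S \<in> sets lebesgue" for S
    unfolding r_def[abs_def] using that g by (intro measurable_If_set) auto
  have r_le: "norm (r S v) * exp (real m * \<bar>v\<bar>) \<le> M * exp (- 1 * \<bar>v\<bar>)" for S v
    using decay[of v] \<open>M \<ge> 0\<close> by (simp add: r_def)
  have r_w: "exp_weighted m (r S)" if S: "S \<in> sets lebesgue" for S
    unfolding exp_weighted_def
  proof (intro conjI r_meas[OF S])
    have [measurable]: "(\<lambda>v. exp (real m * \<bar>v\<bar>)) \<in> borel_measurable lebesgue"
      by (intro continuous_imp_lebesgue_measurable continuous_intros)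
    note r_meas[OF S, measurable]
    have "integrable lebesgue (\<lambda>v. M * exp (- 1 * \<bar>v\<bar>))"
      by (intro integrable_mult_right integrable_exp_minus_abs) simp
    moreover have "(\<lambda>v. norm (r S v) * exp (real m * \<bar>v\<bar>)) \<in> borel_measurable lebesgue" by measurable
    ultimately show "integrable lebesgue (\<lambda>v. norm (r S v) * exp (real m * \<bar>v\<bar>))"
    proof (rule Bochner_Integration.integrable_bound; intro AE_I2)
      show "norm (norm (r S v) * exp (real m * \<bar>v\<bar>)) \<le> norm (M * exp (- 1 * \<bar>v\<bar>))" for v
        using r_le[of S v] \<open>M \<ge> 0\<close> by (simp add: abs_mult)
    qed
  qed
  have K_C: "kernel_conv (r S) H \<in> C_exp" if "S \<in> sets lebesgue" for S
    by (rule C_expI[OF kernel_conv_F_space[OF r_w[OF that] H]])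
  have K_diff: "\<Phi> (kernel_conv (r S) H) - \<Phi> (kernel_conv (r T) H) = \<Phi> (kernel_conv (r (S - T)) H)"
    if S: "S \<in> sets lebesgue" and T: "T \<in> sets lebesgue" and "T \<subseteq> S" for S T
  proof -
    have "kernel_conv (r S) H t - kernel_conv (r T) H t = kernel_conv (r (S - T)) H t" for t
    proof -
      have "r S v * H (v - t) - r T v * H (v - t) = r (S - T) v * H (v - t)" for v
        using \<open>T \<subseteq> S\<close> by (auto simp: r_def)
      then show ?thesis
        unfolding kernel_conv_def
        using Bochner_Integration.integral_diff[OF kernel_conv_integrable[OF r_w[OF S] H] kernel_conv_integrable[OF r_w[OF T] H], of t t]
        by simp
    qed
    then show ?thesis
      using exp_functional_diff[OF \<Phi>(1) K_C[OF S] K_C[OF T]] by simp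
  qed
  define u where "u x = \<Phi> (kernel_conv (r {..x}) H)" for x
  obtain A where A: "A \<ge> 0" "\<And>g. exp_weighted m g \<Longrightarrow>
    norm (\<Phi> (kernel_conv g H)) \<le> A * exp_norm m g"
    using exp_functional_kernel_bound[OF \<Phi> H] by blast
  obtain A' where A': "A' \<ge> 0" "\<And>p x y. exp_weighted m p \<Longrightarrow> x \<le> y \<Longrightarrow> y \<le> x + 1 \<Longrightarrow> (\<And>v. v \<notin> {x<..y} \<Longrightarrow> p v = 0) \<Longrightarrow>
    norm (\<Phi> (kernel_conv p H)) \<le> A' * (y - x) * exp_norm m p"
    using exp_functional_short_kernel[OF \<Phi> H kill] by metis
  \<comment> \<open>One factor y - x comes from the short kernel estimate, the other from the
    weighted mass of \<open>g\<close> on the interval.\<close>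
  have step: "norm (u y - u x) \<le> A' * M * (y - x)\<^sup>2" if xy: "x \<le> y" "y \<le> x + 1" for x y
  proof -
    have int_le: "exp_norm m (r {x<..y}) \<le> M * (y - x)"
    proof -
      have "exp_norm m (r {x<..y}) \<le> (LINT v|lebesgue. M * indicat_real {x<..y} v)"
      proof (rule integral_mono)
        show "integrable lebesgue (\<lambda>v. norm (r {x<..y} v) * exp (real m * \<bar>v\<bar>))"
          using r_w[of "{x<..y}"] by (simp add: exp_weighted_def)
        show "integrable lebesgue (\<lambda>v. M * indicat_real {x<..y} v)"
          using xy by (intro integrable_mult_right integrable_real_indicator) (auto simp: emeasure_lborel_Ioc)
        show "norm (r {x<..y} v) * exp (real m * \<bar>v\<bar>) \<le> M * indicat_real {x<..y} v" for v
        proof (cases "v \<in> {x<..y}")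
          case True
          have "M * exp (- 1 * \<bar>v\<bar>) \<le> M * 1" using \<open>M \<ge> 0\<close> by (intro mult_left_mono) auto
          then show ?thesis using r_le[of "{x<..y}" v] True by simp
        qed (auto simp: r_def)
      qed
      also have "\<dots> = M * (y - x)" using xy by simp
      finally show ?thesis .
    qed
    have "u y - u x = \<Phi> (kernel_conv (r ({..y} - {..x})) H)"
      unfolding u_def using xy by (intro K_diff) auto
    also have "{..y} - {..x} = {x<..y}" by auto
    also have "norm (\<Phi> (kernel_conv (r {x<..y}) H)) \<le> A' * (y - x) * exp_norm m (r {x<..y})"
      using xy by (intro A'(2) r_w) (auto simp: r_def)
    also have "\<dots> \<le> A' * (y - x) * (M * (y - x))"
      using A'(1) xy int_le by (intro mult_left_mono) auto
    finally show ?thesis by (simp add: power2_eq_square mult_ac)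
  qed
  have "(u has_derivative (\<lambda>_. 0)) (at x within UNIV)" for x
  proof (rule has_derivative_from_quadratic_bound[where d = 1 and K = "A' * M"])
    fix h :: real assume "norm h < 1"
    then show "norm (u (x + h) - u x - 0) \<le> A' * M * (norm h)\<^sup>2"
      using step[of x "x + h"] step[of "x + h" x] by (cases "h \<ge> 0") (auto simp: norm_minus_commute)
  qed auto
  then obtain c where c: "\<And>x. u x = c"
    using has_derivative_zero_constant[of UNIV u] by auto
  \<comment> \<open>The decay exp (- |v|) is shared: one half makes the tail small, the other keeps
    it integrable.\<close>
  define J :: real where "J = (LINT v|lebesgue. exp (- (1 / 2) * \<bar>v :: real\<bar>))"
  have J_int: "integrable lebesgue (\<lambda>v. exp (- (1 / 2) * \<bar>v :: real\<bar>))"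
    by (rule integrable_exp_minus_abs) simp
  have tail: "norm (\<Phi> (kernel_conv (r S) H)) \<le> A * (M * exp (- n / 2) * J)"
    if S: "S \<in> sets lebesgue" and far: "\<And>v. v \<in> S \<Longrightarrow> n \<le> \<bar>v\<bar>" for S n
  proof -
    have "exp_norm m (r S) \<le> (LINT v|lebesgue. M * exp (- n / 2) * exp (- (1 / 2) * \<bar>v\<bar>))"
    proof (rule integral_mono)
      show "integrable lebesgue (\<lambda>v. norm (r S v) * exp (real m * \<bar>v\<bar>))"
        using r_w[OF S] by (simp add: exp_weighted_def)
      show "integrable lebesgue (\<lambda>v. M * exp (- n / 2) * exp (- (1 / 2) * \<bar>v\<bar>))"
        using J_int by (rule integrable_mult_right)
      show "norm (r S v) * exp (real m * \<bar>v\<bar>) \<le> M * exp (- n / 2) * exp (- (1 / 2) * \<bar>v\<bar>)" for v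
      proof (cases "v \<in> S")
        case True
        have "exp (- 1 * \<bar>v\<bar>) \<le> exp (- n / 2) * exp (- (1 / 2) * \<bar>v\<bar>)"
          unfolding exp_add[symmetric] using far[OF True] by simp
        then have "M * exp (- 1 * \<bar>v\<bar>) \<le> M * (exp (- n / 2) * exp (- (1 / 2) * \<bar>v\<bar>))"
          using \<open>M \<ge> 0\<close> by (rule mult_left_mono)
        then show ?thesis using r_le[of S v] by (simp add: mult.assoc)
      qed (use \<open>M \<ge> 0\<close> in \<open>simp add: r_def\<close>)
    qed
    also have "\<dots> = M * exp (- n / 2) * J"
      unfolding J_def by (rule integral_mult_right_zero)
    finally show ?thesis
      using A(1) by (intro order_trans[OF A(2)[OF r_w[OF S]]] mult_left_mono)
  qed
  have r_UNIV: "r UNIV = g" by (simp add: r_def[abs_def])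
  have "norm (\<Phi> (kernel_conv g H)) \<le> 2 * (A * M * J) * exp (- real n / 2)" for n
  proof -
    have left: "norm (u (- real n)) \<le> A * (M * exp (- real n / 2) * J)"
      unfolding u_def by (rule tail) auto
    have rest: "\<Phi> (kernel_conv (r UNIV) H) - u (real n) = \<Phi> (kernel_conv (r (UNIV - {..real n})) H)"
      unfolding u_def by (rule K_diff) auto
    have right: "norm (\<Phi> (kernel_conv (r (UNIV - {..real n})) H)) \<le> A * (M * exp (- real n / 2) * J)"
      by (rule tail) auto
    \<comment> \<open>As \<open>u\<close> is constant, its value at n may be replaced by the one at
      - n, and only two tails remain.\<close>
    have "\<Phi> (kernel_conv g H) = \<Phi> (kernel_conv (r (UNIV - {..real n})) H) + u (- real n)"
      using rest c[of "real n"] c[of "- real n"] by (simp add: r_UNIV algebra_simps)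
    then have "norm (\<Phi> (kernel_conv g H)) \<le> A * (M * exp (- real n / 2) * J) + A * (M * exp (- real n / 2) * J)"
      using order_trans[OF norm_triangle_ineq add_mono[OF right left]] by simp
    also have "\<dots> = 2 * (A * M * J) * exp (- real n / 2)"
      by (simp add: mult_ac)
    finally show ?thesis .
  qed
  moreover have "(\<lambda>n. 2 * (A * M * J) * exp (- real n / 2)) \<longlonglongrightarrow> 0"
  proof -
    have "(\<lambda>n. 2 * (A * M * J) * exp (- 1 / 2) ^ n) \<longlonglongrightarrow> 2 * (A * M * J) * 0"
      by (intro tendsto_mult tendsto_const LIMSEQ_power_zero) simp
    then show ?thesis by (simp flip: exp_of_nat_mult)
  qed
  ultimately have "norm (\<Phi> (kernel_conv g H)) \<le> 0"
    by (intro LIMSEQ_le_const) auto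
  then show ?thesis by simp
qed

subsection \<open>Mean-periodicity with respect to functions of polynomial growth\<close>

text \<open>In the variable x the function is exp (s * Ln x - q * (Ln x)^2), holomorphic on the
  right half plane. Cauchy's estimates on discs of radius x / 2 reduce all derivatives to bounds by
  arbitrary powers of x, which the squared logarithm provides.\<close>

lemma gauss_schwartz:
  assumes "q > 0"
  shows "from_exp (\<lambda>t. gauss q s (of_real t)) \<in> schwartz"
proof -
  let ?g = "from_exp (\<lambda>t. gauss q s (of_real t))"
  define f where "f z = exp (s * Ln z - of_real q * (Ln z)\<^sup>2)" for z
  define U where "U = {z. Re z > 0}"
  have U: "open U" unfolding U_def by (rule open_halfspace_Re_gt)
  have f: "f holomorphic_on U"
    unfolding f_def[abs_def] U_def
    by (intro holomorphic_intros) (auto simp: complex_nonpos_Reals_iff)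
  have base: "?g x = (deriv ^^ 0) f (of_real x)" if "x \<in> {0<..}" for x
    using that by (simp add: from_exp_def on_pos_def gauss_def f_def Ln_of_real)
  have step: "((\<lambda>x. (deriv ^^ n) f (of_real x)) has_vector_derivative (deriv ^^ Suc n) f (of_real x)) (at x)"
    if "x \<in> {0<..}" for n x
  proof -
    have "(deriv ^^ n) f holomorphic_on U"
      using f U by (rule holomorphic_higher_deriv)
    then have "((deriv ^^ n) f has_field_derivative (deriv ^^ Suc n) f (of_real x)) (at (of_real x))"
      using holomorphic_derivI[OF _ U] that by (simp add: U_def)
    then show ?thesis
      by (rule has_vector_derivative_real_field)
  qed
  have bd: "\<exists>C. \<forall>x>0. \<forall>z. norm (of_real x - z) = x / 2 \<longrightarrow> norm (f z) \<le> C * x powi M" for M :: int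
  proof (intro exI allI impI)
    \<comment> \<open>\<open>?k\<close> collects what multiplies |l|, and completing the square
      removes it. The other summands come from the bounds 2 for the argument of z (as pi / 2 < 2)
      and ln 2 for |l - ln x|, since |z| is within a factor 2 of x.\<close>
    let ?k = "norm s + \<bar>of_int M\<bar>"
    let ?c = "?k\<^sup>2 / (4 * q) + norm s * 2 + q * 4 + \<bar>of_int M\<bar> * ln 2"
    fix x :: real and z :: complex assume "x > 0" and z: "norm (of_real x - z) = x / 2"
    have "\<bar>x - Re z\<bar> \<le> x / 2" using abs_Re_le_cmod[of "of_real x - z"] z by simp
    then have "Re z > 0" using \<open>x > 0\<close> by linarith
    then have "z \<noteq> 0" by auto
    define l where "l = Re (Ln z)"
    define \<theta> where "\<theta> = Im (Ln z)"
    have \<theta>: "\<bar>\<theta>\<bar> \<le> 2"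
      using Re_Ln_pos_lt[OF \<open>z \<noteq> 0\<close>] \<open>Re z > 0\<close> pi_less_4 unfolding \<theta>_def by linarith
    have norm_z: "x / 2 \<le> norm z" "norm z \<le> 2 * x"
    proof -
      have "\<bar>x - norm z\<bar> \<le> x / 2"
        using norm_triangle_ineq3[of "of_real x" z] z \<open>x > 0\<close> by simp
      then show "x / 2 \<le> norm z" "norm z \<le> 2 * x" using \<open>x > 0\<close> by linarith+
    qed
    have l: "l = ln (norm z)" unfolding l_def using \<open>z \<noteq> 0\<close> by simp
    have "ln (x / 2) \<le> l" "l \<le> ln (2 * x)"
      unfolding l using norm_z \<open>x > 0\<close> \<open>z \<noteq> 0\<close> by (simp_all add: ln_mono)
    then have near: "\<bar>l - ln x\<bar> \<le> ln 2"
      using \<open>x > 0\<close> by (simp add: ln_div ln_mult)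
    have "Re (s * Ln z - of_real q * (Ln z)\<^sup>2) = Re s * l - Im s * \<theta> - q * l\<^sup>2 + q * \<theta>\<^sup>2"
      by (simp add: l_def \<theta>_def power2_eq_square algebra_simps)
    moreover have "Re s * l \<le> norm s * \<bar>l\<bar>"
    proof -
      have "Re s * l \<le> \<bar>Re s\<bar> * \<bar>l\<bar>" using abs_ge_self[of "Re s * l"] by (simp add: abs_mult)
      also have "\<dots> \<le> norm s * \<bar>l\<bar>" by (intro mult_right_mono abs_Re_le_cmod) auto
      finally show ?thesis .
    qed
    moreover have "- Im s * \<theta> \<le> norm s * 2"
    proof -
      have "- Im s * \<theta> \<le> \<bar>Im s\<bar> * \<bar>\<theta>\<bar>" using abs_ge_self[of "- Im s * \<theta>"] by (simp add: abs_mult)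
      also have "\<dots> \<le> norm s * 2" using \<theta> by (intro mult_mono abs_Im_le_cmod) auto
      finally show ?thesis .
    qed
    moreover have "q * \<theta>\<^sup>2 \<le> q * 4"
    proof -
      have "\<bar>\<theta>\<bar>\<^sup>2 \<le> 2\<^sup>2" using \<theta> by (intro power_mono) auto
      then show ?thesis using assms by (intro mult_left_mono) auto
    qed
    moreover have "- of_int M * ln x \<le> \<bar>of_int M\<bar> * \<bar>l\<bar> + \<bar>of_int M\<bar> * ln 2"
    proof -
      have "- of_int M * ln x \<le> \<bar>of_int M\<bar> * \<bar>ln x\<bar>" using abs_ge_self[of "- of_int M * ln x"] by (simp add: abs_mult)
      also have "\<dots> \<le> \<bar>of_int M\<bar> * (\<bar>l\<bar> + ln 2)" using near by (intro mult_left_mono) auto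
      finally show ?thesis by (simp add: distrib_left)
    qed
    moreover have "?k * \<bar>l\<bar> - q * l\<^sup>2 \<le> ?k\<^sup>2 / (4 * q)"
      using quadratic_le[OF assms, of ?k "\<bar>l\<bar>"] by simp
    ultimately have "Re (s * Ln z - of_real q * (Ln z)\<^sup>2)
        \<le> (?c) + of_int M * ln x"
      unfolding distrib_right by linarith
    then have "norm (f z) \<le> exp (?c) * exp (of_int M * ln x)"
      unfolding f_def norm_exp_eq_Re exp_add[symmetric] by simp
    also have "exp (of_int M * ln x) = x powi M"
      using exp_power_int[of "ln x" M] \<open>x > 0\<close> by simp
    finally show "norm (f z) \<le> exp (?c) * x powi M" .
  qed
  have nth: "nth_deriv n (?g) x = (deriv ^^ n) f (of_real x)" if "x \<in> {0<..}" for n x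
    by (rule nth_deriv_eqI[OF open_greaterThan base step that])
  have "bdd_above ((\<lambda>x. x powi m * norm (nth_deriv n (?g) x)) ` {0<..})" for m :: int and n
  proof -
    \<comment> \<open>The power n - m compensates both the weight x^m and the loss x^(- n) in
      Cauchy's estimate.\<close>
    obtain C where C: "\<And>x z. x > 0 \<Longrightarrow> norm (of_real x - z) = x / 2 \<Longrightarrow> norm (f z) \<le> C * x powi (int n - m)"
      using bd by blast
    have "x powi m * norm ((deriv ^^ n) f (of_real x)) \<le> fact n * C * 2 ^ n" if "x > 0" for x
    proof -
      have sub: "cball (of_real x) (x / 2) \<subseteq> U"
      proof
        fix z :: complex assume "z \<in> cball (of_real x) (x / 2)"
        then have "\<bar>x - Re z\<bar> \<le> x / 2" using abs_Re_le_cmod[of "of_real x - z"] by (simp add: dist_norm)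
        then show "z \<in> U" using that unfolding U_def by (simp, linarith)
      qed
      have "norm ((deriv ^^ n) f (of_real x)) \<le> fact n * (C * x powi (int n - m)) / (x / 2) ^ n"
      proof (rule Cauchy_inequality)
        show "f holomorphic_on ball (of_real x) (x / 2)"
          by (rule holomorphic_on_subset[OF f order_trans[OF ball_subset_cball sub]])
        show "continuous_on (cball (of_real x) (x / 2)) f"
          by (rule holomorphic_on_imp_continuous_on[OF holomorphic_on_subset[OF f sub]])
      qed (use C that in auto)
      then have "x powi m * norm ((deriv ^^ n) f (of_real x)) \<le> x powi m * (fact n * (C * x powi (int n - m)) / (x / 2) ^ n)"
        using that by (intro mult_left_mono) auto
      also have "\<dots> = fact n * C * 2 ^ n * ((x powi m * x powi (int n - m)) / x ^ n)"
        by (simp add: power_divide)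
      also have "x powi m * x powi (int n - m) = x ^ n"
        using that by (simp flip: power_int_add)
      finally show ?thesis using that by simp
    qed
    then show ?thesis
      by (intro bdd_aboveI[of _ "fact n * C * 2 ^ n"]) (auto simp: nth)
  qed
  moreover have "smooth_on {0<..} (?g)"
    by (rule smooth_onI[OF open_greaterThan base step])
  ultimately show ?thesis
    unfolding schwartz_def by (simp add: from_exp_def on_pos_def fun_eq_iff)
qed

lemma eq_if_linear_bounds:
  fixes a b :: complex
  assumes "\<forall>q\<in>{0<..1}. norm (x q - a) \<le> C * q" "\<forall>q\<in>{0<..1}. norm (x q - b) \<le> D * q"
  shows "a = b"
proof -
  have bd: "norm (a - b) \<le> (C + D) * (1 / real (Suc n))" for n
  proof -
    have q: "1 / real (Suc n) \<in> {0<..1}" by simp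
    have "norm (a - b) \<le> norm (x (1 / real (Suc n)) - a) + norm (x (1 / real (Suc n)) - b)"
      using norm_triangle_ineq4[of "x (1 / real (Suc n)) - b" "x (1 / real (Suc n)) - a"]
      by (simp add: norm_minus_commute add.commute)
    also have "\<dots> \<le> C * (1 / real (Suc n)) + D * (1 / real (Suc n))"
      using assms[THEN bspec, OF q] by (intro add_mono)
    finally show ?thesis by (simp only: distrib_right)
  qed
  have "(\<lambda>n. (C + D) * (1 / real (Suc n))) \<longlonglongrightarrow> (C + D) * 0"
    by (intro tendsto_mult tendsto_const LIMSEQ_Suc[OF lim_1_over_n])
  with bd have "norm (a - b) \<le> (C + D) * 0"
    by (intro LIMSEQ_le_const) auto
  then show ?thesis by simp
qed

text \<open>For Gaussians the pairing property of \<open>\<psi>\<close> and the vanishing on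
  superpositions are exact identities. Both sides approach their values at exponentials with an
  error linear in q, so the limits agree.\<close>

lemma Mellin_Carleman_via_C_poly:
  fixes h :: "real \<Rightarrow> real"
  assumes C_poly: "on_pos (\<lambda>x. of_real (h x)) \<in> C_poly" and fe: "\<forall>x>0. h (1 / x) = - \<epsilon> * x * h x"
    and \<phi>: "\<phi> \<in> C_poly_annihilators (\<lambda>x. of_real (h x))"
    and \<psi>: "is_dual_conv \<phi> (plus_part (\<lambda>x. of_real (h x))) \<psi>"
  defines "Hp \<equiv> pos_part (\<lambda>u. h (exp (- u)))"
    and "A \<equiv> mellin_dual \<psi>" and "B \<equiv> mellin_dual \<phi>"
  shows "A holomorphic_on UNIV \<and> B holomorphic_on UNIV \<and>
    (\<exists>a. (\<forall>\<sigma>>a. laplace_abs Hp \<sigma>) \<and> (\<forall>s. Re s > a \<longrightarrow> A s = B s * laplace Hp s) \<and>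
      (\<forall>s. Re s < 1 - a \<longrightarrow> A s = of_real \<epsilon> * B s * laplace Hp (1 - s)))"
proof -
  define \<Phi> where "\<Phi> f = \<phi> (from_exp f)" for f
  define \<Psi> where "\<Psi> f = \<psi> (from_exp f)" for f
  define H where "H t = complex_of_real (h (exp (- t)))" for t
  let ?P = "\<lambda>q s f. \<Phi> (\<lambda>t. gauss_conv q s f (of_real t))"
  define Hm where "Hm u = (- of_real \<epsilon>) * (exp (of_real u) * Hp (- u))" for u
  have \<Phi>: "exp_functional \<Phi>" and \<Psi>: "exp_functional \<Psi>"
    using \<phi> \<psi> unfolding \<Phi>_def[abs_def] \<Psi>_def[abs_def] C_poly_annihilators_def is_dual_conv_def
    by (auto intro: exp_functional_from_dual)
  have powr_eq: "on_pos (\<lambda>x. of_real x powr s) = from_exp (\<lambda>t. exp (- s * of_real t))" for s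
  proof
    fix x :: real
    show "on_pos (\<lambda>x. of_real x powr s) x = from_exp (\<lambda>t. exp (- s * of_real t)) x"
      using of_real_exp_powr[of "- ln x" s] by (cases "x > 0") (simp_all add: from_exp_def on_pos_def)
  qed
  have A_eq: "A s = \<Psi> (\<lambda>t. exp (- s * of_real t))" and B_eq: "B s = \<Phi> (\<lambda>t. exp (- s * of_real t))" for s
    unfolding A_def B_def mellin_dual_def powr_eq \<Phi>_def \<Psi>_def by auto
  have hol: "A holomorphic_on UNIV" "B holomorphic_on UNIV"
    using functional_exp_holomorphic[OF \<Psi>] functional_exp_holomorphic[OF \<Phi>]
    by (simp_all add: A_eq[abs_def] B_eq[abs_def])
  have "(\<lambda>t. on_pos (\<lambda>x. of_real (h x)) (exp (- t))) = H"
    by (simp add: on_pos_def H_def fun_eq_iff)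
  then have "H \<in> C_exp" using C_poly by (simp add: C_poly_def)
  then obtain m where m: "m \<ge> 1" and H: "H \<in> F_space m"
    unfolding C_exp_iff by blast
  have kill: "\<Phi> (\<lambda>t. H (x - t)) = 0" for x
  proof -
    have "from_exp (\<lambda>t. H (x - t)) = on_pos (\<lambda>y. of_real (h (exp (- x) / y)))"
      by (auto simp: from_exp_def on_pos_def H_def fun_eq_iff exp_diff exp_minus divide_inverse mult.commute)
    moreover have "\<phi> (on_pos (\<lambda>y. of_real (h (exp (- x) / y)))) = 0"
      using \<phi> unfolding C_poly_annihilators_def by simp
    ultimately show ?thesis by (simp add: \<Phi>_def)
  qed
  obtain C where C: "\<And>u. norm (H u) \<le> C * exp (real m * \<bar>u\<bar>)"
    using H unfolding F_space_iff by (metis nth_deriv_0)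
  have "C \<ge> 0" using order_trans[OF norm_ge_zero C[of 0]] by simp
  have H_meas [measurable]: "H \<in> borel_measurable lebesgue"
    by (intro continuous_imp_lebesgue_measurable F_space_continuous[OF H])
  have Hp_H: "Hp u = (if u > 0 then H u else 0)" for u
    by (simp add: Hp_def pos_part_def H_def)
  have Hp_abs: "laplace_abs Hp \<sigma>" if "\<sigma> > real m" for \<sigma>
  proof (rule laplace_absI)
    show "Hp \<in> borel_measurable lebesgue" unfolding Hp_H[abs_def] by measurable
    show "integrable lebesgue (\<lambda>u. C * exp (- (\<sigma> - real m) * \<bar>u\<bar>))"
      using that by (intro integrable_mult_right integrable_exp_minus_abs) simp
    show "norm (Hp u) * exp (- \<sigma> * u) \<le> C * exp (- (\<sigma> - real m) * \<bar>u\<bar>)" for u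
    proof (cases "u > 0")
      case True
      then have "norm (Hp u) * exp (- \<sigma> * u) \<le> C * exp (real m * \<bar>u\<bar>) * exp (- \<sigma> * u)"
        unfolding Hp_H using C[of u] by (auto intro: mult_right_mono)
      also have "\<dots> = C * exp (- (\<sigma> - real m) * \<bar>u\<bar>)"
        using True by (simp add: mult.assoc algebra_simps flip: exp_add)
      finally show ?thesis .
    qed (use \<open>C \<ge> 0\<close> in \<open>simp add: Hp_H\<close>)
  qed
  have Hm_abs: "laplace_abs Hm \<sigma>" if "\<sigma> < 1 - real m" for \<sigma>
    unfolding Hm_def using that Hp_abs by (intro laplace_abs_reflect) auto
  have H_split: "H u = Hp u + Hm u" if "u \<noteq> 0" for u
    unfolding H_def Hp_def Hm_def by (rule additive_functional_equation[OF fe that])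
  \<comment> \<open>The pairing property of \<open>\<psi>\<close> is available only for Schwartz
    functions, and the regularized exponential is one.\<close>
  have gauss_dual: "\<Psi> (\<lambda>t. gauss q s (of_real t)) = ?P q s Hp" if "q > 0" for q s
  proof -
    let ?g = "from_exp (\<lambda>t. gauss q s (of_real t))"
    have "\<psi> ?g = \<phi> (on_pos (\<lambda>y. LINT x:{0<..}|lebesgue. ?g (x * y) * plus_part (\<lambda>x. of_real (h x)) x / of_real x))"
      using \<psi> gauss_schwartz[OF that] unfolding is_dual_conv_def by blast
    also have "on_pos (\<lambda>y. LINT x:{0<..}|lebesgue. ?g (x * y) * plus_part (\<lambda>x. of_real (h x)) x / of_real x)
        = from_exp (\<lambda>t. gauss_conv q s Hp (of_real t))"
    proof
      fix y :: real
      show "on_pos (\<lambda>y. LINT x:{0<..}|lebesgue. ?g (x * y) * plus_part (\<lambda>x. of_real (h x)) x / of_real x) y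
          = from_exp (\<lambda>t. gauss_conv q s Hp (of_real t)) y"
      proof (cases "y > 0")
        case True
        have shift: "?g (exp (- u) * y) = gauss q s (of_real (- ln y) + of_real u)" for u
          using True by (simp add: from_exp_def on_pos_def ln_mult)
        have "(LINT x:{0<..}|lebesgue. ?g (x * y) * plus_part (\<lambda>x. of_real (h x)) x / of_real x)
            = (LINT u|lebesgue. ?g (exp (- u) * y) * Hp u)"
          unfolding integral_exp_substitution[of "\<lambda>x. ?g (x * y) * plus_part (\<lambda>x. of_real (h x)) x"] plus_part_exp Hp_def ..
        also have "\<dots> = gauss_conv q s Hp (of_real (- ln y))"
          unfolding shift gauss_conv_def ..
        finally show ?thesis
          using True by (simp add: from_exp_def on_pos_def)
      qed (simp add: from_exp_def on_pos_def)
    qed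
    finally show ?thesis by (simp add: \<Psi>_def \<Phi>_def)
  qed
  have gauss_cancel: "?P q s Hp = - ?P q s Hm" if q: "q > 0" for q s
  proof -
    have Lp: "laplace_abs Hp (real m + 1)" and Lm: "laplace_abs Hm (- real m)"
      using Hp_abs Hm_abs by auto
    let ?g = "\<lambda>v. gauss q s (of_real v)"
    have cont: "continuous_on UNIV (\<lambda>u. gauss q s (z + of_real u))" for z
      unfolding gauss_def by (intro continuous_intros)
    have sum: "gauss_conv q s Hp (of_real t) + gauss_conv q s Hm (of_real t) = kernel_conv ?g H t" for t
    proof -
      let ?G = "\<lambda>u. gauss q s (of_real t + of_real u)"
      note I = gauss_conv_integrable[OF Lp q, of s "of_real t"] gauss_conv_integrable[OF Lm q, of s "of_real t"]
      have "gauss_conv q s Hp (of_real t) + gauss_conv q s Hm (of_real t)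
          = (LINT u|lebesgue. ?G u * Hp u + ?G u * Hm u)"
        unfolding gauss_conv_def by (rule Bochner_Integration.integral_add[OF I, symmetric])
      also have "\<dots> = (LINT u|lebesgue. ?G u * H u)"
      proof (rule integral_cong_nonzero)
        show "(\<lambda>u. ?G u * Hp u + ?G u * Hm u) \<in> borel_measurable lebesgue"
          using I by (intro borel_measurable_add) auto
        show "?G u * Hp u + ?G u * Hm u = ?G u * H u" if "u \<noteq> 0" for u
          unfolding H_split[OF that] by (rule distrib_left[symmetric])
      qed
      \<comment> \<open>Substituting u = v - t turns the Gaussian at t + u into a kernel in
        \<open>v\<close> alone, applied to translates of \<open>H\<close>.\<close>
      also have "\<dots> = (LINT v|lebesgue. gauss q s (of_real t + of_real (- t + 1 * v)) * H (- t + 1 * v))"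
        using lebesgue_integral_real_affine[of 1 "\<lambda>u. ?G u * H u" "- t"] by simp
      also have "\<dots> = kernel_conv ?g H t"
        by (simp add: kernel_conv_def)
      finally show ?thesis .
    qed
    \<comment> \<open>The rates m + 1 and - (m + 1) together give two-sided decay exp (- (m + 1) *
      |v|), one unit more than the weight of \<open>F_space m\<close> consumes.\<close>
    obtain M1 where M1: "M1 \<ge> 0" "\<And>w. \<bar>Im w\<bar> \<le> 1 \<Longrightarrow> norm (gauss q s w) \<le> M1 * exp (- (real m + 1) * Re w)"
      using gauss_bound[OF q] by blast
    obtain M2 where M2: "M2 \<ge> 0" "\<And>w. \<bar>Im w\<bar> \<le> 1 \<Longrightarrow> norm (gauss q s w) \<le> M2 * exp (- (- (real m + 1)) * Re w)"
      using gauss_bound[OF q] by blast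
    have "\<Phi> (kernel_conv ?g H) = 0"
    proof (rule exp_functional_kernel_zero[OF \<Phi> m H kill])
      show "?g \<in> borel_measurable lebesgue"
        using continuous_imp_lebesgue_measurable[OF cont[of 0]] by simp
      fix v :: real
      have "norm (?g v) \<le> (M1 + M2) * exp (- (real m + 1) * \<bar>v\<bar>)"
      proof (cases "v \<ge> 0")
        case True
        have "norm (?g v) \<le> M1 * exp (- (real m + 1) * \<bar>v\<bar>)" using M1(2)[of "of_real v"] True by simp
        also have "\<dots> \<le> (M1 + M2) * exp (- (real m + 1) * \<bar>v\<bar>)" using M2(1) by (intro mult_right_mono) auto
        finally show ?thesis .
      next
        case False
        have "norm (?g v) \<le> M2 * exp (- (real m + 1) * \<bar>v\<bar>)" using M2(2)[of "of_real v"] False by (simp add: algebra_simps)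
        also have "\<dots> \<le> (M1 + M2) * exp (- (real m + 1) * \<bar>v\<bar>)" using M1(1) by (intro mult_right_mono) auto
        finally show ?thesis .
      qed
      then have "norm (?g v) * exp (real m * \<bar>v\<bar>) \<le> (M1 + M2) * exp (- (real m + 1) * \<bar>v\<bar>) * exp (real m * \<bar>v\<bar>)"
        by (rule mult_right_mono) simp
      also have "\<dots> = (M1 + M2) * exp (- 1 * \<bar>v\<bar>)"
        by (simp add: mult.assoc algebra_simps flip: exp_add)
      finally show "norm (?g v) * exp (real m * \<bar>v\<bar>) \<le> (M1 + M2) * exp (- 1 * \<bar>v\<bar>)" .
    qed
    then have "\<Phi> (\<lambda>t. 1 * gauss_conv q s Hp (of_real t) + 1 * gauss_conv q s Hm (of_real t)) = 0"
      unfolding mult_1 sum .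
    then have "?P q s Hp + ?P q s Hm = 0"
      using exp_functional_linear[OF \<Phi> gauss_conv_C_exp[OF Lp q, of s] gauss_conv_C_exp[OF Lm q, of s], of 1 1] by simp
    then show ?thesis by (simp add: eq_neg_iff_add_eq_0)
  qed
  have right: "A s = B s * laplace Hp s" if "Re s > real m" for s
  proof -
    \<comment> \<open>Half the distance to the boundary keeps both Re s - \<eta> and Re s + \<eta>
      in the range of absolute convergence.\<close>
    define \<eta> where "\<eta> = (Re s - real m) / 2"
    have \<eta>: "\<eta> > 0" "Re s - \<eta> > real m" "Re s + \<eta> > real m" using that by (auto simp: \<eta>_def field_simps)
    obtain C1 where C1: "\<forall>q\<in>{0<..1}. norm (\<Psi> (\<lambda>t. gauss q s (of_real t)) - A s) \<le> C1 * q"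
      unfolding A_eq using gauss_approx[OF \<Psi>] by blast
    obtain C2 where "\<forall>q\<in>{0<..1}. norm (?P q s Hp - B s * laplace Hp s) \<le> C2 * q"
      unfolding B_eq using gauss_conv_approx[OF \<Phi> \<eta>(1) Hp_abs[OF \<eta>(2)] Hp_abs[OF \<eta>(3)]] by blast
    then have "\<forall>q\<in>{0<..1}. norm (\<Psi> (\<lambda>t. gauss q s (of_real t)) - B s * laplace Hp s) \<le> C2 * q"
      by (simp add: gauss_dual)
    with C1 show ?thesis by (rule eq_if_linear_bounds)
  qed
  have left: "A s = of_real \<epsilon> * B s * laplace Hp (1 - s)" if "Re s < 1 - real m" for s
  proof -
    define \<eta> where "\<eta> = (1 - real m - Re s) / 2"
    have \<eta>: "\<eta> > 0" "Re s - \<eta> < 1 - real m" "Re s + \<eta> < 1 - real m" using that by (auto simp: \<eta>_def field_simps)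
    obtain C1 where C1: "\<forall>q\<in>{0<..1}. norm (\<Psi> (\<lambda>t. gauss q s (of_real t)) - A s) \<le> C1 * q"
      unfolding A_eq using gauss_approx[OF \<Psi>] by blast
    obtain C2 where C2: "\<forall>q\<in>{0<..1}. norm (?P q s Hm - B s * laplace Hm s) \<le> C2 * q"
      unfolding B_eq using gauss_conv_approx[OF \<Phi> \<eta>(1) Hm_abs[OF \<eta>(2)] Hm_abs[OF \<eta>(3)]] by blast
    have "\<forall>q\<in>{0<..1}. norm (\<Psi> (\<lambda>t. gauss q s (of_real t)) - (- (B s * laplace Hm s))) \<le> C2 * q"
    proof
      fix q :: real assume q: "q \<in> {0<..1}"
      then have "norm (\<Psi> (\<lambda>t. gauss q s (of_real t)) - (- (B s * laplace Hm s)))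
          = norm (?P q s Hm - B s * laplace Hm s)"
        by (simp add: gauss_dual gauss_cancel norm_minus_commute)
      with C2 q show "norm (\<Psi> (\<lambda>t. gauss q s (of_real t)) - (- (B s * laplace Hm s))) \<le> C2 * q" by simp
    qed
    with C1 have "A s = - (B s * laplace Hm s)" by (rule eq_if_linear_bounds)
    also have "laplace Hm s = - of_real \<epsilon> * laplace Hp (1 - s)"
      unfolding Hm_def by (rule laplace_reflect)
    finally show ?thesis by simp
  qed
  show ?thesis using hol Hp_abs right left by blast
qed

section \<open>The strip containing the poles\<close>

theorem proposition4p10:
  fixes Z MC :: "complex \<Rightarrow> complex" and h :: "real \<Rightarrow> real" and w \<delta> \<epsilon> :: real
  assumes "in_class_F w Z"
    and "\<epsilon> \<in> {1, -1}"
    and "C_poly_mean_periodic (\<lambda>x. of_real (h x)) \<or>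
         schwartz_dual_mean_periodic (\<lambda>x. of_real (h x))"
    and "\<forall>x>0. h (1 / x) = - \<epsilon> * x * h x"
    and "\<exists>t0>0. (\<forall>t>t0. h (exp (- t)) \<ge> 0) \<or> (\<forall>t>t0. h (exp (- t)) \<le> 0)"
    and "is_MC (\<lambda>x. of_real (h x)) MC"
    and "0 \<le> \<delta>" and "\<delta> < w"
    and "\<forall>x::real. x > 1/2 + \<delta> \<longrightarrow> \<not> is_pole MC (of_real x)"
  shows "(\<forall>s. is_pole MC s \<longrightarrow> \<bar>Re s - 1/2\<bar> \<le> \<delta>) \<and>
         ((\<forall>x::real. x > 1/2 \<longrightarrow> \<not> is_pole MC (of_real x)) \<longrightarrow>
            (\<forall>s. is_pole MC s \<longrightarrow> Re s = 1/2))"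
proof -
  let ?h = "\<lambda>x. complex_of_real (h x)"
  let ?H = "\<lambda>u. h (exp (- u))"
  \<comment> \<open>Both kinds of annihilator lead to the same data: entire functions
    \<open>A\<close> and \<open>B\<close> with the two half-plane identities.\<close>
  have "\<exists>A B. MC = (\<lambda>s. A s / B s) \<and> A holomorphic_on UNIV \<and> B holomorphic_on UNIV \<and>
    (\<exists>a. (\<forall>\<sigma>>a. laplace_abs (pos_part ?H) \<sigma>) \<and> (\<forall>s. Re s > a \<longrightarrow> A s = B s * laplace (pos_part ?H) s) \<and>
      (\<forall>s. Re s < 1 - a \<longrightarrow> A s = of_real \<epsilon> * B s * laplace (pos_part ?H) (1 - s)))"
    using assms(6) unfolding is_MC_def
  proof (elim disjE conjE bexE exE)
    fix \<phi> assume "tempered ?h" "\<phi> \<in> schwartz_annihilators ?h"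
      "MC = (\<lambda>s. mellin (mconv \<phi> (plus_part ?h)) s / mellin \<phi> s)"
    then show ?thesis using Mellin_Carleman_via_schwartz[OF _ assms(4)] by blast
  next
    fix \<phi> \<psi> assume "on_pos ?h \<in> C_poly" "\<phi> \<in> C_poly_annihilators ?h" "is_dual_conv \<phi> (plus_part ?h) \<psi>"
      "MC = (\<lambda>s. mellin_dual \<psi> s / mellin_dual \<phi> s)"
    then show ?thesis using Mellin_Carleman_via_C_poly[OF _ assms(4)] by blast
  qed
  then obtain A B a where MC: "MC = (\<lambda>s. A s / B s)"
    and hol: "A holomorphic_on UNIV" "B holomorphic_on UNIV"
    and a: "\<And>\<sigma>. \<sigma> > a \<Longrightarrow> laplace_abs (pos_part ?H) \<sigma>"
    and right: "\<And>s. Re s > a \<Longrightarrow> A s = B s * laplace (pos_part ?H) s"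
    and left: "\<And>s. Re s < 1 - a \<Longrightarrow> A s = of_real \<epsilon> * B s * laplace (pos_part ?H) (1 - s)"
    by blast
  obtain t0 where t0: "t0 > 0" "(\<forall>t>t0. ?H t \<ge> 0) \<or> (\<forall>t>t0. ?H t \<le> 0)"
    using assms(5) by blast
  \<comment> \<open>Formulated for arbitrary \<open>b\<close>, as it is applied with 1/2 + \<delta>
    and with 1/2; the bounds 1 - b and b are symmetric about 1/2.\<close>
  have strip: "1 - b \<le> Re s \<and> Re s \<le> b"
    if "\<And>x. x > b \<Longrightarrow> \<not> is_pole MC (of_real x)" "is_pole MC s" for b s
    using poles_in_strip[of a ?H t0 A B "of_real \<epsilon>" b s] a t0 hol right left that
    unfolding MC pos_part_def[abs_def] by blast
  have "\<bar>Re s - 1/2\<bar> \<le> \<delta>" if "is_pole MC s" for s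
    using strip[of "1/2 + \<delta>" s] assms(9) that by auto
  moreover have "Re s = 1/2" if "\<forall>x::real. x > 1/2 \<longrightarrow> \<not> is_pole MC (of_real x)" "is_pole MC s" for s
    using strip[of "1/2" s] that by auto
  ultimately show ?thesis by blast
qed

end
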